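(* Let $k$ be a field, $R$ a (standard graded) Koszul $k$-algebra and $M$ a finitely generated graded $R$-module. The module $M$ is Koszul if and only if it is componentwise linear.
   Context: A standard graded $k$-algebra is a commutative graded ring $R=\bigoplus_{i\ge0}R_i$ with $R_0=k$, $\mathrm{rank}_kR_1$ finite and $R=k[R_1]$; $\mathfrak m=\bigoplus_{i\ge1}R_i$. For a finitely generated graded $R$-module $M$ with minimal graded free resolution $F$, let $\mathcal F^iF\subseteq F$ be the subcomplex with $(\mathcal F^iF)_n=\mathfrak m^{i-n}F_n$ (with $\mathfrak m^j=R$ for $j\le0$); the linear part of $F$ is $\mathrm{lin}^RF=\bigoplus_i\mathcal F^iF/\mathcal F^{i+1}F$, and $\mathrm{ld}_RM=\sup\{i:H_i(\mathrm{lin}^RF)\ne0\}$. $M$ is Koszul if $\mathrm{ld}_RM=0$, and $R$ is Koszul if $\mathrm{ld}_Rk=0$ (equivalently, $k$ has a linear resolution over $R$). Let $\beta^R_{n,j}(M)=\dim_k\mathrm{Tor}^R_n(k,M)_j$. $M$ has an $i$-linear resolution if $\beta^R_{n,n+r}(M)=0$ for all $n$ and all $r\ne i$. For $i\in\mathbb Z$, $M_{\langle i\rangle}$ denotes the submodule of $M$ generated by $M_i$. $M$ is componentwise linear if $M_{\langle i\rangle}$ has an $i$-linear resolution for each $i$. *)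

theory Defs
  imports
    "HOL-Library.Poly_Mapping"
    "HOL-Library.Set_Algebras"
    "HOL-Library.Extended_Nat"
begin

section \<open>Graded algebras and graded modules\<close>

definition additive_subgroup :: "'a::ab_group_add set \<Rightarrow> bool" where
  "additive_subgroup V \<longleftrightarrow> 0 \<in> V \<and> (\<forall>x\<in>V. \<forall>y\<in>V. x + y \<in> V) \<and> (\<forall>x\<in>V. - x \<in> V)"

definition family_sum :: "'i set \<Rightarrow> ('i \<Rightarrow> 'a::ab_group_add set) \<Rightarrow> 'a set" where
  "family_sum I V = {\<Sum>i\<in>J. f i | J f. finite J \<and> J \<subseteq> I \<and> (\<forall>i\<in>J. f i \<in> V i)}"

definition internal_direct_sum :: "'a::ab_group_add set \<Rightarrow> ('i \<Rightarrow> 'a set) \<Rightarrow> bool" where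
  "internal_direct_sum X V \<longleftrightarrow>
     (\<forall>i. additive_subgroup (V i)) \<and>
     X = family_sum UNIV V \<and>
     (\<forall>J f. finite J \<and> (\<forall>i\<in>J. f i \<in> V i) \<and> (\<Sum>i\<in>J. f i) = 0 \<longrightarrow> (\<forall>i\<in>J. f i = 0))"

definition generated_subalgebra :: "('k::field \<Rightarrow> 'r::comm_ring_1) \<Rightarrow> 'r set \<Rightarrow> 'r set" where
  "generated_subalgebra \<iota> X =
     \<Inter> {S. range \<iota> \<subseteq> S \<and> X \<subseteq> S \<and> (\<forall>x\<in>S. \<forall>y\<in>S. x + y \<in> S \<and> x * y \<in> S)}"

text \<open>The type \<open>'r\<close> is the ring \<open>R\<close>, \<open>A i\<close> is \<open>R\<^sub>i\<close>, and \<open>\<iota>\<close> is the structure map identifying \<open>k\<close> with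
  \<open>R\<^sub>0\<close> (injective, since \<open>k\<close> is a field and \<open>1 \<noteq> 0\<close> in \<open>R\<close>).\<close>

definition standard_graded_algebra :: "('k::field \<Rightarrow> 'r::comm_ring_1) \<Rightarrow> (nat \<Rightarrow> 'r set) \<Rightarrow> bool" where
  "standard_graded_algebra \<iota> A \<longleftrightarrow>
     \<iota> 1 = 1 \<and> (\<forall>x y. \<iota> (x + y) = \<iota> x + \<iota> y) \<and> (\<forall>x y. \<iota> (x * y) = \<iota> x * \<iota> y) \<and>
     internal_direct_sum UNIV A \<and>
     (\<forall>i j. \<forall>x\<in>A i. \<forall>y\<in>A j. x * y \<in> A (i + j)) \<and>
     A 0 = range \<iota> \<and>
     (\<exists>B. finite B \<and> A 1 = module.span (\<lambda>c x. \<iota> c * x) B) \<and>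
     generated_subalgebra \<iota> (A 1) = UNIV"

definition irrelevant_ideal :: "(nat \<Rightarrow> 'r::comm_ring_1 set) \<Rightarrow> 'r set" where
  "irrelevant_ideal A = family_sum {1..} A"

text \<open>The projection of \<open>R\<close> onto \<open>R / \<mm> = k\<close>.\<close>

definition residue_map :: "('k::field \<Rightarrow> 'r::comm_ring_1) \<Rightarrow> (nat \<Rightarrow> 'r set) \<Rightarrow> 'r \<Rightarrow> 'k" where
  "residue_map \<iota> A r = (THE c. r - \<iota> c \<in> irrelevant_ideal A)"

definition ideal_times :: "('r::comm_ring_1 \<Rightarrow> 'm::ab_group_add \<Rightarrow> 'm) \<Rightarrow> 'r set \<Rightarrow> 'm set \<Rightarrow> 'm set" where
  "ideal_times s I N = module.span s {s a x | a x. a \<in> I \<and> x \<in> N}"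

primrec ideal_power :: "'r::comm_ring_1 set \<Rightarrow> nat \<Rightarrow> 'r set" where
  "ideal_power I 0 = UNIV"
| "ideal_power I (Suc n) = ideal_times (*) I (ideal_power I n)"

definition int_component :: "(nat \<Rightarrow> 'r::comm_ring_1 set) \<Rightarrow> int \<Rightarrow> 'r set" where
  "int_component A t = (if t < 0 then {0} else A (nat t))"

definition graded_module ::
  "(nat \<Rightarrow> 'r::comm_ring_1 set) \<Rightarrow> ('r \<Rightarrow> 'm::ab_group_add \<Rightarrow> 'm) \<Rightarrow> (int \<Rightarrow> 'm set) \<Rightarrow> bool" where
  "graded_module A s G \<longleftrightarrow>
     module s \<and> internal_direct_sum UNIV G \<and>
     (\<forall>i j. \<forall>a\<in>A i. \<forall>x\<in>G j. s a x \<in> G (int i + j))"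

definition fin_generated :: "('r::comm_ring_1 \<Rightarrow> 'm::ab_group_add \<Rightarrow> 'm) \<Rightarrow> 'm set \<Rightarrow> bool" where
  "fin_generated s N \<longleftrightarrow> (\<exists>B. finite B \<and> module.span s B = N)"

section \<open>Graded free resolutions\<close>

text \<open>A free module with basis \<open>e\<^sub>0, \<dots>, e\<^bsub>b-1\<^esub>\<close> is the set of all \<open>f :: nat \<Rightarrow>\<^sub>0 'r\<close>
  with \<open>keys f \<subseteq> {..<b}\<close>.\<close>

definition free_scale :: "'a::comm_ring_1 \<Rightarrow> (nat \<Rightarrow>\<^sub>0 'a) \<Rightarrow> (nat \<Rightarrow>\<^sub>0 'a)" where
  "free_scale c f = Poly_Mapping.map ((*) c) f"

text \<open>The data of a complex \<open>\<dots> \<rightarrow> F\<^sub>1 \<rightarrow> F\<^sub>0 \<rightarrow> N\<close>: the rank of \<open>F\<^sub>n\<close> is \<open>rk F n\<close>, its \<open>i\<close>-th basis element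
  has degree \<open>shft F n i\<close>, and \<open>dif F n\<close> is the map \<open>F\<^sub>n \<rightarrow> F\<^bsub>n-1\<^esub>\<close>.  Truncated subtraction is used, with
  \<open>dif F 0 = 0\<close>, in place of \<open>F\<^bsub>-1\<^esub> = 0\<close>.  Finite ranks suffice: all modules to be
  resolved are finitely generated over a Noetherian ring.\<close>

record (overloaded) ('r, 'm) free_res =
  rk :: "nat \<Rightarrow> nat"
  shft :: "nat \<Rightarrow> nat \<Rightarrow> int"
  dif :: "nat \<Rightarrow> (nat \<Rightarrow>\<^sub>0 'r) \<Rightarrow> (nat \<Rightarrow>\<^sub>0 'r)"
  aug :: "(nat \<Rightarrow>\<^sub>0 'r) \<Rightarrow> 'm"

definition free_carrier :: "('r::comm_ring_1, 'm) free_res \<Rightarrow> nat \<Rightarrow> (nat \<Rightarrow>\<^sub>0 'r) set" where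
  "free_carrier F n = {f. Poly_Mapping.keys f \<subseteq> {..<rk F n}}"

definition free_component ::
  "(nat \<Rightarrow> 'r::comm_ring_1 set) \<Rightarrow> ('r, 'm) free_res \<Rightarrow> nat \<Rightarrow> int \<Rightarrow> (nat \<Rightarrow>\<^sub>0 'r) set" where
  "free_component A F n j =
     {f \<in> free_carrier F n. \<forall>i<rk F n. Poly_Mapping.lookup f i \<in> int_component A (j - shft F n i)}"

text \<open>\<open>N\<close> is a graded submodule of the \<open>R\<close>-module \<open>'m\<close>, with homogeneous components \<open>G j\<close>.\<close>

definition graded_free_resolution ::
  "(nat \<Rightarrow> 'r::comm_ring_1 set) \<Rightarrow> ('r \<Rightarrow> 'm::ab_group_add \<Rightarrow> 'm) \<Rightarrow> 'm set \<Rightarrow> (int \<Rightarrow> 'm set) \<Rightarrow>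
   ('r, 'm) free_res \<Rightarrow> bool" where
  "graded_free_resolution A s N G F \<longleftrightarrow>
     (\<forall>n. module_hom free_scale free_scale (dif F n)) \<and>
     module_hom free_scale s (aug F) \<and>
     (\<forall>x. dif F 0 x = 0) \<and>
     (\<forall>n j. dif F n ` free_component A F n j \<subseteq> free_component A F (n - 1) j) \<and>
     (\<forall>j. aug F ` free_component A F 0 j \<subseteq> G j) \<and>
     aug F ` free_carrier F 0 = N \<and>
     {x \<in> free_carrier F 0. aug F x = 0} = dif F 1 ` free_carrier F 1 \<and>
     (\<forall>n\<ge>1. {x \<in> free_carrier F n. dif F n x = 0} = dif F (n + 1) ` free_carrier F (n + 1))"

definition minimal_graded_free_resolution ::
  "(nat \<Rightarrow> 'r::comm_ring_1 set) \<Rightarrow> ('r \<Rightarrow> 'm::ab_group_add \<Rightarrow> 'm) \<Rightarrow> 'm set \<Rightarrow> (int \<Rightarrow> 'm set) \<Rightarrow>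
   ('r, 'm) free_res \<Rightarrow> bool" where
  "minimal_graded_free_resolution A s N G F \<longleftrightarrow>
     graded_free_resolution A s N G F \<and>
     (\<forall>n\<ge>1. dif F n ` free_carrier F n
              \<subseteq> ideal_times free_scale (irrelevant_ideal A) (free_carrier F (n - 1)))"

section \<open>The linear part and the linearity defect\<close>

text \<open>\<open>fil A F i n\<close> is \<open>\<mm>\<^bsup>i-n\<^esup>F\<^sub>n\<close>; truncated subtraction gives \<open>\<mm>\<^sup>j = R\<close> for \<open>j \<le> 0\<close>.\<close>

definition fil :: "(nat \<Rightarrow> 'r::comm_ring_1 set) \<Rightarrow> ('r, 'm) free_res \<Rightarrow> nat \<Rightarrow> nat \<Rightarrow> (nat \<Rightarrow>\<^sub>0 'r) set" where
  "fil A F i n = ideal_times free_scale (ideal_power (irrelevant_ideal A) (i - n)) (free_carrier F n)"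

text \<open>The \<open>i\<close>-th summand of the linear part in homological degree \<open>n\<close>, as a set of cosets, and
  its induced differential to homological degree \<open>n - 1\<close>: the coset of \<open>x\<close> is sent to that of \<open>dif F n x\<close>.
  The summands with negative \<open>i\<close> vanish.\<close>

definition lin :: "(nat \<Rightarrow> 'r::comm_ring_1 set) \<Rightarrow> ('r, 'm) free_res \<Rightarrow> nat \<Rightarrow> nat \<Rightarrow> (nat \<Rightarrow>\<^sub>0 'r) set set" where
  "lin A F i n = (\<lambda>x. x +o fil A F (i + 1) n) ` fil A F i n"

definition lin_dif ::
  "(nat \<Rightarrow> 'r::comm_ring_1 set) \<Rightarrow> ('r, 'm) free_res \<Rightarrow> nat \<Rightarrow> nat \<Rightarrow>
   (nat \<Rightarrow>\<^sub>0 'r) set \<Rightarrow> (nat \<Rightarrow>\<^sub>0 'r) set" where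
  "lin_dif A F i n C = dif F n ` C + fil A F (i + 1) (n - 1)"

definition lin_homology_nonzero ::
  "(nat \<Rightarrow> 'r::comm_ring_1 set) \<Rightarrow> ('r, 'm) free_res \<Rightarrow> nat \<Rightarrow> bool" where
  "lin_homology_nonzero A F n \<longleftrightarrow>
     (\<exists>i. {C \<in> lin A F i n. lin_dif A F i n C = fil A F (i + 1) (n - 1)}
            \<noteq> lin_dif A F i (n + 1) ` lin A F i (n + 1))"

text \<open>The minimal resolution exists for finitely generated \<open>N\<close> and is unique up to isomorphism.
  The supremum over the empty set is \<open>0\<close>, so that the zero module is Koszul.\<close>

definition linearity_defect ::
  "(nat \<Rightarrow> 'r::comm_ring_1 set) \<Rightarrow> ('r \<Rightarrow> 'm::ab_group_add \<Rightarrow> 'm) \<Rightarrow> 'm set \<Rightarrow> (int \<Rightarrow> 'm set) \<Rightarrow> enat" where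
  "linearity_defect A s N G =
     (let F = (SOME F. minimal_graded_free_resolution A s N G F)
      in Sup {enat n | n. lin_homology_nonzero A F n})"

definition koszul_module ::
  "(nat \<Rightarrow> 'r::comm_ring_1 set) \<Rightarrow> ('r \<Rightarrow> 'm::ab_group_add \<Rightarrow> 'm) \<Rightarrow> 'm set \<Rightarrow> (int \<Rightarrow> 'm set) \<Rightarrow> bool" where
  "koszul_module A s N G \<longleftrightarrow> linearity_defect A s N G = 0"

definition koszul_algebra :: "('k::field \<Rightarrow> 'r::comm_ring_1) \<Rightarrow> (nat \<Rightarrow> 'r set) \<Rightarrow> bool" where
  "koszul_algebra \<iota> A \<longleftrightarrow>
     koszul_module A (\<lambda>r c. residue_map \<iota> A r * c) (UNIV :: 'k set) (\<lambda>j. if j = 0 then UNIV else {0})"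

section \<open>Graded Betti numbers and componentwise linear modules\<close>

text \<open>Tensoring with \<open>k\<close> turns a free module of rank \<open>b\<close> into \<open>k\<^sup>b\<close>, and applies the
  residue map to the matrix entries of a linear map.\<close>

definition k_tensor_component ::
  "('r, 'm) free_res \<Rightarrow> nat \<Rightarrow> int \<Rightarrow> (nat \<Rightarrow>\<^sub>0 'k::field) set" where
  "k_tensor_component F n j = {v. Poly_Mapping.keys v \<subseteq> {i. i < rk F n \<and> shft F n i = j}}"

definition k_tensor_dif ::
  "('k::field \<Rightarrow> 'r::comm_ring_1) \<Rightarrow> (nat \<Rightarrow> 'r set) \<Rightarrow> ('r, 'm) free_res \<Rightarrow> nat \<Rightarrow>
   (nat \<Rightarrow>\<^sub>0 'k) \<Rightarrow> (nat \<Rightarrow>\<^sub>0 'k)" where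
  "k_tensor_dif \<iota> A F n v = Poly_Mapping.map (residue_map \<iota> A) (dif F n (Poly_Mapping.map \<iota> v))"

text \<open>The dimension of the homology of \<open>k \<otimes> F\<close> is that of the cycles minus that of the
  boundaries; all spaces involved are finite-dimensional.\<close>

definition tor_dim ::
  "('k::field \<Rightarrow> 'r::comm_ring_1) \<Rightarrow> (nat \<Rightarrow> 'r set) \<Rightarrow> ('r, 'm) free_res \<Rightarrow> nat \<Rightarrow> int \<Rightarrow> nat" where
  "tor_dim \<iota> A F n j =
     vector_space.dim free_scale {v \<in> k_tensor_component F n j. k_tensor_dif \<iota> A F n v = 0}
     - vector_space.dim free_scale (k_tensor_dif \<iota> A F (n + 1) ` k_tensor_component F (n + 1) j)"

definition betti ::
  "('k::field \<Rightarrow> 'r::comm_ring_1) \<Rightarrow> (nat \<Rightarrow> 'r set) \<Rightarrow> ('r \<Rightarrow> 'm::ab_group_add \<Rightarrow> 'm) \<Rightarrow>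
   'm set \<Rightarrow> (int \<Rightarrow> 'm set) \<Rightarrow> nat \<Rightarrow> int \<Rightarrow> nat" where
  "betti \<iota> A s N G n j = tor_dim \<iota> A (SOME F. graded_free_resolution A s N G F) n j"

definition has_linear_resolution ::
  "('k::field \<Rightarrow> 'r::comm_ring_1) \<Rightarrow> (nat \<Rightarrow> 'r set) \<Rightarrow> ('r \<Rightarrow> 'm::ab_group_add \<Rightarrow> 'm) \<Rightarrow>
   'm set \<Rightarrow> (int \<Rightarrow> 'm set) \<Rightarrow> int \<Rightarrow> bool" where
  "has_linear_resolution \<iota> A s N G i \<longleftrightarrow> (\<forall>n r. r \<noteq> i \<longrightarrow> betti \<iota> A s N G n (int n + r) = 0)"

definition componentwise_linear ::
  "('k::field \<Rightarrow> 'r::comm_ring_1) \<Rightarrow> (nat \<Rightarrow> 'r set) \<Rightarrow> ('r \<Rightarrow> 'm::ab_group_add \<Rightarrow> 'm) \<Rightarrow>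
   (int \<Rightarrow> 'm set) \<Rightarrow> bool" where
  "componentwise_linear \<iota> A s G \<longleftrightarrow>
     (\<forall>i. has_linear_resolution \<iota> A s (module.span s (G i)) (\<lambda>j. module.span s (G i) \<inter> G j) i)"

end

theory Submission
  imports Defs
begin

text \<open>
  Let \<open>K\<close> be the minimal free resolution of \<open>k\<close>. The ring \<open>R\<close> is Koszul exactly when \<open>K\<close> is linear,
  that is, when its differentials are matrices of linear forms. Then \<open>Tor\<^sub>n(k, N)\<close> is the homology of
  the complex \<open>K \<otimes> N\<close> with terms \<open>N\<^bsup>b n\<^esup>\<close>, where \<open>b n\<close> is the rank of \<open>K\<^sub>n\<close>; its
  differentials are explicit and of degree one, and are given by the same matrices for all submodules
  of \<open>M\<close>. For \<open>P, Q \<subseteq> N\<close> let \<open>E\<^sub>n(P, Q)\<close> say that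
  every cycle in \<open>P\<^bsup>b n\<^esup>\<close> is the boundary of a tuple in \<open>Q\<^bsup>b (n+1)\<^esup>\<close> (\<open>kexact\<close> below). Both
  sides of the theorem amount to the same conditions of this form.

  \<^item> Let \<open>N = M\<^bsub>\<langle>i\<rangle>\<^esub>\<close>. Then \<open>Tor\<^sub>n(k, N)\<close> vanishes in degree \<open>n + r\<close> iff \<open>E\<^sub>n(N\<^sub>r, N\<^bsub>r-1\<^esub>)\<close>, and
    \<open>N\<^sub>r = R\<^bsub>r-i\<^esub> M\<^sub>i\<close> for \<open>r \<ge> i\<close>. So \<open>M\<close> is componentwise linear iff
    \<open>E\<^sub>n(R\<^bsub>q+1\<^esub> M\<^sub>i, R\<^sub>q M\<^sub>i)\<close> for all \<open>n, i, q\<close> (\<open>componentwise_linear_iff_kx\<close>).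
  \<^item> Let \<open>F\<close> be the minimal resolution of \<open>M\<close> and \<open>Z\<^sub>n \<subseteq> F\<^bsub>n-1\<^esub>\<close> the syzygies. The linear part of \<open>F\<close>
    is acyclic in positive degrees iff \<open>Z\<^sub>n \<inter> \<mm>\<^bsup>j+1\<^esup> F\<^bsub>n-1\<^esub> = \<mm>\<^sup>j Z\<^sub>n\<close> for all \<open>n \<ge> 1\<close> and \<open>j\<close>
    (\<open>lin_acyclic_iff_strict\<close>). Dimension shifting along \<open>0 \<rightarrow> Z\<^bsub>n+1\<^esub> \<rightarrow> F\<^sub>n \<rightarrow> Z\<^sub>n \<rightarrow> 0\<close>, started with
    \<open>M\<close> in place of \<open>Z\<^sub>0\<close>, turns this into
    \<open>E\<^sub>n(\<mm>\<^bsup>q+1\<^esup> M, \<mm>\<^sup>q M)\<close> for all \<open>n, q\<close>: the inclusions \<open>\<mm>\<^bsup>q+1\<^esup> M \<subseteq> \<mm>\<^sup>q M\<close> induce zero on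
    \<open>Tor(k, -)\<close> (\<open>strict_iff_kx\<close>).
  \<^item> The component of \<open>\<mm>\<^sup>q M\<close> in degree \<open>r\<close> is \<open>R\<^sub>q M\<^bsub>r-q\<^esub>\<close>, because \<open>R\<close> is generated in degree one.
    So the second family of conditions, split into homogeneous components, is the first
    (\<open>kx_powers_iff\<close>).

  Two foundations are laid on the way. Minimal graded free resolutions of finite rank exist
  (\<open>minimal_resolution_exists\<close>), by Hilbert's basis theorem and the choice of homogeneous generating
  sets of least cardinality. The Betti numbers, which are computed from an arbitrary graded free
  resolution of \<open>N\<close>, vanish exactly when \<open>K \<otimes> N\<close> is exact in the corresponding place
  (\<open>tor_dim_eq_0_iff_kx\<close>), again by dimension shifting.
\<close>

section \<open>Internal direct sums\<close>

lemma additive_subgroup_0: "additive_subgroup V \<Longrightarrow> 0 \<in> V"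
  and additive_subgroup_add: "additive_subgroup V \<Longrightarrow> x \<in> V \<Longrightarrow> y \<in> V \<Longrightarrow> x + y \<in> V"
  and additive_subgroup_minus: "additive_subgroup V \<Longrightarrow> x \<in> V \<Longrightarrow> - x \<in> V"
  by (auto simp: additive_subgroup_def)

lemma additive_subgroup_diff: "additive_subgroup V \<Longrightarrow> x \<in> V \<Longrightarrow> y \<in> V \<Longrightarrow> x - y \<in> V"
  using additive_subgroup_add[of V x "- y"] additive_subgroup_minus[of V y] by simp

lemma additive_subgroup_sum:
  "additive_subgroup V \<Longrightarrow> (\<And>i. i \<in> J \<Longrightarrow> f i \<in> V) \<Longrightarrow> sum f J \<in> V"
  by (induct J rule: infinite_finite_induct) (auto simp: additive_subgroup_0 additive_subgroup_add)

lemma additive_subgroup_Int: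
  "additive_subgroup V \<Longrightarrow> additive_subgroup W \<Longrightarrow> additive_subgroup (V \<inter> W)"
  by (auto simp: additive_subgroup_def)

lemma additive_subgroup_vimage:
  assumes "additive f" "additive_subgroup V"
  shows "additive_subgroup {x. f x \<in> V}"
proof -
  interpret additive f by fact
  show ?thesis
    using assms(2) by (simp add: additive_subgroup_def zero add minus)
qed

lemma family_sum_iff:
  assumes "\<And>i. additive_subgroup (V i)"
  shows "x \<in> family_sum UNIV V \<longleftrightarrow>
    (\<exists>f. (\<forall>i. f i \<in> V i) \<and> finite {i. f i \<noteq> 0} \<and> x = (\<Sum>i | f i \<noteq> 0. f i))"
proof
  assume "x \<in> family_sum UNIV V"
  then obtain J f where J: "finite J" "\<forall>i\<in>J. f i \<in> V i" "x = (\<Sum>i\<in>J. f i)"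
    by (auto simp: family_sum_def)
  define g where "g i = (if i \<in> J then f i else 0)" for i
  have "\<forall>i. g i \<in> V i"
    using J assms by (auto simp: g_def additive_subgroup_0)
  moreover have "finite {i. g i \<noteq> 0}"
    by (rule finite_subset[OF _ J(1)]) (auto simp: g_def)
  moreover have "x = (\<Sum>i | g i \<noteq> 0. g i)"
    unfolding J(3) by (rule sum.mono_neutral_cong_right) (use J in \<open>auto simp: g_def\<close>)
  ultimately show "\<exists>f. (\<forall>i. f i \<in> V i) \<and> finite {i. f i \<noteq> 0} \<and> x = (\<Sum>i | f i \<noteq> 0. f i)"
    by blast
next
  assume "\<exists>f. (\<forall>i. f i \<in> V i) \<and> finite {i. f i \<noteq> 0} \<and> x = (\<Sum>i | f i \<noteq> 0. f i)"
  then show "x \<in> family_sum UNIV V"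
    unfolding family_sum_def by blast
qed

definition dcomp :: "('i \<Rightarrow> 'a::ab_group_add set) \<Rightarrow> 'i \<Rightarrow> 'a \<Rightarrow> 'a" where
  "dcomp V i x =
    (SOME f. (\<forall>i. f i \<in> V i) \<and> finite {i. f i \<noteq> 0} \<and> x = (\<Sum>i | f i \<noteq> 0. f i)) i"

lemma ids_subgroup: "internal_direct_sum X V \<Longrightarrow> additive_subgroup (V i)"
  by (simp add: internal_direct_sum_def)

lemma dcomp_decomposition:
  assumes "internal_direct_sum X V" "x \<in> X"
  shows dcomp_mem: "dcomp V i x \<in> V i"
    and dcomp_finite: "finite {i. dcomp V i x \<noteq> 0}"
    and dcomp_sum: "(\<Sum>i | dcomp V i x \<noteq> 0. dcomp V i x) = x"
proof -
  have "x \<in> family_sum UNIV V"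
    using assms by (simp add: internal_direct_sum_def)
  then have "\<exists>f. (\<forall>i. f i \<in> V i) \<and> finite {i. f i \<noteq> 0} \<and> x = (\<Sum>i | f i \<noteq> 0. f i)"
    by (subst (asm) family_sum_iff) (use assms in \<open>auto simp: internal_direct_sum_def\<close>)
  from someI_ex[OF this] show "dcomp V i x \<in> V i" "finite {i. dcomp V i x \<noteq> 0}"
    "(\<Sum>i | dcomp V i x \<noteq> 0. dcomp V i x) = x"
    unfolding dcomp_def[abs_def] by auto
qed

lemma dcomp_sum_superset:
  assumes "internal_direct_sum X V" "x \<in> X" "finite J" "{i. dcomp V i x \<noteq> 0} \<subseteq> J"
  shows "(\<Sum>i\<in>J. dcomp V i x) = x"
proof -
  have "(\<Sum>i\<in>J. dcomp V i x) = (\<Sum>i | dcomp V i x \<noteq> 0. dcomp V i x)"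
    by (rule sum.mono_neutral_right) (use assms in auto)
  then show ?thesis
    using dcomp_sum[OF assms(1,2)] by simp
qed

lemma ids_independent:
  assumes "internal_direct_sum X V" "finite J" "\<And>i. i \<in> J \<Longrightarrow> f i \<in> V i" "(\<Sum>i\<in>J. f i) = 0" "i \<in> J"
  shows "f i = 0"
  using assms unfolding internal_direct_sum_def by blast

lemma ids_sum_mem:
  assumes "internal_direct_sum X V" "finite J" "\<And>i. i \<in> J \<Longrightarrow> f i \<in> V i"
  shows "(\<Sum>i\<in>J. f i) \<in> X"
  using assms unfolding internal_direct_sum_def family_sum_def by blast

lemma ids_component_subset:
  assumes "internal_direct_sum X V" "x \<in> V i"
  shows "x \<in> X"
  using ids_sum_mem[OF assms(1), of "{i}" "\<lambda>_. x"] assms(2) by simp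

lemma dcomp_eqI:
  assumes D: "internal_direct_sum X V" and J: "finite J"
    and f: "\<And>i. i \<in> J \<Longrightarrow> f i \<in> V i" "\<And>i. i \<notin> J \<Longrightarrow> f i = 0" and x: "x = (\<Sum>i\<in>J. f i)"
  shows "dcomp V i x = f i"
proof (cases "i \<in> J \<union> {i. dcomp V i x \<noteq> 0}")
  case True
  have xX: "x \<in> X"
    using ids_sum_mem[OF D J f(1)] x by simp
  let ?J = "J \<union> {i. dcomp V i x \<noteq> 0}"
  have fin: "finite ?J"
    using J dcomp_finite[OF D xX] by simp
  have "(\<Sum>i\<in>?J. f i) = (\<Sum>i\<in>J. f i)"
    by (rule sum.mono_neutral_right) (use fin f in auto)
  moreover have "(\<Sum>i\<in>?J. dcomp V i x) = x"
    by (rule dcomp_sum_superset[OF D xX fin]) auto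
  ultimately have 0: "(\<Sum>i\<in>?J. dcomp V i x - f i) = 0"
    by (simp add: sum_subtractf x)
  have mem: "dcomp V i x - f i \<in> V i" for i
    using dcomp_mem[OF D xX, of i] f[of i] ids_subgroup[OF D, of i]
    by (cases "i \<in> J") (auto intro: additive_subgroup_diff)
  have "dcomp V i x - f i = 0"
    by (rule ids_independent[OF D fin mem 0 True])
  then show ?thesis by simp
next
  case False
  then show ?thesis using f by auto
qed

lemma dcomp_homogeneous:
  assumes "internal_direct_sum X V" "x \<in> V j"
  shows "dcomp V i x = (if i = j then x else 0)"
  using dcomp_eqI[OF assms(1), of "{j}" "\<lambda>i. if i = j then x else 0" x i] assms(2) by simp

lemma ids_additive_subgroup:
  assumes D: "internal_direct_sum X V"
  shows "additive_subgroup X"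
proof -
  have *: "x \<in> X \<Longrightarrow> y \<in> X \<Longrightarrow> x - y \<in> X" for x y
  proof -
    assume xy: "x \<in> X" "y \<in> X"
    let ?J = "{i. dcomp V i x \<noteq> 0} \<union> {i. dcomp V i y \<noteq> 0}"
    have fin: "finite ?J"
      using dcomp_finite[OF D] xy by auto
    have "x = (\<Sum>i\<in>?J. dcomp V i x)" "y = (\<Sum>i\<in>?J. dcomp V i y)"
      by (rule dcomp_sum_superset[OF D _ fin, symmetric]; use xy in auto)+
    then have "x - y = (\<Sum>i\<in>?J. dcomp V i x - dcomp V i y)"
      by (simp add: sum_subtractf)
    also have "\<dots> \<in> X"
      by (rule ids_sum_mem[OF D fin])
        (use dcomp_mem[OF D] xy ids_subgroup[OF D] in \<open>auto intro: additive_subgroup_diff\<close>)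
    finally show ?thesis .
  qed
  have 0: "0 \<in> X"
    using ids_sum_mem[OF D, of "{}"] by simp
  show ?thesis
    unfolding additive_subgroup_def
  proof (intro conjI ballI 0)
    fix x assume x: "x \<in> X"
    show "- x \<in> X"
      using *[OF 0 x] by simp
    fix y assume "y \<in> X"
    from *[OF x *[OF 0 this]] show "x + y \<in> X"
      by simp
  qed
qed

text \<open>A homogeneous map commutes with taking components. The index shift \<open>\<sigma>\<close> covers maps of nonzero
  degree, such as the multiplication by a form.\<close>

lemma dcomp_additive:
  assumes D: "internal_direct_sum X V" and E: "internal_direct_sum Y W"
    and \<phi>: "additive \<phi>" "\<And>i x. x \<in> V i \<Longrightarrow> \<phi> x \<in> W (\<sigma> i)" and \<sigma>: "bij \<sigma>" and x: "x \<in> X"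
  shows "dcomp W (\<sigma> i) (\<phi> x) = \<phi> (dcomp V i x)"
proof -
  interpret additive \<phi> by fact
  let ?J = "{i. dcomp V i x \<noteq> 0}"
  let ?f = "\<lambda>j. \<phi> (dcomp V (inv \<sigma> j) x)"
  have inv[simp]: "inv \<sigma> (\<sigma> k) = k" "\<sigma> (inv \<sigma> j) = j" for k j
    using \<sigma> by (auto simp: bij_is_inj bij_is_surj surj_f_inv_f)
  have "\<phi> x = (\<Sum>i\<in>?J. \<phi> (dcomp V i x))"
    using arg_cong[OF dcomp_sum[OF D x], of \<phi>] by (simp add: sum)
  also have "\<dots> = (\<Sum>j\<in>\<sigma> ` ?J. ?f j)"
    using \<sigma> by (subst sum.reindex) (auto simp: o_def intro: inj_on_subset[OF bij_is_inj])
  finally have eq: "\<phi> x = (\<Sum>j\<in>\<sigma> ` ?J. ?f j)" .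
  have "dcomp W (\<sigma> i) (\<phi> x) = ?f (\<sigma> i)"
  proof (rule dcomp_eqI[OF E _ _ _ eq])
    show "finite (\<sigma> ` ?J)"
      using dcomp_finite[OF D x] by simp
    show "?f j \<in> W j" for j
      using \<phi>(2)[OF dcomp_mem[OF D x, of "inv \<sigma> j"]] by simp
    show "?f j = 0" if "j \<notin> \<sigma> ` ?J" for j
    proof -
      have "dcomp V (inv \<sigma> j) x = 0"
        using that by (metis (mono_tags, lifting) CollectI inv(2) imageI)
      then show ?thesis by (simp add: zero)
    qed
  qed
  then show ?thesis by simp
qed

lemma dcomp_add:
  assumes D: "internal_direct_sum X V" and xy: "x \<in> X" "y \<in> X"
  shows "dcomp V i (x + y) = dcomp V i x + dcomp V i y"
proof -
  let ?J = "{i. dcomp V i x \<noteq> 0} \<union> {i. dcomp V i y \<noteq> 0}"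
  have fin: "finite ?J"
    using dcomp_finite[OF D] xy by auto
  have eq: "x = (\<Sum>i\<in>?J. dcomp V i x)" "y = (\<Sum>i\<in>?J. dcomp V i y)"
    by (rule dcomp_sum_superset[OF D _ fin, symmetric]; use xy in auto)+
  show ?thesis
  proof (rule dcomp_eqI[OF D fin])
    show "x + y = (\<Sum>i\<in>?J. dcomp V i x + dcomp V i y)"
      using eq by (simp add: sum.distrib)
  qed (use dcomp_mem[OF D] xy ids_subgroup[OF D] in \<open>auto intro: additive_subgroup_add\<close>)
qed

lemma dcomp_0: "internal_direct_sum X V \<Longrightarrow> dcomp V i 0 = 0"
  using dcomp_eqI[of X V "{}" "\<lambda>_. 0" 0] by simp

lemma dcomp_minus:
  assumes D: "internal_direct_sum X V" and x: "x \<in> X"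
  shows "dcomp V i (- x) = - dcomp V i x"
proof -
  have "- x \<in> X"
    using ids_additive_subgroup[OF D] x by (rule additive_subgroup_minus)
  then have "dcomp V i (x + - x) = dcomp V i x + dcomp V i (- x)"
    using dcomp_add[OF D x] by blast
  then show ?thesis
    using dcomp_0[OF D, of i] by (simp add: minus_unique)
qed

lemma dcomp_diff:
  assumes D: "internal_direct_sum X V" and xy: "x \<in> X" "y \<in> X"
  shows "dcomp V i (x - y) = dcomp V i x - dcomp V i y"
  using dcomp_add[OF D xy(1), of "- y" i] dcomp_minus[OF D xy(2)]
    additive_subgroup_minus[OF ids_additive_subgroup[OF D] xy(2)] by simp

lemma dcomp_of_sum:
  assumes D: "internal_direct_sum X V" and "\<And>j. j \<in> J \<Longrightarrow> f j \<in> X"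
  shows "dcomp V i (sum f J) = (\<Sum>j\<in>J. dcomp V i (f j))"
  using assms(2)
proof (induct J rule: infinite_finite_induct)
  case (insert j J)
  then show ?case
    using dcomp_add[OF D, of "f j" "sum f J" i]
      additive_subgroup_sum[OF ids_additive_subgroup[OF D], of J f] by simp
qed (simp_all add: dcomp_0[OF D])

lemma dcomp_dcomp:
  assumes D: "internal_direct_sum X V" and x: "x \<in> X"
  shows "dcomp V i (dcomp V j x) = (if i = j then dcomp V i x else 0)"
  using dcomp_homogeneous[OF D dcomp_mem[OF D x, of j], of i] by simp

text \<open>A subgroup that contains the components of its elements is graded; this makes kernels of
  homogeneous maps and submodules generated in one degree graded modules.\<close>

lemma ids_subI:
  assumes D: "internal_direct_sum X V" and Z: "additive_subgroup Z" "Z \<subseteq> X"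
    and comp: "\<And>x i. x \<in> Z \<Longrightarrow> dcomp V i x \<in> Z"
  shows "internal_direct_sum Z (\<lambda>i. Z \<inter> V i)"
  unfolding internal_direct_sum_def
proof (intro conjI allI impI)
  show "additive_subgroup (Z \<inter> V i)" for i
    using Z ids_subgroup[OF D] by (intro additive_subgroup_Int)
  show "Z = family_sum UNIV (\<lambda>i. Z \<inter> V i)"
  proof (rule set_eqI, subst family_sum_iff)
    show "additive_subgroup (Z \<inter> V i)" for i
      using Z ids_subgroup[OF D] by (intro additive_subgroup_Int)
    show "x \<in> Z \<longleftrightarrow> (\<exists>f. (\<forall>i. f i \<in> Z \<inter> V i) \<and> finite {i. f i \<noteq> 0} \<and> x = (\<Sum>i | f i \<noteq> 0. f i))"
      for x
    proof
      assume x: "x \<in> Z"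
      then have "x \<in> X" using Z by auto
      from dcomp_decomposition[OF D this] comp[OF x]
      show "\<exists>f. (\<forall>i. f i \<in> Z \<inter> V i) \<and> finite {i. f i \<noteq> 0} \<and> x = (\<Sum>i | f i \<noteq> 0. f i)"
        by (intro exI[of _ "\<lambda>i. dcomp V i x"]) auto
    qed (auto intro: additive_subgroup_sum[OF Z(1)])
  qed
  show "\<forall>i\<in>J. f i = 0" if "finite J \<and> (\<forall>i\<in>J. f i \<in> Z \<inter> V i) \<and> (\<Sum>i\<in>J. f i) = 0" for f J
    using ids_independent[OF D, of J f] that by auto
qed

lemma ids_reindex:
  assumes D: "internal_direct_sum X V" and \<sigma>: "inj \<sigma>"
    and W: "\<And>i. W (\<sigma> i) = V i" "\<And>j. j \<notin> range \<sigma> \<Longrightarrow> W j = {0}"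
  shows "internal_direct_sum X W"
proof -
  have sub: "additive_subgroup (W j)" for j
    using ids_subgroup[OF D] W
    by (cases "j \<in> range \<sigma>") (auto simp: additive_subgroup_def)
  have "x \<in> X \<longleftrightarrow> x \<in> family_sum UNIV W" for x
  proof
    assume x: "x \<in> X"
    let ?J = "{i. dcomp V i x \<noteq> 0}"
    have "x = (\<Sum>j\<in>\<sigma> ` ?J. dcomp V (inv \<sigma> j) x)"
      using dcomp_sum[OF D x] \<sigma> by (subst sum.reindex) (auto simp: inj_on_def o_def)
    moreover have "\<forall>j\<in>\<sigma> ` ?J. dcomp V (inv \<sigma> j) x \<in> W j"
      using dcomp_mem[OF D x] \<sigma> by (auto simp: W)
    ultimately show "x \<in> family_sum UNIV W"
      unfolding family_sum_def mem_Collect_eq using finite_imageI[OF dcomp_finite[OF D x], of \<sigma>]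
      by (intro exI[of _ "\<sigma> ` ?J"] exI[of _ "\<lambda>j. dcomp V (inv \<sigma> j) x"]) blast
  next
    assume "x \<in> family_sum UNIV W"
    then obtain J f where J: "\<forall>j\<in>J. f j \<in> W j" "x = (\<Sum>j\<in>J. f j)"
      by (auto simp: family_sum_def)
    have "W j \<subseteq> X" for j
      using ids_component_subset[OF D] W
        additive_subgroup_0[OF ids_additive_subgroup[OF D]]
      by (cases "j \<in> range \<sigma>") auto
    then show "x \<in> X"
      using J by (auto intro!: additive_subgroup_sum[OF ids_additive_subgroup[OF D]])
  qed
  moreover have "f j = 0"
    if J: "finite J" "\<forall>j\<in>J. f j \<in> W j" "(\<Sum>j\<in>J. f j) = 0" "j \<in> J" for f J j
  proof (cases "j \<in> range \<sigma>")
    case True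
    have "(\<Sum>i\<in>\<sigma> -` J. f (\<sigma> i)) = (\<Sum>j\<in>\<sigma> ` \<sigma> -` J. f j)"
      using \<sigma> by (subst sum.reindex) (auto simp: inj_on_def o_def)
    also have "\<dots> = (\<Sum>j\<in>J. f j)"
    proof (rule sum.mono_neutral_left[OF J(1)])
      show "\<forall>j\<in>J - \<sigma> ` \<sigma> -` J. f j = 0"
      proof
        fix j assume j: "j \<in> J - \<sigma> ` \<sigma> -` J"
        then have "j \<notin> range \<sigma>" by auto
        then show "f j = 0" using J(2) W(2)[of j] j by auto
      qed
    qed auto
    finally have "(\<Sum>i\<in>\<sigma> -` J. f (\<sigma> i)) = 0" using J(3) by simp
    from ids_independent[OF D finite_vimageI[OF J(1) \<sigma>] _ this] True J W
    show ?thesis by auto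
  qed (use J W in auto)
  ultimately show ?thesis
    unfolding internal_direct_sum_def using sub by blast
qed

section \<open>Tuples as finitely supported functions\<close>

abbreviation lookup :: "('i \<Rightarrow>\<^sub>0 'a::zero) \<Rightarrow> 'i \<Rightarrow> 'a" where
  "lookup \<equiv> Poly_Mapping.lookup"

definition tup :: "nat \<Rightarrow> (nat \<Rightarrow> 'a::zero) \<Rightarrow> (nat \<Rightarrow>\<^sub>0 'a)" where
  "tup b g = Abs_poly_mapping (\<lambda>i. if i < b then g i else 0)"

lemma lookup_tup [simp]: "lookup (tup b g) i = (if i < b then g i else 0)"
proof -
  have "finite {i. (if i < b then g i else 0) \<noteq> 0}"
    by (rule finite_subset[of _ "{..<b}"]) auto
  then show ?thesis by (simp add: tup_def)
qed

abbreviation bvec :: "nat \<Rightarrow> (nat \<Rightarrow>\<^sub>0 'a::zero_neq_one)" where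
  "bvec l \<equiv> Poly_Mapping.single l 1"

text \<open>A single free module, apart from any resolution, so that it can serve as the next term of a
  resolution under construction.\<close>

definition fcar :: "nat \<Rightarrow> (nat \<Rightarrow>\<^sub>0 'a::zero) set" where
  "fcar b = {f. Poly_Mapping.keys f \<subseteq> {..<b}}"

lemma fcar_iff: "f \<in> fcar b \<longleftrightarrow> (\<forall>i. b \<le> i \<longrightarrow> lookup f i = 0)"
  unfolding fcar_def subset_iff in_keys_iff lessThan_iff mem_Collect_eq by (meson not_less)

lemma tup_in_fcar [simp]: "tup b g \<in> fcar b"
  by (simp add: fcar_iff)

lemma fcar_eqI:
  "f \<in> fcar b \<Longrightarrow> g \<in> fcar b \<Longrightarrow> (\<And>i. i < b \<Longrightarrow> lookup f i = lookup g i) \<Longrightarrow> f = g"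
  by (rule poly_mapping_eqI) (metis fcar_iff not_less)

lemma lookup_free_scale [simp]: "lookup (free_scale c f) i = c * lookup f i"
  by (auto simp: free_scale_def Poly_Mapping.map.rep_eq when_def)

lemma module_free_scale: "module (free_scale :: 'a::comm_ring_1 \<Rightarrow> _)"
  by standard (auto intro!: poly_mapping_eqI simp: lookup_add algebra_simps)

lemma module_mult: "module ((*) :: 'a::comm_ring_1 \<Rightarrow> _)"
  by standard (auto simp: algebra_simps)

lemma subspace_fcar: "module.subspace free_scale (fcar b)"
  by (rule module.subspaceI[OF module_free_scale]) (auto simp: fcar_iff lookup_add)

lemma module_hom_imp_additive: "module_hom s t f \<Longrightarrow> additive f"
  by (simp add: module_hom_def module_hom_axioms_def additive_def)

lemma additive_lookup: "additive (\<lambda>f. lookup f i)"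
  by standard (simp add: lookup_add)

lemma additive_scale: "module s \<Longrightarrow> additive (s a)"
  by standard (simp add: module.scale_right_distrib)

lemma subspace_imp_additive_subgroup: "module s \<Longrightarrow> module.subspace s N \<Longrightarrow> additive_subgroup N"
  by (simp add: additive_subgroup_def module.subspace_0 module.subspace_add module.subspace_neg)

lemma free_expansion:
  assumes "f \<in> fcar b"
  shows "f = (\<Sum>l<b. free_scale (lookup f l) (bvec l))"
proof (rule fcar_eqI[OF assms])
  show "(\<Sum>l<b. free_scale (lookup f l) (bvec l)) \<in> fcar b"
    by (auto simp: fcar_iff lookup_sum lookup_single when_def)
  fix i assume "i < b"
  then show "lookup f i = lookup (\<Sum>l<b. free_scale (lookup f l) (bvec l)) i"
    by (simp add: lookup_sum lookup_single mult_when) (simp add: when_def)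
qed

lemma hom_expansion:
  assumes h: "module_hom free_scale s h" and f: "f \<in> fcar b"
  shows "h f = (\<Sum>l<b. s (lookup f l) (h (bvec l)))"
proof -
  have "h f = h (\<Sum>l<b. free_scale (lookup f l) (bvec l))"
    using free_expansion[OF f] by simp
  also have "\<dots> = (\<Sum>l<b. h (free_scale (lookup f l) (bvec l)))"
    by (rule additive.sum[OF module_hom_imp_additive[OF h]])
  also have "\<dots> = (\<Sum>l<b. s (lookup f l) (h (bvec l)))"
    using module_hom.scale[OF h] by simp
  finally show ?thesis .
qed

(* otherwise the component A 1 would turn into A (Suc 0) *)
declare One_nat_def [simp del]

section \<open>Multiplication by linear forms\<close>

text \<open>Only sums of products are taken, without closing under scalars. For the linear forms \<open>U\<close> the
  iterates then give both \<open>\<mm>\<^sup>q N\<close> for a submodule \<open>N\<close> and the space \<open>R\<^sub>q M\<^sub>i\<close> for a homogeneous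
  component \<open>M\<^sub>i\<close>.\<close>

inductive_set lmul :: "('r \<Rightarrow> 'm::ab_group_add \<Rightarrow> 'm) \<Rightarrow> 'r set \<Rightarrow> 'm set \<Rightarrow> 'm set"
  for s U Q where
  zero: "0 \<in> lmul s U Q"
| step: "a \<in> U \<Longrightarrow> q \<in> Q \<Longrightarrow> w \<in> lmul s U Q \<Longrightarrow> s a q + w \<in> lmul s U Q"

lemma lmul_base: "a \<in> U \<Longrightarrow> q \<in> Q \<Longrightarrow> s a q \<in> lmul s U Q"
  using lmul.step[OF _ _ lmul.zero, of a U q Q s] by simp

lemma lmul_add: "x \<in> lmul s U Q \<Longrightarrow> y \<in> lmul s U Q \<Longrightarrow> x + y \<in> lmul s U Q"
  by (induct x rule: lmul.induct) (auto simp: add.assoc intro: lmul.step)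

lemma lmul_sum: "(\<And>i. i \<in> J \<Longrightarrow> f i \<in> lmul s U Q) \<Longrightarrow> sum f J \<in> lmul s U Q"
  by (induct J rule: infinite_finite_induct) (auto simp: lmul.zero lmul_add)

lemma lmul_mono: "Q \<subseteq> Q' \<Longrightarrow> lmul s U Q \<subseteq> lmul s U Q'"
proof
  fix x assume "x \<in> lmul s U Q" "Q \<subseteq> Q'"
  then show "x \<in> lmul s U Q'"
    by (induct x rule: lmul.induct) (auto intro: lmul.zero lmul.step)
qed

lemma lmul_power_mono: "Q \<subseteq> Q' \<Longrightarrow> (lmul s U ^^ q) Q \<subseteq> (lmul s U ^^ q) Q'"
  by (induct q) (auto intro: lmul_mono[THEN subsetD])

lemma lmul_subsetI:
  assumes "0 \<in> T" "\<And>x y. x \<in> T \<Longrightarrow> y \<in> T \<Longrightarrow> x + y \<in> T" "\<And>a q. a \<in> U \<Longrightarrow> q \<in> Q \<Longrightarrow> s a q \<in> T"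
  shows "lmul s U Q \<subseteq> T"
proof
  fix x assume "x \<in> lmul s U Q"
  then show "x \<in> T" by (induct x rule: lmul.induct) (auto intro: assms)
qed

lemma lmul_image:
  assumes "additive \<phi>" "\<And>a x. \<phi> (s a x) = t a (\<phi> x)"
  shows "\<phi> ` lmul s U Q = lmul t U (\<phi> ` Q)"
proof -
  interpret \<phi>: additive \<phi> by fact
  show ?thesis
  proof (intro equalityI subsetI)
    fix y assume "y \<in> \<phi> ` lmul s U Q"
    then obtain x where "x \<in> lmul s U Q" "y = \<phi> x" by blast
    then show "y \<in> lmul t U (\<phi> ` Q)"
      by (induct x arbitrary: y rule: lmul.induct)
        (auto simp: \<phi>.zero \<phi>.add assms(2) intro: lmul.zero lmul.step)
  next
    fix y assume "y \<in> lmul t U (\<phi> ` Q)"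
    then show "y \<in> \<phi> ` lmul s U Q"
    proof (induct y rule: lmul.induct)
      case zero
      show ?case by (rule image_eqI[OF _ lmul.zero]) (simp add: \<phi>.zero)
    next
      case (step a q w)
      obtain q' where q': "q' \<in> Q" "q = \<phi> q'" using step(2) by blast
      obtain w' where w': "w' \<in> lmul s U Q" "w = \<phi> w'" using step(4) by blast
      have "\<phi> (s a q' + w') = t a q + w"
        unfolding \<phi>.add assms(2) q'(2) w'(2) by (rule refl)
      then show ?case
        using lmul.step[OF step(1) q'(1) w'(1)] by (metis imageI)
    qed
  qed
qed

lemma lmul_power_image:
  assumes "additive \<phi>" "\<And>a x. \<phi> (s a x) = t a (\<phi> x)"
  shows "\<phi> ` (lmul s U ^^ q) Q = (lmul t U ^^ q) (\<phi> ` Q)"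
proof (induct q)
  case (Suc q)
  have "\<phi> ` lmul s U ((lmul s U ^^ q) Q) = lmul t U (\<phi> ` (lmul s U ^^ q) Q)"
    by (rule lmul_image[where t = t, OF assms])
  also have "\<dots> = lmul t U ((lmul t U ^^ q) (\<phi> ` Q))"
    by (simp only: Suc)
  finally show ?case by simp
qed simp

lemma lmul_additive_subgroup:
  assumes "module s" "additive_subgroup Q"
  shows "additive_subgroup (lmul s U Q)"
proof -
  interpret module s by fact
  have "- x \<in> lmul s U Q" if "x \<in> lmul s U Q" for x
    using that
  proof (induct x rule: lmul.induct)
    case (step a q w)
    have "s a (- q) + - w \<in> lmul s U Q"
      using step assms(2) by (intro lmul.step) (auto intro: additive_subgroup_minus)
    then show ?case by simp
  qed (simp add: lmul.zero)
  then show ?thesis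
    by (auto simp: additive_subgroup_def lmul.zero lmul_add)
qed

lemma lmul_power_additive_subgroup:
  assumes "module s" "additive_subgroup Q"
  shows "additive_subgroup ((lmul s U ^^ q) Q)"
  by (induct q) (use assms in \<open>auto intro: lmul_additive_subgroup\<close>)

lemma lmul_scale_closed:
  assumes "module s" "\<And>x. x \<in> Q \<Longrightarrow> s c x \<in> Q" "x \<in> lmul s U Q"
  shows "s c x \<in> lmul s U Q"
proof -
  interpret module s by fact
  show ?thesis
    using assms(3)
  proof (induct x rule: lmul.induct)
    case (step a q w)
    have "s a (s c q) + s c w \<in> lmul s U Q"
      using step assms(2) by (intro lmul.step) auto
    then show ?case by (simp add: scale_right_distrib mult.commute)
  qed (simp add: lmul.zero)
qed

lemma lmul_power_scale_closed:
  assumes "module s" "\<And>x. x \<in> Q \<Longrightarrow> s c x \<in> Q" "x \<in> (lmul s U ^^ q) Q"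
  shows "s c x \<in> (lmul s U ^^ q) Q"
  using assms(3)
  by (induct q arbitrary: x) (use assms in \<open>auto intro: lmul_scale_closed\<close>)

lemma lmul_subspace:
  assumes "module s" "module.subspace s N"
  shows "module.subspace s (lmul s U N)"
proof (rule module.subspaceI[OF assms(1) lmul.zero lmul_add])
  fix c x assume "x \<in> lmul s U N"
  then show "s c x \<in> lmul s U N"
    using assms by (auto intro: lmul_scale_closed module.subspace_scale)
qed auto

lemma lmul_power_subspace:
  assumes "module s" "module.subspace s N"
  shows "module.subspace s ((lmul s U ^^ q) N)"
  by (induct q) (use assms in \<open>auto intro: lmul_subspace\<close>)

lemma lmul_subset_subspace:
  assumes "module s" "module.subspace s N"
  shows "lmul s U N \<subseteq> N"
  by (rule lmul_subsetI) (use assms in \<open>auto intro: module.subspace_0 module.subspace_add module.subspace_scale\<close>)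

lemma lmul_power_Suc_subset:
  assumes "module s" "module.subspace s N"
  shows "(lmul s U ^^ Suc q) N \<subseteq> (lmul s U ^^ q) N"
  using lmul_subset_subspace[OF assms(1) lmul_power_subspace[OF assms]] by simp

lemma lmul_power_antimono:
  assumes "module s" "module.subspace s N" "p \<le> q"
  shows "(lmul s U ^^ q) N \<subseteq> (lmul s U ^^ p) N"
  by (rule lift_Suc_antimono_le[of "\<lambda>q. (lmul s U ^^ q) N", OF lmul_power_Suc_subset[OF assms(1,2)] assms(3)])

section \<open>Standard graded algebras\<close>

locale std_graded =
  fixes \<iota> :: "'k::field \<Rightarrow> 'r::comm_ring_1" and A :: "nat \<Rightarrow> 'r set"
  assumes sga: "standard_graded_algebra \<iota> A"
begin

abbreviation lm :: "('r \<Rightarrow> 'm::ab_group_add \<Rightarrow> 'm) \<Rightarrow> 'm set \<Rightarrow> 'm set" where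
  "lm s \<equiv> lmul s (A 1)"

abbreviation "lmF \<equiv> lm (free_scale :: 'r \<Rightarrow> _)"

lemma iota_1: "\<iota> 1 = 1" and iota_add: "\<iota> (x + y) = \<iota> x + \<iota> y"
  and iota_mult: "\<iota> (x * y) = \<iota> x * \<iota> y"
  and ids_A: "internal_direct_sum UNIV A"
  and A_mult: "a \<in> A i \<Longrightarrow> b \<in> A j \<Longrightarrow> a * b \<in> A (i + j)"
  and A_0: "A 0 = range \<iota>"
  and generated_A1: "generated_subalgebra \<iota> (A 1) = UNIV"
  using sga unfolding standard_graded_algebra_def by blast+

lemma additive_iota: "additive \<iota>"
  by standard (rule iota_add)

lemma iota_0: "\<iota> 0 = 0"
  using additive.zero[OF additive_iota] .

lemma iota_eq_0: "\<iota> c = 0 \<longleftrightarrow> c = 0"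
proof
  assume "\<iota> c = 0"
  then have "c \<noteq> 0 \<Longrightarrow> \<iota> 1 = 0"
    using iota_mult[of c "inverse c"] by simp
  then show "c = 0" using iota_1 by auto
qed (simp add: iota_0)

abbreviation IA :: "int \<Rightarrow> 'r set" where "IA \<equiv> int_component A"

lemma IA_int [simp]: "IA (int n) = A n"
  by (simp add: int_component_def)

lemma IA_0 [simp]: "IA 0 = A 0" and IA_1 [simp]: "IA 1 = A 1"
  by (simp_all add: int_component_def One_nat_def)

lemma IA_neg: "j < 0 \<Longrightarrow> IA j = {0}"
  by (simp add: int_component_def)

text \<open>Indexing the ring by the integers makes it a graded module over itself.\<close>

lemma ids_IA: "internal_direct_sum UNIV IA"
proof (rule ids_reindex[OF ids_A])
  fix j assume "j \<notin> range int"
  then have "j < 0" by (metis not_less rangeI zero_le_imp_eq_int)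
  then show "IA j = {0}" by (rule IA_neg)
qed (simp_all add: inj_on_def)

lemma IA_subgroup: "additive_subgroup (IA j)"
  by (rule ids_subgroup[OF ids_IA])

lemma IA_zero: "0 \<in> IA j"
  by (rule additive_subgroup_0[OF IA_subgroup])

lemma IA_mult: "a \<in> A i \<Longrightarrow> x \<in> IA j \<Longrightarrow> a * x \<in> IA (int i + j)"
proof (cases "j < 0")
  case True
  assume "a \<in> A i" "x \<in> IA j"
  then have "a * x = 0" using True by (auto simp: IA_neg)
  then show ?thesis using IA_subgroup by (auto intro: additive_subgroup_0)
next
  case False
  assume "a \<in> A i" "x \<in> IA j"
  then have "a * x \<in> A (i + nat j)" using False by (intro A_mult) (auto simp: int_component_def)
  then show ?thesis using False by (simp add: int_component_def nat_add_distrib)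
qed

definition graded_on :: "('r \<Rightarrow> 'm::ab_group_add \<Rightarrow> 'm) \<Rightarrow> 'm set \<Rightarrow> (int \<Rightarrow> 'm set) \<Rightarrow> bool" where
  "graded_on s X V \<longleftrightarrow> module s \<and> module.subspace s X \<and> internal_direct_sum X V \<and>
     (\<forall>i j. \<forall>a\<in>A i. \<forall>x\<in>V j. s a x \<in> V (int i + j))"

lemma graded_on_UNIV: "graded_on s UNIV V \<longleftrightarrow> graded_module A s V"
  by (auto simp: graded_on_def graded_module_def module.subspace_UNIV)

lemma graded_on_ring: "graded_on (*) UNIV IA"
  by (auto simp: graded_on_def module_mult module.subspace_UNIV ids_IA IA_mult)

lemma graded_on_ids: "graded_on s X V \<Longrightarrow> internal_direct_sum X V"
  and graded_on_module: "graded_on s X V \<Longrightarrow> module s"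
  and graded_on_subspace: "graded_on s X V \<Longrightarrow> module.subspace s X"
  and graded_on_scale: "graded_on s X V \<Longrightarrow> a \<in> A i \<Longrightarrow> x \<in> V j \<Longrightarrow> s a x \<in> V (int i + j)"
  by (auto simp: graded_on_def)

lemma dcomp_scale:
  assumes "graded_on s X V" "a \<in> A i" "x \<in> X"
  shows "dcomp V (int i + j) (s a x) = s a (dcomp V j x)"
proof (rule dcomp_additive[OF graded_on_ids[OF assms(1)] graded_on_ids[OF assms(1)] _ _ _ assms(3)])
  show "bij ((+) (int i))"
    by (rule o_bij[where g = "\<lambda>j. j - int i"]) auto
qed (use assms in \<open>auto intro: additive_scale graded_on_module graded_on_scale\<close>)

lemma dcomp_scale1:
  assumes "graded_on s X V" "a \<in> A 1" "x \<in> X"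
  shows "dcomp V j (s a x) = s a (dcomp V (j - 1) x)"
  using dcomp_scale[OF assms, of "j - 1"] by simp

lemma dcomp_scale0:
  assumes "graded_on s X V" "x \<in> X"
  shows "dcomp V j (s (\<iota> c) x) = s (\<iota> c) (dcomp V j x)"
  using dcomp_scale[OF assms(1) _ assms(2), of "\<iota> c" 0 j] by (simp add: A_0)

text \<open>Since the algebra is generated by its forms of degree one, it suffices to test submodules on
  scalars and linear forms.\<close>

lemma subspaceI_A1:
  assumes s: "module s" and T: "additive_subgroup T"
    and "\<And>c x. x \<in> T \<Longrightarrow> s (\<iota> c) x \<in> T" "\<And>a x. a \<in> A 1 \<Longrightarrow> x \<in> T \<Longrightarrow> s a x \<in> T"
  shows "module.subspace s T"
proof -
  interpret module s by fact
  have "generated_subalgebra \<iota> (A 1) \<subseteq> {r. \<forall>x\<in>T. s r x \<in> T}"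
    unfolding generated_subalgebra_def
    by (rule Inter_lower)
      (use assms in \<open>auto simp: scale_left_distrib simp flip: scale_scale intro: additive_subgroup_add\<close>)
  then have "\<forall>r. \<forall>x\<in>T. s r x \<in> T"
    unfolding generated_A1 by auto
  then show ?thesis
    using T by (intro subspaceI) (auto simp: additive_subgroup_def)
qed

lemma subspace_homogeneous_component:
  assumes "graded_on s X V"
  shows "x \<in> V j \<Longrightarrow> s (\<iota> c) x \<in> V j"
  using graded_on_scale[OF assms, of "\<iota> c" 0 x j] by (simp add: A_0)

text \<open>For subgroups \<open>W r \<subseteq> V r\<close> this is the direct sum of the \<open>W r\<close>.\<close>

definition hsub :: "'m set \<Rightarrow> (int \<Rightarrow> 'm::ab_group_add set) \<Rightarrow> (int \<Rightarrow> 'm set) \<Rightarrow> 'm set" where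
  "hsub X V W = {x \<in> X. \<forall>r. dcomp V r x \<in> W r}"

lemma hsub_self: "internal_direct_sum X V \<Longrightarrow> hsub X V V = X"
  by (auto simp: hsub_def dcomp_mem)

lemma hsub_additive_subgroup:
  assumes D: "internal_direct_sum X V" and W: "\<And>r. additive_subgroup (W r)"
  shows "additive_subgroup (hsub X V W)"
  using ids_additive_subgroup[OF D] W
  by (auto simp: additive_subgroup_def hsub_def dcomp_0[OF D] dcomp_add[OF D] dcomp_minus[OF D])

lemma hsub_homogeneous:
  assumes D: "internal_direct_sum X V" and W: "\<And>r. additive_subgroup (W r)" "\<And>r. W r \<subseteq> V r"
  shows "hsub X V W \<inter> V j = W j"
proof (intro equalityI subsetI)
  fix x assume "x \<in> hsub X V W \<inter> V j"
  then show "x \<in> W j"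
    using dcomp_homogeneous[OF D, of x j j] by (auto simp: hsub_def dest: spec[of _ j])
next
  fix x assume x: "x \<in> W j"
  then have "x \<in> V j" using W by auto
  moreover have "x \<in> X" by (rule ids_component_subset[OF D \<open>x \<in> V j\<close>])
  moreover have "dcomp V r x \<in> W r" for r
    using dcomp_homogeneous[OF D \<open>x \<in> V j\<close>, of r] x additive_subgroup_0[OF W(1)] by auto
  ultimately show "x \<in> hsub X V W \<inter> V j" by (auto simp: hsub_def)
qed

text \<open>A linear form maps the component of degree \<open>r - 1\<close> to the one of degree \<open>r\<close>, so that the products
  can be sorted by degree.\<close>

lemma lmul_hsub:
  assumes g: "graded_on s X V" and W: "\<And>r. additive_subgroup (W r)" "\<And>r. W r \<subseteq> V r"
  shows "lm s (hsub X V W) = hsub X V (\<lambda>r. lm s (W (r - 1)))"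
proof
  note D = graded_on_ids[OF g]
  show "lm s (hsub X V W) \<subseteq> hsub X V (\<lambda>r. lm s (W (r - 1)))"
  proof (rule lmul_subsetI)
    fix a x assume a: "a \<in> A 1" and x: "x \<in> hsub X V W"
    then show "s a x \<in> hsub X V (\<lambda>r. lm s (W (r - 1)))"
      using dcomp_scale1[OF g a, of x] module.subspace_scale[OF graded_on_module[OF g] graded_on_subspace[OF g]]
      by (auto simp: hsub_def intro: lmul_base)
  qed (use hsub_additive_subgroup[OF D lmul_additive_subgroup[OF graded_on_module[OF g] W(1)]]
        in \<open>auto simp: additive_subgroup_def\<close>)
  show "hsub X V (\<lambda>r. lm s (W (r - 1))) \<subseteq> lm s (hsub X V W)"
  proof
    fix x assume x: "x \<in> hsub X V (\<lambda>r. lm s (W (r - 1)))"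
    have sub: "W r \<subseteq> hsub X V W" for r
      using hsub_homogeneous[OF D W, of r] by auto
    have "dcomp V r x \<in> lm s (hsub X V W)" for r
    proof -
      have "dcomp V r x \<in> lm s (W (r - 1))"
        using x by (simp add: hsub_def)
      then show ?thesis using lmul_mono[OF sub] by blast
    qed
    then have "(\<Sum>r | dcomp V r x \<noteq> 0. dcomp V r x) \<in> lm s (hsub X V W)"
      by (intro lmul_sum)
    then show "x \<in> lm s (hsub X V W)"
      using dcomp_sum[OF D, of x] x by (auto simp: hsub_def)
  qed
qed

lemma lmul_component:
  assumes g: "graded_on s X V" and W: "\<And>r. W r \<subseteq> V r"
  shows "lm s (W (r - 1)) \<subseteq> V r"
  by (rule lmul_subsetI)
    (use ids_subgroup[OF graded_on_ids[OF g], of r] graded_on_scale[OF g, of _ 1 _ "r - 1"] W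
      in \<open>auto simp: additive_subgroup_def\<close>)

lemma lmul_power_component:
  assumes g: "graded_on s X V"
  shows "(lm s ^^ q) (V (r - int q)) \<subseteq> V r"
proof (induct q arbitrary: r)
  case (Suc q)
  have "(lm s ^^ Suc q) (V (r - int (Suc q))) =
      lm s ((lm s ^^ q) (V ((r - 1) - int q)))"
    by (simp add: algebra_simps)
  also have "\<dots> \<subseteq> V r"
    using lmul_component[OF g, of "\<lambda>r. (lm s ^^ q) (V (r - int q))"] Suc by blast
  finally show ?case .
qed simp

lemma lmul_power_graded:
  assumes g: "graded_on s X V"
  shows "(lm s ^^ q) X = hsub X V (\<lambda>r. (lm s ^^ q) (V (r - int q)))"
proof (induct q)
  case 0
  then show ?case using hsub_self[OF graded_on_ids[OF g]] by simp
next
  case (Suc q)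
  have "lm s (hsub X V (\<lambda>r. (lm s ^^ q) (V (r - int q)))) =
    hsub X V (\<lambda>r. lm s ((lm s ^^ q) (V (r - 1 - int q))))"
    using lmul_power_component[OF g] ids_subgroup[OF graded_on_ids[OF g]]
    by (intro lmul_hsub[OF g]) (auto intro: lmul_power_additive_subgroup[OF graded_on_module[OF g]])
  then show ?case using Suc by (simp add: algebra_simps)
qed

section \<open>Submodules generated in one degree\<close>

text \<open>The right-hand side is closed under scalars and linear forms, hence a submodule, and it contains
  \<open>G i\<close>.\<close>

lemma span_component:
  assumes g: "graded_on s UNIV G"
  shows "module.span s (G i) = hsub UNIV G (\<lambda>r. if r < i then {0} else (lm s ^^ nat (r - i)) (G i))"
    (is "_ = hsub UNIV G ?W")
proof
  interpret module s by (rule graded_on_module[OF g])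
  note D = graded_on_ids[OF g]
  have subG: "additive_subgroup (G r)" for r using ids_subgroup[OF D] .
  have W: "additive_subgroup (?W r)" for r
    using lmul_power_additive_subgroup[OF module_axioms subG] by (auto simp: additive_subgroup_def)
  have WG: "?W r \<subseteq> G r" for r
    using lmul_power_component[OF g, of "nat (r - i)" r] additive_subgroup_0[OF subG] by auto
  have "subspace (hsub UNIV G ?W)"
  proof (rule subspaceI_A1[OF module_axioms hsub_additive_subgroup[OF D W]])
    fix c x assume x: "x \<in> hsub UNIV G ?W"
    have "s (\<iota> c) y \<in> ?W r" if "y \<in> ?W r" for y r
      using that lmul_power_scale_closed[OF module_axioms subspace_homogeneous_component[OF g]]
      by (auto split: if_splits)
    moreover have "dcomp G r x \<in> ?W r" for r using x unfolding hsub_def by blast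
    ultimately have "s (\<iota> c) (dcomp G r x) \<in> ?W r" for r by blast
    then show "s (\<iota> c) x \<in> hsub UNIV G ?W"
      unfolding hsub_def mem_Collect_eq dcomp_scale0[OF g UNIV_I] by blast
  next
    fix c x assume c: "c \<in> A 1" and x: "x \<in> hsub UNIV G ?W"
    have "s c y \<in> ?W r" if "y \<in> ?W (r - 1)" for y r
    proof (cases "r - 1 < i")
      case True
      then have "y = 0" using that by simp
      then show ?thesis using additive_subgroup_0[OF W, of r] by simp
    next
      case False
      then have "nat (r - i) = Suc (nat (r - 1 - i))" by simp
      then show ?thesis using that False c by (auto intro!: lmul_base)
    qed
    moreover have "dcomp G (r - 1) x \<in> ?W (r - 1)" for r using x unfolding hsub_def by blast
    ultimately have "s c (dcomp G (r - 1) x) \<in> ?W r" for r by blast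
    then show "s c x \<in> hsub UNIV G ?W"
      unfolding hsub_def mem_Collect_eq dcomp_scale1[OF g c UNIV_I] by blast
  qed
  moreover have "G i \<subseteq> hsub UNIV G ?W"
    using hsub_homogeneous[OF D W WG, of i] by auto
  ultimately show "span (G i) \<subseteq> hsub UNIV G ?W" by (rule_tac span_minimal)
  have pow: "(lm s ^^ q) (G i) \<subseteq> span (G i)" for q
    using lmul_power_mono[OF span_superset[of "G i"], of q s "A 1"]
      lmul_power_antimono[OF module_axioms subspace_span[of "G i"] le0[of q], of "A 1"] by auto
  show "hsub UNIV G ?W \<subseteq> span (G i)"
  proof
    fix x assume x: "x \<in> hsub UNIV G ?W"
    have "dcomp G r x \<in> span (G i)" for r
    proof (cases "r < i")
      case True
      have "dcomp G r x \<in> ?W r" using x unfolding hsub_def by blast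
      then show ?thesis using True by (simp add: span_zero)
    next
      case False
      have "dcomp G r x \<in> ?W r" using x unfolding hsub_def by blast
      then show ?thesis using pow[of "nat (r - i)"] False by auto
    qed
    then have "(\<Sum>r | dcomp G r x \<noteq> 0. dcomp G r x) \<in> span (G i)" by (intro span_sum)
    then show "x \<in> span (G i)" using dcomp_sum[OF D, of x] by simp
  qed
qed

lemma span_component_homogeneous:
  assumes g: "graded_on s UNIV G"
  shows "module.span s (G i) \<inter> G r = (if r < i then {0} else (lm s ^^ nat (r - i)) (G i))"
  unfolding span_component[OF g]
proof (rule hsub_homogeneous[OF graded_on_ids[OF g]])
  have subG: "additive_subgroup (G r)" for r using ids_subgroup[OF graded_on_ids[OF g]] .
  show "additive_subgroup (if r < i then {0} else (lm s ^^ nat (r - i)) (G i))" for r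
    using lmul_power_additive_subgroup[OF graded_on_module[OF g] subG] by (auto simp: additive_subgroup_def)
  show "(if r < i then {0} else (lm s ^^ nat (r - i)) (G i)) \<subseteq> G r" for r
    using lmul_power_component[OF g, of "nat (r - i)" r] additive_subgroup_0[OF subG] by auto
qed

lemma graded_on_span_component:
  assumes g: "graded_on s UNIV G"
  shows "graded_on s (module.span s (G i)) (\<lambda>r. module.span s (G i) \<inter> G r)"
proof -
  interpret module s by (rule graded_on_module[OF g])
  note D = graded_on_ids[OF g]
  have "internal_direct_sum (span (G i)) (\<lambda>r. span (G i) \<inter> G r)"
  proof (rule ids_subI[OF D subspace_imp_additive_subgroup[OF module_axioms subspace_span]])
    fix x r assume "x \<in> span (G i)"
    then have "dcomp G r x \<in> (if r < i then {0} else (lm s ^^ nat (r - i)) (G i))"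
      unfolding span_component[OF g] hsub_def by blast
    then show "dcomp G r x \<in> span (G i)" using span_component_homogeneous[OF g, of i r] by auto
  qed simp
  then show ?thesis
    using graded_on_scale[OF g] module_axioms by (auto simp: graded_on_def span_scale)
qed

section \<open>Powers of the irrelevant ideal\<close>

text \<open>The ring is generated, as a module over itself, by its component of degree \<open>0\<close>, and the
  components of such a module have just been computed.\<close>

lemma A_eq_lmul_power: "A n = (lm (*) ^^ n) (A 0)"
proof -
  interpret module "(*) :: 'r \<Rightarrow> _" by (rule module_mult)
  have "1 \<in> A 0" by (metis A_0 iota_1 rangeI)
  then have "x \<in> span (A 0)" for x
    using span_scale[OF span_base[of 1 "A 0"], of x] by simp
  then have "span (IA 0) \<inter> IA (int n) = A n" by auto
  then show ?thesis
    unfolding span_component_homogeneous[OF graded_on_ring] by simp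
qed

lemma A_add_eq_lmul_power: "A (q + n) = (lm (*) ^^ q) (A n)"
  unfolding A_eq_lmul_power[of "q + n"] A_eq_lmul_power[of n] by (simp add: funpow_add)

lemma lmul_power_ring_component:
  "(lm (*) ^^ q) (IA (j - int q)) = (if j < int q then {0} else IA j)"
proof (cases "j < int q")
  case True
  have "(lm (*) ^^ q) {0} = {0::'r}"
  proof (induct q)
    case (Suc q)
    have "lm (*) {0} = {0::'r}"
      using lmul_subsetI[of "{0}" "A 1" "{0}" "(*)"] lmul.zero[of "(*)" "A 1" "{0}"] by auto
    then show ?case using Suc by simp
  qed simp
  then show ?thesis using True by (simp add: IA_neg)
next
  case False
  define n where "n = nat (j - int q)"
  have "j = int (q + n)" using False by (simp add: n_def)
  then show ?thesis using A_add_eq_lmul_power[of q n] IA_int[of "q + n"] by simp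
qed

text \<open>An element whose components all have degree at least \<open>q\<close> lies in the \<open>q\<close>-th power because
  \<open>R\<^bsub>q+n\<^esub> = (R\<^sub>1)\<^sup>q R\<^sub>n\<close>.\<close>

lemma lmul_power_ring_iff:
  "r \<in> (lm (*) ^^ q) UNIV \<longleftrightarrow> (\<forall>j<int q. dcomp IA j r = 0)"
  unfolding lmul_power_graded[OF graded_on_ring] hsub_def lmul_power_ring_component
  using dcomp_mem[OF ids_IA] by auto

lemma irrelevant_ideal_eq: "irrelevant_ideal A = lm (*) UNIV"
proof -
  have neg: "dcomp IA j r = 0" if "j < 0" for j r
    using dcomp_mem[OF ids_IA, of r j] IA_neg[OF that] by auto
  have "(\<forall>j<1. dcomp IA j r = 0) \<longleftrightarrow> dcomp IA 0 r = 0" for r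
    using neg[of _ r] by (metis int_one_le_iff_zero_less linorder_neqE_linordered_idom not_le zero_less_one)
  then have iff: "r \<in> lm (*) UNIV \<longleftrightarrow> dcomp IA 0 r = 0" for r
    using lmul_power_ring_iff[of r 1] by (simp add: One_nat_def)
  show ?thesis
  proof (intro equalityI subsetI)
    fix r assume "r \<in> irrelevant_ideal A"
    then obtain J f where J: "finite J" "J \<subseteq> {1..}" "\<forall>i\<in>J. f i \<in> A i" "r = (\<Sum>i\<in>J. f i)"
      by (auto simp: irrelevant_ideal_def family_sum_def)
    have "dcomp IA 0 (f i) = 0" if "i \<in> J" for i
      using dcomp_homogeneous[OF ids_IA, of "f i" "int i" 0] J that by auto
    then have "dcomp IA 0 r = 0"
      unfolding J(4) by (subst dcomp_of_sum[OF ids_IA]) auto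
    then show "r \<in> lm (*) UNIV" using iff by blast
  next
    fix r :: 'r
    let ?J = "{j. dcomp IA j r \<noteq> 0}"
    assume "r \<in> lm (*) UNIV"
    then have "dcomp IA 0 r = 0" using iff by blast
    have pos: "j \<ge> 1" if "j \<in> ?J" for j
    proof -
      have "j \<noteq> 0" using that \<open>dcomp IA 0 r = 0\<close> by auto
      moreover have "\<not> j < 0" using that neg[of j r] by auto
      ultimately show ?thesis by simp
    qed
    have "r = (\<Sum>j\<in>?J. dcomp IA j r)" using dcomp_sum[OF ids_IA, of r] by simp
    also have "\<dots> = (\<Sum>i\<in>nat ` ?J. dcomp IA (int i) r)"
      using pos by (subst sum.reindex) (force simp: inj_on_def o_def intro!: sum.cong)+
    finally have "r = (\<Sum>i\<in>nat ` ?J. dcomp IA (int i) r)" .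
    moreover have "dcomp IA (int i) r \<in> A i" for i
      using dcomp_mem[OF ids_IA, of r "int i"] by simp
    moreover have "finite (nat ` ?J)" "nat ` ?J \<subseteq> {1..}"
      using dcomp_finite[OF ids_IA, of r] pos by force+
    ultimately show "r \<in> irrelevant_ideal A"
      unfolding irrelevant_ideal_def family_sum_def by blast
  qed
qed

lemma irrelevant_ideal_iff: "r \<in> irrelevant_ideal A \<longleftrightarrow> dcomp IA 0 r = 0"
proof -
  have neg: "dcomp IA j r = 0" if "j < 0" for j
    using dcomp_mem[OF ids_IA, of r j] IA_neg[OF that] by auto
  have "(\<forall>j<1. dcomp IA j r = 0) \<longleftrightarrow> dcomp IA 0 r = 0"
    using neg by (metis int_one_le_iff_zero_less linorder_neqE_linordered_idom not_le zero_less_one)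
  then show ?thesis
    using lmul_power_ring_iff[of r 1] by (simp add: irrelevant_ideal_eq One_nat_def)
qed

text \<open>For fixed \<open>x\<close> the map \<open>r \<mapsto> r x\<close> carries products of linear forms to such products; and since
  \<open>\<mm>\<close> is generated by the linear forms, iterated multiplication by them recovers the powers of
  \<open>\<mm>\<close>.\<close>

lemma ideal_times_lmul_power_ring:
  assumes s: "module s" and N: "module.subspace s N"
  shows "ideal_times s ((lm (*) ^^ q) UNIV) N = (lm s ^^ q) N"
proof -
  interpret module s by fact
  have scale: "s r x \<in> (lm s ^^ q) N" if "r \<in> (lm (*) ^^ q) UNIV" "x \<in> N" for r x q
  proof -
    have "s r x \<in> (\<lambda>r. s r x) ` (lm (*) ^^ q) UNIV" using that by blast
    also have "\<dots> = (lm s ^^ q) (range (\<lambda>r. s r x))"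
      by (rule lmul_power_image) (auto simp: additive_def scale_left_distrib)
    also have "\<dots> \<subseteq> (lm s ^^ q) N"
      using that N by (intro lmul_power_mono) (auto intro: subspace_scale)
    finally show ?thesis .
  qed
  show ?thesis
  proof
    show "ideal_times s ((lm (*) ^^ q) UNIV) N \<subseteq> (lm s ^^ q) N"
      unfolding ideal_times_def
      by (rule span_minimal) (use scale lmul_power_subspace[OF s N] in auto)
    show "(lm s ^^ q) N \<subseteq> ideal_times s ((lm (*) ^^ q) UNIV) N"
    proof (induct q)
      case 0
      have "x \<in> ideal_times s UNIV N" if "x \<in> N" for x
        using that unfolding ideal_times_def by (intro span_base) (auto intro!: exI[of _ 1])
      then show ?case by auto
    next
      case (Suc q)
      let ?I = "\<lambda>q. (lm (*) ^^ q) UNIV"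
      have "lm s (ideal_times s (?I q) N) \<subseteq> ideal_times s (?I (Suc q)) N"
      proof (rule lmul_subsetI)
        fix a x assume a: "a \<in> A 1" and x: "x \<in> ideal_times s (?I q) N"
        from x show "s a x \<in> ideal_times s (?I (Suc q)) N"
          unfolding ideal_times_def
        proof (induct x rule: span_induct_alt)
          case (step c x y)
          then obtain r z where rz: "x = s r z" "r \<in> ?I q" "z \<in> N" by blast
          have "s (a * r) z \<in> {s a x |a x. a \<in> ?I (Suc q) \<and> x \<in> N}"
            using a rz lmul_base[of a "A 1" r "?I q" "(*)"] by auto
          from span_add[OF span_scale[OF span_base[OF this]] step(2)]
          have "s c (s (a * r) z) + s a y \<in> span {s a x |a x. a \<in> ?I (Suc q) \<and> x \<in> N}" .
          then show ?case
            by (simp add: rz scale_right_distrib mult.left_commute)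
        qed (simp add: span_zero)
      qed (auto simp: ideal_times_def intro: span_zero span_add)
      then show ?case using lmul_mono[OF Suc, of s "A 1"] by auto
    qed
  qed
qed

lemma ideal_times_irrelevant:
  assumes "module s" "module.subspace s N"
  shows "ideal_times s (irrelevant_ideal A) N = lm s N"
  using ideal_times_lmul_power_ring[OF assms, of 1] by (simp add: irrelevant_ideal_eq One_nat_def)

lemma ideal_power_irrelevant: "ideal_power (irrelevant_ideal A) q = (lm (*) ^^ q) UNIV"
  by (induct q)
    (simp_all add: ideal_times_irrelevant[OF module_mult lmul_power_subspace[OF module_mult module.subspace_UNIV[OF module_mult]]])

lemma ideal_times_ideal_power:
  assumes "module s" "module.subspace s N"
  shows "ideal_times s (ideal_power (irrelevant_ideal A) q) N = (lm s ^^ q) N"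
  by (simp add: ideal_power_irrelevant ideal_times_lmul_power_ring[OF assms])

section \<open>Graded free modules\<close>

definition fcomp :: "nat \<Rightarrow> (nat \<Rightarrow> int) \<Rightarrow> int \<Rightarrow> (nat \<Rightarrow>\<^sub>0 'r) set" where
  "fcomp b d j = {f \<in> fcar b. \<forall>i<b. lookup f i \<in> IA (j - d i)}"

lemma ids_shifted: "internal_direct_sum UNIV (\<lambda>j. IA (j - t))"
  by (rule ids_reindex[OF ids_IA, of "\<lambda>j. j + t"])
    (auto simp: inj_on_def image_iff intro: exI[of _ "_ - t"])

lemma additive_subgroup_fcar: "additive_subgroup (fcar b :: (nat \<Rightarrow>\<^sub>0 'r) set)"
  by (rule subspace_imp_additive_subgroup[OF module_free_scale subspace_fcar])

lemma lookup_sum_coordinates: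
  assumes "finite J" "\<And>i j. i < b \<Longrightarrow> j \<notin> J \<Longrightarrow> g j i = 0" "\<And>i. i < b \<Longrightarrow> lookup f i = (\<Sum>j\<in>J. g j i)" "f \<in> fcar b"
  shows "f = (\<Sum>j\<in>J. tup b (g j))"
proof (rule fcar_eqI[OF assms(4)])
  show "(\<Sum>j\<in>J. tup b (g j)) \<in> fcar b" by (auto simp: fcar_iff lookup_sum)
qed (use assms in \<open>auto simp: lookup_sum\<close>)

lemma ids_fcomp: "internal_direct_sum (fcar b) (fcomp b d)"
  unfolding internal_direct_sum_def
proof (intro conjI allI impI)
  show sub: "additive_subgroup (fcomp b d j)" for j
    using additive_subgroup_fcar[of b] IA_subgroup
    by (auto simp: additive_subgroup_def fcomp_def lookup_add)
  show "fcar b = family_sum UNIV (fcomp b d)"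
  proof (intro equalityI subsetI)
    fix f :: "nat \<Rightarrow>\<^sub>0 'r" assume f: "f \<in> fcar b"
    let ?g = "\<lambda>j i. dcomp (\<lambda>j. IA (j - d i)) j (lookup f i)"
    let ?J = "\<Union>i<b. {j. ?g j i \<noteq> 0}"
    have fin: "finite ?J" using dcomp_finite[OF ids_shifted] by auto
    have "f = (\<Sum>j\<in>?J. tup b (?g j))"
      by (rule lookup_sum_coordinates[OF fin _ _ f])
        (use dcomp_sum_superset[OF ids_shifted UNIV_I fin] in \<open>auto intro!: dcomp_sum_superset[OF ids_shifted UNIV_I fin, symmetric]\<close>)
    moreover have "tup b (?g j) \<in> fcomp b d j" for j
      using dcomp_mem[OF ids_shifted] by (auto simp: fcomp_def)
    ultimately show "f \<in> family_sum UNIV (fcomp b d)"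
      unfolding family_sum_def using fin by blast
  next
    fix f :: "nat \<Rightarrow>\<^sub>0 'r" assume "f \<in> family_sum UNIV (fcomp b d)"
    then obtain J g where "f = (\<Sum>i\<in>J. g i)" "\<forall>i\<in>J. g i \<in> fcomp b d i"
      by (auto simp: family_sum_def)
    then show "f \<in> fcar b"
      by (auto intro!: additive_subgroup_sum[OF additive_subgroup_fcar] simp: fcomp_def)
  qed
  fix J f assume J: "finite J \<and> (\<forall>i\<in>J. f i \<in> fcomp b d i) \<and> (\<Sum>i\<in>J. f i) = 0"
  show "\<forall>j\<in>J. f j = 0"
  proof
    fix j assume j: "j \<in> J"
    have "lookup (f j) i = 0" if i: "i < b" for i
    proof -
      have "(\<Sum>j\<in>J. lookup (f j) i) = 0" using J by (metis lookup_sum lookup_zero)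
      from ids_independent[OF ids_shifted[of "d i"] _ _ this j]
      show ?thesis using J i by (auto simp: fcomp_def)
    qed
    moreover have "f j \<in> fcar b" using J j by (auto simp: fcomp_def)
    ultimately show "f j = 0"
      by (intro fcar_eqI[of _ b]) (auto simp: fcar_iff)
  qed
qed

lemma fcomp_subgroup: "additive_subgroup (fcomp b d j)"
  by (rule ids_subgroup[OF ids_fcomp])

lemma graded_on_fcar: "graded_on free_scale (fcar b) (fcomp b d)"
  unfolding graded_on_def
proof (intro conjI module_free_scale subspace_fcar ids_fcomp allI ballI)
  fix i j a f assume "a \<in> A i" "f \<in> fcomp b d j"
  then show "free_scale a f \<in> fcomp b d (int i + j)"
    using IA_mult[of a i] by (auto simp: fcomp_def fcar_iff add_diff_eq[symmetric])
qed

text \<open>Statements about the \<open>\<mm>\<close>-adic filtration of a free module reduce to the ring itself.\<close>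

lemma lmul_coordinates:
  assumes P: "\<And>i. i < b \<Longrightarrow> 0 \<in> P i"
  shows "lmul free_scale U {f \<in> fcar b. \<forall>i<b. lookup f i \<in> P i} =
    {f \<in> fcar b. \<forall>i<b. lookup f i \<in> lmul (*) U (P i)}" (is "lmul _ _ ?F = ?G")
proof
  show "lmul free_scale U ?F \<subseteq> ?G"
    by (rule lmul_subsetI) (auto simp: fcar_iff lookup_add intro: lmul.zero lmul_add lmul_base)
  show "?G \<subseteq> lmul free_scale U ?F"
  proof
    fix f assume f: "f \<in> ?G"
    have "Poly_Mapping.single i (lookup f i) \<in> lmul free_scale U ?F" if i: "i < b" for i
    proof -
      have "Poly_Mapping.single i (lookup f i) \<in> Poly_Mapping.single i ` lmul (*) U (P i)"
        using f i by blast
      also have "\<dots> = lmul free_scale U (Poly_Mapping.single i ` P i)"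
        by (rule lmul_image) (auto simp: additive_def single_add lookup_single mult_when intro!: poly_mapping_eqI)
      also have "\<dots> \<subseteq> lmul free_scale U ?F"
        using i P by (intro lmul_mono) (auto simp: fcar_iff lookup_single when_def)
      finally show ?thesis .
    qed
    then have "(\<Sum>i<b. Poly_Mapping.single i (lookup f i)) \<in> lmul free_scale U ?F"
      by (intro lmul_sum) auto
    moreover have "f = (\<Sum>i<b. Poly_Mapping.single i (lookup f i))"
      by (rule fcar_eqI[of _ b]) (use f in \<open>auto simp: fcar_iff lookup_sum lookup_single when_def\<close>)
    ultimately show "f \<in> lmul free_scale U ?F" by simp
  qed
qed

lemma lmul_power_coordinates:
  fixes U :: "'r set"
  shows "(lmul free_scale U ^^ q) (fcar b) = {f \<in> fcar b. \<forall>i<b. lookup f i \<in> (lmul (*) U ^^ q) UNIV}"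
proof (induct q)
  case (Suc q)
  have "0 \<in> (lmul (*) U ^^ q) (UNIV::'r set)"
    using lmul_power_subspace[OF module_mult module.subspace_UNIV[OF module_mult]]
    by (rule module.subspace_0[OF module_mult])
  then show ?case
    using lmul_coordinates[of b "\<lambda>_. (lmul (*) U ^^ q) UNIV"] Suc by simp
qed simp

end

section \<open>The Hilbert basis theorem for modules\<close>

text \<open>A set \<open>U\<close> of operators takes the place of a subring: the algebra is built up by adjoining one
  generator at a time, and submodules over the intermediate subalgebras are those closed under the
  generators adjoined so far.\<close>

definition op_closed :: "('r \<Rightarrow> 'm::ab_group_add \<Rightarrow> 'm) \<Rightarrow> 'r set \<Rightarrow> 'm set \<Rightarrow> bool" where
  "op_closed s U Z \<longleftrightarrow> additive_subgroup Z \<and> (\<forall>a\<in>U. \<forall>z\<in>Z. s a z \<in> Z)"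

definition op_span :: "('r \<Rightarrow> 'm::ab_group_add \<Rightarrow> 'm) \<Rightarrow> 'r set \<Rightarrow> 'm set \<Rightarrow> 'm set" where
  "op_span s U B = \<Inter> {Z. op_closed s U Z \<and> B \<subseteq> Z}"

definition op_noetherian :: "('r \<Rightarrow> 'm::ab_group_add \<Rightarrow> 'm) \<Rightarrow> 'r set \<Rightarrow> 'm set \<Rightarrow> bool" where
  "op_noetherian s U P \<longleftrightarrow>
     (\<forall>Z. op_closed s U Z \<and> Z \<subseteq> P \<longrightarrow> (\<exists>B. finite B \<and> B \<subseteq> Z \<and> Z \<subseteq> op_span s U B))"

lemma op_closedI:
  assumes "0 \<in> Z" "\<And>x y. x \<in> Z \<Longrightarrow> y \<in> Z \<Longrightarrow> x + y \<in> Z" "\<And>x. x \<in> Z \<Longrightarrow> - x \<in> Z"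
    "\<And>a x. a \<in> U \<Longrightarrow> x \<in> Z \<Longrightarrow> s a x \<in> Z"
  shows "op_closed s U Z"
  using assms by (simp add: op_closed_def additive_subgroup_def)

lemma op_closedD:
  assumes "op_closed s U Z"
  shows "0 \<in> Z" "x \<in> Z \<Longrightarrow> y \<in> Z \<Longrightarrow> x + y \<in> Z" "x \<in> Z \<Longrightarrow> - x \<in> Z"
    "a \<in> U \<Longrightarrow> x \<in> Z \<Longrightarrow> s a x \<in> Z"
  using assms by (auto simp: op_closed_def additive_subgroup_def)

lemma op_closed_Int: "op_closed s U Y \<Longrightarrow> op_closed s U Z \<Longrightarrow> op_closed s U (Y \<inter> Z)"
  by (simp add: op_closed_def additive_subgroup_Int)

lemma op_closed_chain_Union:
  assumes L: "\<And>n. op_closed s U (L n)" and mono: "\<And>m n::nat. m \<le> n \<Longrightarrow> L m \<subseteq> L n"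
  shows "op_closed s U (\<Union>n. L n)"
proof (rule op_closedI)
  show "0 \<in> (\<Union>n. L n)" using op_closedD(1)[OF L, of 0] by blast
  show "x + y \<in> (\<Union>n. L n)" if xy: "x \<in> (\<Union>n. L n)" "y \<in> (\<Union>n. L n)" for x y
  proof -
    obtain m n where "x \<in> L m" "y \<in> L n" using xy by blast
    then have "x \<in> L (max m n)" "y \<in> L (max m n)"
      using mono[of m "max m n"] mono[of n "max m n"] by auto
    then show ?thesis using op_closedD(2)[OF L] by blast
  qed
  show "- x \<in> (\<Union>n. L n)" if "x \<in> (\<Union>n. L n)" for x
    using that op_closedD(3)[OF L] by blast
  show "s a x \<in> (\<Union>n. L n)" if a: "a \<in> U" and x: "x \<in> (\<Union>n. L n)" for a x
  proof -
    obtain n where "x \<in> L n" using x by blast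
    then have "s a x \<in> L n" by (rule op_closedD(4)[OF L a])
    then show ?thesis by blast
  qed
qed

lemma op_span_closed: "op_closed s U (op_span s U B)"
  unfolding op_span_def op_closed_def additive_subgroup_def by auto

lemma op_span_base: "B \<subseteq> op_span s U B"
  unfolding op_span_def by auto

lemma op_span_minimal: "op_closed s U Z \<Longrightarrow> B \<subseteq> Z \<Longrightarrow> op_span s U B \<subseteq> Z"
  unfolding op_span_def by auto

text \<open>The elements of degree less than \<open>n\<close> in \<open>P[t] = P + tP + t\<^sup>2P + \<dots>\<close>.\<close>

primrec poly_below :: "('r::comm_ring_1 \<Rightarrow> 'm::ab_group_add \<Rightarrow> 'm) \<Rightarrow> 'r \<Rightarrow> 'm set \<Rightarrow> nat \<Rightarrow> 'm set" where
  "poly_below s t P 0 = {0}"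
| "poly_below s t P (Suc n) = {q + s (t ^ n) p | q p. q \<in> poly_below s t P n \<and> p \<in> P}"

context
  fixes s :: "'r::comm_ring_1 \<Rightarrow> 'm::ab_group_add \<Rightarrow> 'm" and U :: "'r set" and P :: "'m set" and t :: 'r
  assumes s: "module s" and P: "op_closed s U P"
begin

interpretation module s by fact

private abbreviation "PB \<equiv> poly_below s t P"

lemma poly_below_SucI: "q \<in> PB n \<Longrightarrow> p \<in> P \<Longrightarrow> x = q + s (t ^ n) p \<Longrightarrow> x \<in> PB (Suc n)"
  unfolding poly_below.simps by blast

lemma poly_below_SucE:
  assumes "x \<in> PB (Suc n)"
  obtains q p where "q \<in> PB n" "p \<in> P" "x = q + s (t ^ n) p"
  using assms by auto

lemma poly_below_closed: "op_closed s U (PB n)"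
proof (induct n)
  case 0
  then show ?case by (simp add: op_closed_def additive_subgroup_def)
next
  case (Suc n)
  note p = op_closedD[OF P] and q = op_closedD[OF Suc]
  show ?case
  proof (rule op_closedI)
    show "0 \<in> PB (Suc n)" by (rule poly_below_SucI[OF q(1) p(1)]) simp
    show "x + y \<in> PB (Suc n)" if xy: "x \<in> PB (Suc n)" "y \<in> PB (Suc n)" for x y
    proof -
      obtain u v where uv: "u \<in> PB n" "v \<in> P" "x = u + s (t ^ n) v" by (rule poly_below_SucE[OF xy(1)])
      obtain u' v' where uv': "u' \<in> PB n" "v' \<in> P" "y = u' + s (t ^ n) v'" by (rule poly_below_SucE[OF xy(2)])
      show ?thesis
        by (rule poly_below_SucI[OF q(2)[OF uv(1) uv'(1)] p(2)[OF uv(2) uv'(2)]])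
          (simp add: uv(3) uv'(3) scale_right_distrib)
    qed
    show "- x \<in> PB (Suc n)" if x: "x \<in> PB (Suc n)" for x
      by (rule poly_below_SucE[OF x], rule poly_below_SucI[OF q(3) p(3)]) auto
    show "s a x \<in> PB (Suc n)" if a: "a \<in> U" and x: "x \<in> PB (Suc n)" for a x
      by (rule poly_below_SucE[OF x], rule poly_below_SucI[OF q(4)[OF a] p(4)[OF a]])
        (auto simp: scale_right_distrib mult.commute)
  qed
qed

lemma poly_below_Suc: "PB n \<subseteq> PB (Suc n)"
proof
  fix x assume "x \<in> PB n"
  then show "x \<in> PB (Suc n)" by (rule poly_below_SucI[OF _ op_closedD(1)[OF P]]) simp
qed

lemma poly_below_mono: "m \<le> n \<Longrightarrow> PB m \<subseteq> PB n"
  by (rule lift_Suc_mono_le[of PB, OF poly_below_Suc])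

lemma poly_below_mult: "x \<in> PB n \<Longrightarrow> s t x \<in> PB (Suc n)"
proof (induct n arbitrary: x)
  case 0
  then show ?case using op_closedD(1)[OF poly_below_closed, of 1] by (simp add: One_nat_def)
next
  case (Suc n)
  obtain q p where qp: "q \<in> PB n" "p \<in> P" "x = q + s (t ^ n) p"
    by (rule poly_below_SucE[OF Suc(2)])
  show ?case by (rule poly_below_SucI[OF Suc(1)[OF qp(1)] qp(2)]) (simp add: qp(3) scale_right_distrib)
qed

lemma poly_below_mult_power: "x \<in> PB n \<Longrightarrow> s (t ^ k) x \<in> PB (n + k)"
proof (induct k)
  case (Suc k)
  then show ?case using poly_below_mult[of "s (t ^ k) x" "n + k"] by simp
qed simp

lemma poly_below_Union_closed: "op_closed s (insert t U) (\<Union>n. PB n)"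
proof -
  have "op_closed s U (\<Union>n. PB n)"
    by (rule op_closed_chain_Union[OF poly_below_closed poly_below_mono])
  moreover have "s t x \<in> (\<Union>n. PB n)" if "x \<in> (\<Union>n. PB n)" for x
    using that poly_below_mult by blast
  ultimately show ?thesis unfolding op_closed_def by blast
qed

text \<open>The possible coefficients of \<open>t\<^sup>n\<close>, in \<open>P\<close> or not, in elements of \<open>Z\<close> of degree \<open>n\<close>. As the
  powers of \<open>t\<close> may be dependent, the element does not determine its leading coefficient.\<close>

definition lead :: "'m set \<Rightarrow> nat \<Rightarrow> 'm set" where
  "lead Z n = {p. \<exists>z\<in>Z. z - s (t ^ n) p \<in> PB n}"

lemma lead_closed:
  assumes Z: "op_closed s U Z"
  shows "op_closed s U (lead Z n)"
proof (rule op_closedI)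
  note z = op_closedD[OF Z] and q = op_closedD[OF poly_below_closed[of n]]
  show "0 \<in> lead Z n" unfolding lead_def using z(1) q(1) by (auto intro!: bexI[of _ 0])
  show "x + y \<in> lead Z n" if xy: "x \<in> lead Z n" "y \<in> lead Z n" for x y
  proof -
    obtain v w where vw: "v \<in> Z" "w \<in> Z" "v - s (t ^ n) x \<in> PB n" "w - s (t ^ n) y \<in> PB n"
      using xy by (auto simp: lead_def)
    have "(v + w) - s (t ^ n) (x + y) \<in> PB n"
      using q(2)[OF vw(3,4)] by (simp add: algebra_simps)
    then show ?thesis using z(2)[OF vw(1,2)] by (auto simp: lead_def)
  qed
  show "- x \<in> lead Z n" if x: "x \<in> lead Z n" for x
  proof -
    obtain v where v: "v \<in> Z" "v - s (t ^ n) x \<in> PB n" using x by (auto simp: lead_def)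
    have "- v - s (t ^ n) (- x) \<in> PB n" using q(3)[OF v(2)] by simp
    then show ?thesis using z(3)[OF v(1)] unfolding lead_def by blast
  qed
  show "s a x \<in> lead Z n" if a: "a \<in> U" and x: "x \<in> lead Z n" for a x
  proof -
    obtain v where v: "v \<in> Z" "v - s (t ^ n) x \<in> PB n" using x by (auto simp: lead_def)
    have "s a v - s (t ^ n) (s a x) \<in> PB n"
      using q(4)[OF a v(2)] by (simp add: scale_right_diff_distrib mult.commute)
    then show ?thesis using z(4)[OF a v(1)] unfolding lead_def by blast
  qed
qed

text \<open>Multiplication by \<open>t\<close> raises the degree and keeps the leading coefficient, whence the modules of
  leading coefficients form a chain.\<close>

lemma lead_shift:
  assumes Z: "\<And>x. x \<in> Z \<Longrightarrow> s t x \<in> Z" and p: "p \<in> lead Z m" and mn: "m \<le> n"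
  shows "p \<in> lead Z n"
proof -
  obtain v where v: "v \<in> Z" "v - s (t ^ m) p \<in> PB m" using p by (auto simp: lead_def)
  have "s (t ^ k) v \<in> Z" for k
  proof (induct k)
    case (Suc k)
    then show ?case using Z[of "s (t ^ k) v"] by simp
  qed (simp add: v)
  moreover have "s (t ^ (n - m)) v - s (t ^ n) p \<in> PB n"
    using poly_below_mult_power[OF v(2), of "n - m"] mn
    by (simp add: scale_right_diff_distrib flip: power_add)
  ultimately show ?thesis unfolding lead_def by blast
qed

text \<open>Hilbert's argument: a submodule \<open>Z\<close> of \<open>P[t]\<close> is generated by finitely many elements whose
  leading coefficients generate the modules of leading coefficients of \<open>Z\<close>, which form a chain that
  becomes stationary.\<close>

lemma op_noetherian_adjoin:
  assumes noeth: "op_noetherian s U P"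
  shows "op_noetherian s (insert t U) (\<Union>n. PB n)"
  unfolding op_noetherian_def
proof (intro allI impI, elim conjE)
  fix Z assume Z: "op_closed s (insert t U) Z" and ZP: "Z \<subseteq> (\<Union>n. PB n)"
  have weaken: "op_closed s U Y" if "op_closed s (insert t U) Y" for Y
    using that by (simp add: op_closed_def)
  define L where "L n = P \<inter> lead Z n" for n
  have L_closed: "op_closed s U (L n)" for n
    unfolding L_def by (rule op_closed_Int[OF P lead_closed[OF weaken[OF Z]]])
  have L_P: "L n \<subseteq> P" for n by (auto simp: L_def)
  have L_mono: "L m \<subseteq> L n" if "m \<le> n" for m n
    using lead_shift[of Z _ m n] op_closedD(4)[OF Z, of t] that by (auto simp: L_def)
  \<comment> \<open>the chain of the \<open>L n\<close> is stationary from \<open>m\<close> on\<close>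
  obtain m where m: "\<And>n. L n \<subseteq> L m"
  proof -
    have "op_closed s U (\<Union>n. L n)" by (rule op_closed_chain_Union[OF L_closed L_mono])
    then obtain B where B: "finite B" "B \<subseteq> (\<Union>n. L n)" "(\<Union>n. L n) \<subseteq> op_span s U B"
      using noeth L_P unfolding op_noetherian_def by (meson UN_least)
    have "\<exists>m. B \<subseteq> L m"
      using B(1,2)
    proof (induct B rule: finite_induct)
      case (insert b B)
      then obtain m n where "B \<subseteq> L m" "b \<in> L n" by auto
      then have "insert b B \<subseteq> L (max m n)"
        using L_mono[of m "max m n"] L_mono[of n "max m n"] by auto
      then show ?case by blast
    qed auto
    then obtain m where "B \<subseteq> L m" by blast
    then have "op_span s U B \<subseteq> L m" by (rule op_span_minimal[OF L_closed])
    then show ?thesis using that B(3) by blast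
  qed
  have "\<exists>G. finite G \<and> G \<subseteq> L n \<and> L n \<subseteq> op_span s U G" for n
    using noeth L_closed L_P unfolding op_noetherian_def by blast
  then obtain G where G: "\<And>n. finite (G n)" "\<And>n. G n \<subseteq> L n" "\<And>n. L n \<subseteq> op_span s U (G n)"
    by metis
  define zf where "zf n g = (SOME z. z \<in> Z \<and> z - s (t ^ n) g \<in> PB n)" for n g
  have zf: "zf n g \<in> Z \<and> zf n g - s (t ^ n) g \<in> PB n" if "g \<in> G n" for n g
    unfolding zf_def by (rule someI_ex) (use subsetD[OF G(2) that] in \<open>auto simp: L_def lead_def\<close>)
  define B where "B = (\<Union>n\<le>m. zf n ` G n)"
  define S where "S = op_span s (insert t U) B"
  have finB: "finite B" using G(1) by (auto simp: B_def)
  have BZ: "B \<subseteq> Z" using zf by (auto simp: B_def)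
  have S: "op_closed s (insert t U) S" unfolding S_def by (rule op_span_closed)
  have SZ: "S \<subseteq> Z" unfolding S_def by (rule op_span_minimal[OF Z BZ])
  have lead_S: "L n \<subseteq> lead S n" if "n \<le> m" for n
  proof -
    have "G n \<subseteq> lead S n"
    proof
      fix g assume g: "g \<in> G n"
      have "zf n g \<in> S" using g that op_span_base[of B s "insert t U"] by (auto simp: S_def B_def)
      then show "g \<in> lead S n" using zf[OF g] unfolding lead_def by blast
    qed
    then show ?thesis
      using op_span_minimal[OF lead_closed[OF weaken[OF S]]] G(3)[of n] by blast
  qed
  \<comment> \<open>beyond \<open>m\<close>, multiples by powers of \<open>t\<close> of the elements for \<open>m\<close> have the leading coefficients\<close>
  have lead_S': "p \<in> lead S n" if p: "p \<in> L n" for n p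
  proof (cases "n \<le> m")
    case False
    have "p \<in> lead S m" using lead_S[of m] p m by blast
    then show ?thesis
      by (rule lead_shift[rotated]) (use op_closedD(4)[OF S, of t] False in auto)
  qed (use lead_S p in blast)
  have "Z \<inter> PB n \<subseteq> S" for n
  proof (induct n)
    case 0
    then show ?case using op_closedD(1)[OF S] by auto
  next
    case (Suc n)
    show ?case
    proof
      fix z assume z: "z \<in> Z \<inter> PB (Suc n)"
      then obtain q p where qp: "q \<in> PB n" "p \<in> P" "z = q + s (t ^ n) p"
        by (elim IntE poly_below_SucE)
      have "z - s (t ^ n) p \<in> PB n" using qp by simp
      then have "p \<in> L n" using z qp(2) unfolding L_def lead_def by blast
      then obtain w where w: "w \<in> S" "w - s (t ^ n) p \<in> PB n"
        using lead_S' unfolding lead_def by blast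
      have "z - w = q + - (w - s (t ^ n) p)" using qp by simp
      then have "z - w \<in> PB n"
        using op_closedD(2,3)[OF poly_below_closed] qp(1) w(2) by (simp only:)
      moreover have "z - w \<in> Z"
        using op_closedD(2)[OF Z, of z "- w"] op_closedD(3)[OF Z, of w] w SZ z by auto
      ultimately have "z - w \<in> S" using Suc by blast
      then show "z \<in> S" using op_closedD(2)[OF S _ w(1), of "z - w"] by simp
    qed
  qed
  then have "Z \<subseteq> S" using ZP by blast
  then show "\<exists>B. finite B \<and> B \<subseteq> Z \<and> Z \<subseteq> op_span s (insert t U) B"
    using finB BZ unfolding S_def by blast
qed

end

lemma op_noetherian_adjoin_finite:
  assumes "finite X" "module s" "op_closed s U P" "op_noetherian s U P"
  shows "\<exists>P'. P \<subseteq> P' \<and> op_closed s (U \<union> X) P' \<and> op_noetherian s (U \<union> X) P'"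
  using assms(1)
proof (induct X rule: finite_induct)
  case empty
  then show ?case using assms by auto
next
  case (insert t X)
  then obtain P' where P': "P \<subseteq> P'" "op_closed s (U \<union> X) P'" "op_noetherian s (U \<union> X) P'"
    by blast
  have "P' \<subseteq> poly_below s t P' (Suc 0)"
    using module.scale_one[OF assms(2)] by auto
  then have "P' \<subseteq> (\<Union>n. poly_below s t P' n)" by blast
  then show ?case
    using poly_below_Union_closed[OF assms(2) P'(2), of t] op_noetherian_adjoin[OF assms(2) P'(2,3), of t] P'(1)
    by (intro exI[of _ "\<Union>n. poly_below s t P' n"]) auto
qed

context std_graded
begin

lemma vector_space_iota: "module s \<Longrightarrow> vector_space (\<lambda>c. s (\<iota> c))"
  by (simp add: vector_space_def module_def iota_add iota_mult iota_1)

lemma op_closed_iota_iff: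
  "module s \<Longrightarrow> op_closed s (range \<iota>) Z \<longleftrightarrow> module.subspace (\<lambda>c. s (\<iota> c)) Z"
proof -
  assume s: "module s"
  interpret V: vector_space "\<lambda>c. s (\<iota> c)" by (rule vector_space_iota[OF s])
  show ?thesis
    using V.subspace_neg[of Z] unfolding op_closed_def additive_subgroup_def V.subspace_def by blast
qed

lemma op_noetherian_finite_dimensional:
  assumes s: "module s" and B: "finite B"
  shows "op_noetherian s (range \<iota>) (module.span (\<lambda>c. s (\<iota> c)) B)"
  unfolding op_noetherian_def
proof (intro allI impI, elim conjE)
  interpret V: vector_space "\<lambda>c. s (\<iota> c)" by (rule vector_space_iota[OF s])
  fix Z assume Z: "op_closed s (range \<iota>) Z" "Z \<subseteq> V.span B"
  obtain C where C: "C \<subseteq> Z" "V.independent C" "Z \<subseteq> V.span C"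
    using V.maximal_independent_subset[of Z] by auto
  have "finite C"
    using V.independent_span_bound[OF B C(2)] C(1) Z(2) by blast
  moreover have "V.span C \<subseteq> op_span s (range \<iota>) C"
    using op_span_closed[of s "range \<iota>" C] op_closed_iota_iff[OF s]
    by (intro V.span_minimal op_span_base) simp
  ultimately show "\<exists>C. finite C \<and> C \<subseteq> Z \<and> Z \<subseteq> op_span s (range \<iota>) C"
    using C by blast
qed

text \<open>The \<open>k\<close>-span of finitely many generators of \<open>N\<close> is finite-dimensional, hence noetherian. Adjoining
  finitely many linear forms that span \<open>R\<^sub>1\<close>, one by one, preserves this and yields a module over \<open>R\<close>
  that contains \<open>N\<close>.\<close>

theorem fin_generated_subspace:
  fixes s :: "'r \<Rightarrow> 'm::ab_group_add \<Rightarrow> 'm"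
  assumes s: "module s" and N: "fin_generated s N" and Z: "module.subspace s Z" "Z \<subseteq> N"
  shows "fin_generated s Z"
proof -
  interpret module s by fact
  interpret V: vector_space "\<lambda>c. s (\<iota> c)" by (rule vector_space_iota[OF s])
  interpret W: vector_space "\<lambda>c x. \<iota> c * x" by (rule vector_space_iota[OF module_mult])
  obtain B where B: "finite B" "span B = N" using N by (auto simp: fin_generated_def)
  obtain X where X: "finite X" "A 1 = W.span X"
    using sga unfolding standard_graded_algebra_def by auto
  have "op_closed s (range \<iota>) (V.span B)"
    using op_closed_iota_iff[OF s] by auto
  from op_noetherian_adjoin_finite[OF X(1) s this op_noetherian_finite_dimensional[OF s B(1)]]
  obtain P where P: "V.span B \<subseteq> P" "op_closed s (range \<iota> \<union> X) P" "op_noetherian s (range \<iota> \<union> X) P"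
    by blast
  have "subspace P"
  proof (rule subspaceI_A1[OF s])
    show sub: "additive_subgroup P" using P(2) by (simp add: op_closed_def)
    show iota: "s (\<iota> c) x \<in> P" if "x \<in> P" for c x using P(2) that by (auto simp: op_closed_def)
    fix a x assume "a \<in> A 1" and x: "x \<in> P"
    then have "a \<in> W.span X" using X by simp
    then show "s a x \<in> P"
    proof (induct a rule: W.span_induct_alt)
      case base
      then show ?case using sub by (simp add: additive_subgroup_0)
    next
      case (step c y z)
      have "s y x \<in> P" using P(2) step x by (auto simp: op_closed_def)
      from iota[OF this, of c] have "s (\<iota> c * y) x \<in> P" by simp
      from additive_subgroup_add[OF sub this step(2)] show ?case by (simp add: scale_left_distrib)
    qed
  qed
  then have "N \<subseteq> P"
    using span_minimal[of B P] V.span_superset[of B] P(1) B(2) by blast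
  moreover have "op_closed s (range \<iota> \<union> X) Z"
    using Z(1) subspace_imp_additive_subgroup[OF s Z(1)] by (auto simp: op_closed_def subspace_scale)
  ultimately obtain C where C: "finite C" "C \<subseteq> Z" "Z \<subseteq> op_span s (range \<iota> \<union> X) C"
    using P(3) Z(2) unfolding op_noetherian_def by (meson order_trans)
  have "op_span s (range \<iota> \<union> X) C \<subseteq> span C"
    using subspace_imp_additive_subgroup[OF s subspace_span, of C]
    by (intro op_span_minimal) (auto simp: op_closed_def span_scale span_base)
  then have "span C = Z"
    using C Z(1) by (intro span_subspace) auto
  then show ?thesis using C(1) by (auto simp: fin_generated_def)
qed

section \<open>Existence of minimal graded free resolutions\<close>

lemma homogeneous_generators:
  assumes g: "graded_on s N V" and N: "fin_generated s N"
  shows "\<exists>C. finite C \<and> module.span s C = N \<and> C \<subseteq> (\<Union>j. V j)"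
proof -
  interpret module s by (rule graded_on_module[OF g])
  note D = graded_on_ids[OF g]
  obtain B where B: "finite B" "span B = N" using N by (auto simp: fin_generated_def)
  have BN: "B \<subseteq> N" using B span_superset by auto
  define C where "C = (\<Union>x\<in>B. (\<lambda>j. dcomp V j x) ` {j. dcomp V j x \<noteq> 0})"
  have "finite C" using B(1) BN dcomp_finite[OF D] by (auto simp: C_def)
  moreover have CV: "C \<subseteq> (\<Union>j. V j)" using BN dcomp_mem[OF D] by (auto simp: C_def)
  moreover have "span C = N"
  proof (rule span_subspace)
    show "C \<subseteq> N" using CV ids_component_subset[OF D] by blast
    have "B \<subseteq> span C"
    proof
      fix x assume x: "x \<in> B"
      have "(\<Sum>j | dcomp V j x \<noteq> 0. dcomp V j x) \<in> span C"
        using x by (intro span_sum span_base) (auto simp: C_def)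
      then show "x \<in> span C" using dcomp_sum[OF D, of x] x BN by auto
    qed
    then show "N \<subseteq> span C" using span_minimal[of B "span C"] B(2) by auto
    show "subspace N" using graded_on_subspace[OF g] .
  qed
  ultimately show ?thesis by blast
qed

text \<open>Take homogeneous generators, as few as possible. A relation with a coefficient outside \<open>\<mm>\<close> has a
  homogeneous component with a nonzero scalar coefficient, and that one would express a generator by
  the others.\<close>

lemma minimal_graded_cover:
  assumes g: "graded_on s N V" and N: "fin_generated s N"
  shows "\<exists>b d \<phi>. module_hom free_scale s \<phi> \<and> (\<forall>j. \<phi> ` fcomp b d j \<subseteq> V j) \<and> \<phi> ` fcar b = N \<and>
    (\<forall>f\<in>fcar b. \<phi> f = 0 \<longrightarrow> (\<forall>i<b. lookup f i \<in> irrelevant_ideal A))"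
proof -
  interpret module s by (rule graded_on_module[OF g])
  note D = graded_on_ids[OF g]
  let ?gen = "\<lambda>C. finite C \<and> span C = N \<and> C \<subseteq> (\<Union>j. V j)"
  obtain C0 where "?gen C0" using homogeneous_generators[OF g N] by metis
  from ex_has_least_nat[of ?gen, OF this, of card]
  obtain C where C: "?gen C" and least: "\<And>C'. ?gen C' \<Longrightarrow> card C \<le> card C'"
    by (elim exE conjE) metis
  define b where "b = card C"
  obtain z where z: "bij_betw z {..<b} C"
    using C ex_bij_betw_nat_finite[of C] unfolding b_def by (auto simp: atLeast0LessThan)
  have "\<forall>i<b. \<exists>j. z i \<in> V j" using z C by (auto simp: bij_betw_def)
  then obtain d where d: "\<And>i. i < b \<Longrightarrow> z i \<in> V (d i)" by metis
  define \<phi> where "\<phi> f = (\<Sum>i<b. s (lookup f i) (z i))" for f :: "nat \<Rightarrow>\<^sub>0 'r"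
  have hom: "module_hom free_scale s \<phi>"
    unfolding module_hom_def module_hom_axioms_def
    by (auto simp: module_free_scale module_axioms \<phi>_def lookup_add scale_left_distrib sum.distrib scale_sum_right)
  have sub: "additive_subgroup (V j)" for j using ids_subgroup[OF D] .
  have IA_V: "s a x \<in> V j" if "a \<in> IA (j - i)" "x \<in> V i" for a x i j
  proof (cases "j - i < 0")
    case True
    then show ?thesis using that sub by (auto simp: IA_neg additive_subgroup_0)
  next
    case False
    then show ?thesis using that graded_on_scale[OF g, of a "nat (j - i)" x i] by (simp add: int_component_def)
  qed
  have graded: "\<phi> ` fcomp b d j \<subseteq> V j" for j
    using IA_V d by (auto simp: \<phi>_def fcomp_def intro!: additive_subgroup_sum[OF sub])
  have surj: "\<phi> ` fcar b = N"
  proof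
    have zN: "z i \<in> N" if "i < b" for i
      using d[OF that] by (rule ids_component_subset[OF D])
    show "\<phi> ` fcar b \<subseteq> N"
      using zN graded_on_subspace[OF g] by (auto simp: \<phi>_def intro!: subspace_sum subspace_scale)
    show "N \<subseteq> \<phi> ` fcar b"
    proof
      fix x assume "x \<in> N"
      then have "x \<in> range (\<lambda>u. \<Sum>v\<in>C. s (u v) v)" using C span_finite[of C] by auto
      then obtain u where "x = (\<Sum>v\<in>C. s (u v) v)" by blast
      also have "\<dots> = (\<Sum>i<b. s (u (z i)) (z i))"
        using z by (rule sum.reindex_bij_betw[symmetric])
      also have "\<dots> = \<phi> (tup b (\<lambda>i. u (z i)))" by (simp add: \<phi>_def)
      finally show "x \<in> \<phi> ` fcar b" by auto
    qed
  qed
  have "lookup f i \<in> irrelevant_ideal A" if f: "f \<in> fcar b" "\<phi> f = 0" and i: "i < b" for f i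
  proof (rule ccontr)
    assume "lookup f i \<notin> irrelevant_ideal A"
    then have "dcomp IA 0 (lookup f i) \<noteq> 0" by (simp add: irrelevant_ideal_iff)
    moreover obtain c where "dcomp IA 0 (lookup f i) = \<iota> c"
      using dcomp_mem[OF ids_IA, of "lookup f i" 0] by (auto simp: A_0)
    ultimately have c: "dcomp IA 0 (lookup f i) = \<iota> c" "c \<noteq> 0"
      by (auto simp: iota_eq_0)
    \<comment> \<open>the component of the relation in which the \<open>i\<close>-th coefficient is a scalar\<close>
    define h where "h = dcomp (fcomp b d) (d i) f"
    have h: "h \<in> fcomp b d (d i)"
      unfolding h_def by (rule dcomp_mem[OF ids_fcomp f(1)])
    have "dcomp V (id (d i)) (\<phi> f) = \<phi> h"
      unfolding h_def
      by (rule dcomp_additive[OF ids_fcomp D module_hom_imp_additive[OF hom] _ bij_id f(1)])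
        (use graded in auto)
    then have h0: "\<phi> h = 0" using f(2) dcomp_0[OF D] by simp
    have hi: "lookup h i = \<iota> c"
    proof -
      have "dcomp (\<lambda>j. IA (j - d i)) (id (d i)) (lookup f i) = lookup h i"
        unfolding h_def
        by (rule dcomp_additive[OF ids_fcomp ids_shifted additive_lookup _ bij_id f(1)])
          (use i in \<open>auto simp: fcomp_def\<close>)
      moreover have "dcomp (\<lambda>j. IA (j - d i)) (0 + d i) (id (lookup f i)) = id (dcomp IA 0 (lookup f i))"
        by (rule dcomp_additive[OF ids_IA ids_shifted]) (auto simp: additive_def intro!: o_bij[where g = "\<lambda>j. j - d i"])
      ultimately show ?thesis using c(1) by simp
    qed
    have "0 = s (lookup h i) (z i) + (\<Sum>l\<in>{..<b} - {i}. s (lookup h l) (z l))"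
      using h0 i unfolding \<phi>_def by (simp add: sum.remove)
    then have eq: "s (\<iota> c) (z i) = - (\<Sum>l\<in>{..<b} - {i}. s (lookup h l) (z l))"
      unfolding hi by (simp add: eq_neg_iff_add_eq_0)
    have others: "z l \<in> C - {z i}" if "l < b" "l \<noteq> i" for l
      using that i z by (auto simp: bij_betw_def inj_on_def)
    have "s (\<iota> c) (z i) \<in> span (C - {z i})"
      unfolding eq using others by (intro span_neg span_sum span_scale span_base) auto
    then have "s (\<iota> (inverse c)) (s (\<iota> c) (z i)) \<in> span (C - {z i})" by (rule span_scale)
    then have "z i \<in> span (C - {z i})" using c(2) by (simp add: iota_1 flip: iota_mult)
    moreover have zi: "z i \<in> C" using z i by (auto simp: bij_betw_def)
    ultimately have "C \<subseteq> span (C - {z i})"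
      by (metis insert_Diff insert_subset span_superset)
    then have "span (C - {z i}) = N"
      using C by (metis Diff_subset span_minimal span_mono subset_antisym subspace_span)
    then have "card C \<le> card (C - {z i})" using C by (intro least) auto
    then show False using zi C by (meson card_Diff1_less leD)
  qed
  then show ?thesis using hom graded surj by blast
qed

lemma graded_on_kernel:
  assumes hom: "module_hom free_scale s \<phi>" and D: "internal_direct_sum N V"
    and graded: "\<And>j. \<phi> ` fcomp b d j \<subseteq> V j"
  defines "Z \<equiv> {f \<in> fcar b. \<phi> f = 0}"
  shows "graded_on free_scale Z (\<lambda>j. Z \<inter> fcomp b d j)"
proof -
  interpret module_hom free_scale s \<phi> by fact
  have sub: "module.subspace free_scale Z"
    using subspace_fcar[of b] unfolding module.subspace_def[OF module_free_scale] Z_def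
    by (auto simp: zero add scale module.scale_zero_right[OF m2.module_axioms])
  have ids: "internal_direct_sum Z (\<lambda>j. Z \<inter> fcomp b d j)"
  proof (rule ids_subI[OF ids_fcomp subspace_imp_additive_subgroup[OF module_free_scale sub]])
    show "Z \<subseteq> fcar b" by (auto simp: Z_def)
    fix f j assume f: "f \<in> Z"
    then have fb: "f \<in> fcar b" by (simp add: Z_def)
    have "dcomp V (id j) (\<phi> f) = \<phi> (dcomp (fcomp b d) j f)"
      by (rule dcomp_additive[OF ids_fcomp D module_hom_imp_additive[OF hom] _ bij_id fb])
        (use graded in auto)
    then have "\<phi> (dcomp (fcomp b d) j f) = 0" using f dcomp_0[OF D] by (simp add: Z_def)
    then show "dcomp (fcomp b d) j f \<in> Z"
      using dcomp_mem[OF ids_fcomp fb] by (auto simp: Z_def fcomp_def)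
  qed
  show ?thesis
    unfolding graded_on_def
    using sub ids graded_on_scale[OF graded_on_fcar, of _ _ _ b d] module_free_scale
      module.subspace_scale[OF module_free_scale sub] by auto
qed

lemma fin_generated_fcar: "fin_generated free_scale (fcar b :: (nat \<Rightarrow>\<^sub>0 'r) set)"
  unfolding fin_generated_def
proof (intro exI conjI)
  interpret module "free_scale :: 'r \<Rightarrow> _" by (rule module_free_scale)
  let ?B = "bvec ` {..<b} :: (nat \<Rightarrow>\<^sub>0 'r) set"
  show "finite ?B" by simp
  show "span ?B = fcar b"
  proof (rule span_subspace[OF _ _ subspace_fcar])
    show "?B \<subseteq> fcar b" by (auto simp: fcar_iff lookup_single when_def)
    show "fcar b \<subseteq> span ?B"
    proof
      fix f :: "nat \<Rightarrow>\<^sub>0 'r" assume "f \<in> fcar b"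
      then show "f \<in> span ?B"
        by (subst free_expansion[of f b]) (auto intro!: span_sum span_scale intro: span_base)
    qed
  qed
qed

lemma free_carrier_eq: "free_carrier F n = fcar (rk F n)"
  by (simp add: free_carrier_def fcar_def)

lemma free_component_eq: "free_component A F n j = fcomp (rk F n) (shft F n) j"
  by (simp add: free_component_def fcomp_def free_carrier_eq)

lemma minimal_step:
  assumes Z: "graded_on free_scale Z (\<lambda>j. Z \<inter> fcomp b d j)" "Z \<subseteq> fcar b"
  shows "\<exists>b' d' \<phi>. module_hom free_scale free_scale \<phi> \<and> (\<forall>j. \<phi> ` fcomp b' d' j \<subseteq> fcomp b d j) \<and>
    \<phi> ` fcar b' = Z \<and> (\<forall>f\<in>fcar b'. \<phi> f = 0 \<longrightarrow> (\<forall>i<b'. lookup f i \<in> irrelevant_ideal A)) \<and>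
    graded_on free_scale {f \<in> fcar b'. \<phi> f = 0} (\<lambda>j. {f \<in> fcar b'. \<phi> f = 0} \<inter> fcomp b' d' j)"
proof -
  have "fin_generated free_scale Z"
    by (rule fin_generated_subspace[OF module_free_scale fin_generated_fcar graded_on_subspace[OF Z(1)] Z(2)])
  from minimal_graded_cover[OF Z(1) this] obtain b' d' \<phi> where
    *: "module_hom free_scale free_scale \<phi>" "\<And>j. \<phi> ` fcomp b' d' j \<subseteq> Z \<inter> fcomp b d j" "\<phi> ` fcar b' = Z"
    "\<forall>f\<in>fcar b'. \<phi> f = 0 \<longrightarrow> (\<forall>i<b'. lookup f i \<in> irrelevant_ideal A)"
    by blast
  from graded_on_kernel[OF *(1) graded_on_ids[OF Z(1)] *(2)] * show ?thesis
    by blast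
qed

theorem minimal_resolution_exists:
  fixes s :: "'r \<Rightarrow> 'm::ab_group_add \<Rightarrow> 'm"
  assumes g: "graded_on s N V" and N: "fin_generated s N"
  shows "\<exists>F. minimal_graded_free_resolution A s N V F"
proof -
  obtain b0 d0 \<epsilon> where \<epsilon>: "module_hom free_scale s \<epsilon>" "\<And>j. \<epsilon> ` fcomp b0 d0 j \<subseteq> V j" "\<epsilon> ` fcar b0 = N"
    "\<forall>f\<in>fcar b0. \<epsilon> f = 0 \<longrightarrow> (\<forall>i<b0. lookup f i \<in> irrelevant_ideal A)"
    using minimal_graded_cover[OF g N] by blast
  define start where "start = (b0, d0, (\<lambda>_. 0) :: (nat \<Rightarrow>\<^sub>0 'r) \<Rightarrow> (nat \<Rightarrow>\<^sub>0 'r), {f \<in> fcar b0. \<epsilon> f = 0})"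
  \<comment> \<open>a stage consists of a rank, the degrees of the basis, a differential, and the cycles to be resolved\<close>
  define good :: "nat \<Rightarrow> nat \<times> (nat \<Rightarrow> int) \<times> ((nat \<Rightarrow>\<^sub>0 'r) \<Rightarrow> (nat \<Rightarrow>\<^sub>0 'r)) \<times> (nat \<Rightarrow>\<^sub>0 'r) set \<Rightarrow> bool"
    where "good n st = (case st of (b, d, \<phi>, Z) \<Rightarrow> (n = 0 \<longrightarrow> st = start) \<and>
      graded_on free_scale Z (\<lambda>j. Z \<inter> fcomp b d j) \<and> Z \<subseteq> fcar b \<and>
      (\<forall>f\<in>Z. \<forall>i<b. lookup f i \<in> irrelevant_ideal A))" for n st
  define succ :: "nat \<times> (nat \<Rightarrow> int) \<times> ((nat \<Rightarrow>\<^sub>0 'r) \<Rightarrow> (nat \<Rightarrow>\<^sub>0 'r)) \<times> (nat \<Rightarrow>\<^sub>0 'r) set \<Rightarrow>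
      nat \<times> (nat \<Rightarrow> int) \<times> ((nat \<Rightarrow>\<^sub>0 'r) \<Rightarrow> (nat \<Rightarrow>\<^sub>0 'r)) \<times> (nat \<Rightarrow>\<^sub>0 'r) set \<Rightarrow> bool"
    where "succ st st' = (case st of (b, d, \<phi>, Z) \<Rightarrow> case st' of (b', d', \<phi>', Z') \<Rightarrow>
      module_hom free_scale free_scale \<phi>' \<and> (\<forall>j. \<phi>' ` fcomp b' d' j \<subseteq> fcomp b d j) \<and>
      \<phi>' ` fcar b' = Z \<and> Z' = {f \<in> fcar b'. \<phi>' f = 0})" for st st'
  have "\<exists>f. \<forall>n. good n (f n) \<and> succ (f n) (f (Suc n))"
  proof (rule dependent_nat_choice)
    show "\<exists>st. good 0 st"
      using graded_on_kernel[OF \<epsilon>(1) graded_on_ids[OF g] \<epsilon>(2)] \<epsilon>(4)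
      by (intro exI[of _ start]) (auto simp: good_def start_def)
    fix st n assume "good n st"
    moreover obtain b d \<phi> Z where st: "st = (b, d, \<phi>, Z)" by (cases st)
    ultimately have Z: "graded_on free_scale Z (\<lambda>j. Z \<inter> fcomp b d j)" "Z \<subseteq> fcar b"
      by (auto simp: good_def)
    from minimal_step[OF Z] obtain b' d' \<phi>' where
      "module_hom free_scale free_scale \<phi>'" "\<forall>j. \<phi>' ` fcomp b' d' j \<subseteq> fcomp b d j"
      "\<phi>' ` fcar b' = Z" "\<forall>f\<in>fcar b'. \<phi>' f = 0 \<longrightarrow> (\<forall>i<b'. lookup f i \<in> irrelevant_ideal A)"
      "graded_on free_scale {f \<in> fcar b'. \<phi>' f = 0} (\<lambda>j. {f \<in> fcar b'. \<phi>' f = 0} \<inter> fcomp b' d' j)"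
      by blast
    then show "\<exists>st'. good (Suc n) st' \<and> succ st st'"
      by (intro exI[of _ "(b', d', \<phi>', {f \<in> fcar b'. \<phi>' f = 0})"]) (auto simp: good_def succ_def st)
  qed
  then obtain S where S: "\<And>n. good n (S n)" "\<And>n. succ (S n) (S (Suc n))" by blast
  define b where "b n = fst (S n)" for n
  define d where "d n = fst (snd (S n))" for n
  define \<phi> where "\<phi> n = fst (snd (snd (S n)))" for n
  define Z where "Z n = snd (snd (snd (S n)))" for n
  have S_eq: "S n = (b n, d n, \<phi> n, Z n)" for n by (simp add: b_def d_def \<phi>_def Z_def)
  have "S 0 = start" using S(1)[of 0] unfolding good_def S_eq[of 0] by simp
  then have S0: "b 0 = b0" "d 0 = d0" "\<phi> 0 = (\<lambda>_. 0)" "Z 0 = {f \<in> fcar b0. \<epsilon> f = 0}"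
    by (auto simp: S_eq start_def)
  have Zirr: "\<forall>f\<in>Z n. f \<in> fcar (b n) \<and> (\<forall>i<b n. lookup f i \<in> irrelevant_ideal A)" for n
    using S(1)[of n] by (auto simp: good_def S_eq)
  have step: "module_hom free_scale free_scale (\<phi> (Suc n))"
    "\<phi> (Suc n) ` fcomp (b (Suc n)) (d (Suc n)) j \<subseteq> fcomp (b n) (d n) j"
    "\<phi> (Suc n) ` fcar (b (Suc n)) = Z n" "Z (Suc n) = {f \<in> fcar (b (Suc n)). \<phi> (Suc n) f = 0}" for n j
    using S(2)[of n] by (auto simp: succ_def S_eq)
  define F :: "('r, 'm) free_res" where "F = \<lparr>rk = b, shft = d, dif = \<phi>, aug = \<epsilon>\<rparr>"
  have F: "rk F = b" "shft F = d" "dif F = \<phi>" "aug F = \<epsilon>" by (simp_all add: F_def)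
  have hom: "module_hom free_scale free_scale (\<phi> n)" for n
  proof (cases n)
    case 0
    have "module_hom free_scale free_scale (\<lambda>_. 0 :: nat \<Rightarrow>\<^sub>0 'r)"
      by (simp add: module_hom_def module_hom_axioms_def module_free_scale
          module.scale_zero_right[OF module_free_scale])
    then show ?thesis by (simp add: 0 S0)
  qed (simp add: step)
  have "graded_free_resolution A s N V F"
    unfolding graded_free_resolution_def free_carrier_eq free_component_eq F
  proof (intro conjI allI impI)
    show "\<phi> n ` fcomp (b n) (d n) j \<subseteq> fcomp (b (n - 1)) (d (n - 1)) j" for n j
    proof (cases n)
      case 0
      show ?thesis using additive_subgroup_0[OF fcomp_subgroup]
        by (auto simp: 0 S0)
    next
      case (Suc m)
      then show ?thesis using step(2)[of m j] by simp
    qed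
    show "{x \<in> fcar (b 0). \<epsilon> x = 0} = \<phi> 1 ` fcar (b 1)"
      using step(3)[of 0] by (simp add: S0 One_nat_def)
    show "{x \<in> fcar (b n). \<phi> n x = 0} = \<phi> (n + 1) ` fcar (b (n + 1))" if n: "1 \<le> n" for n
    proof -
      obtain m where "n = Suc m" using n by (cases n) auto
      then show ?thesis using step(3)[of n] step(4)[of m] by (simp add: One_nat_def)
    qed
  qed (use \<epsilon> hom S0 in auto)
  moreover have "\<phi> n ` fcar (b n) \<subseteq> ideal_times free_scale (irrelevant_ideal A) (fcar (b (n - 1)))"
    if n: "n \<ge> 1" for n
  proof -
    obtain m where m: "n = Suc m" using n by (cases n) auto
    have "Z m \<subseteq> ideal_times free_scale (irrelevant_ideal A) (fcar (b m))"
      unfolding ideal_times_irrelevant[OF module_free_scale subspace_fcar]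
      using Zirr[of m] lmul_power_coordinates[of 1 "A 1" "b m"] by (auto simp: irrelevant_ideal_eq One_nat_def)
    then show ?thesis using step(3)[of m] m by simp
  qed
  ultimately show ?thesis
    unfolding minimal_graded_free_resolution_def free_carrier_eq F[symmetric] by blast
qed

end

section \<open>Tensoring with a linear resolution of the residue field\<close>

text \<open>The differential of \<open>K \<otimes> N\<close> from \<open>N\<^bsup>b n\<^esup>\<close> to \<open>N\<^bsup>b (n-1)\<^esup>\<close>, where \<open>a n l i\<close> is the coefficient
  of the \<open>i\<close>-th basis element of \<open>K\<^bsub>n-1\<^esub>\<close> in the image of the \<open>l\<close>-th one of \<open>K\<^sub>n\<close>. Tuples are
  functions whose values beyond the range do not matter.\<close>

definition kdif :: "('r \<Rightarrow> 'm::ab_group_add \<Rightarrow> 'm) \<Rightarrow> (nat \<Rightarrow> nat) \<Rightarrow> (nat \<Rightarrow> nat \<Rightarrow> nat \<Rightarrow> 'r) \<Rightarrow>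
    nat \<Rightarrow> (nat \<Rightarrow> 'm) \<Rightarrow> nat \<Rightarrow> 'm" where
  "kdif s b a n x i = (\<Sum>l<b n. s (a n l i) (x l))"

text \<open>The condition that every cycle in \<open>P\<^bsup>b n\<^esup>\<close> bounds a tuple in \<open>Q\<^bsup>b (n+1)\<^esup>\<close>. For \<open>n = 0\<close> all
  tuples count as cycles once \<open>a 0 = 0\<close>, as truncated subtraction demands.\<close>

definition kexact :: "('r \<Rightarrow> 'm::ab_group_add \<Rightarrow> 'm) \<Rightarrow> (nat \<Rightarrow> nat) \<Rightarrow> (nat \<Rightarrow> nat \<Rightarrow> nat \<Rightarrow> 'r) \<Rightarrow>
    nat \<Rightarrow> 'm set \<Rightarrow> 'm set \<Rightarrow> bool" where
  "kexact s b a n P Q \<longleftrightarrow>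
     (\<forall>x. (\<forall>l<b n. x l \<in> P) \<and> (\<forall>i<b (n - 1). kdif s b a n x i = 0) \<longrightarrow>
       (\<exists>y. (\<forall>l<b (Suc n). y l \<in> Q) \<and> (\<forall>i<b n. kdif s b a (Suc n) y i = x i)))"

lemma choice_less: "(\<And>i. i < n \<Longrightarrow> \<exists>y. P i y) \<Longrightarrow> \<exists>f. \<forall>i<n::nat. P i (f i)"
  by metis

lemma kexactD:
  assumes "kexact s b a n P Q" "\<And>l. l < b n \<Longrightarrow> x l \<in> P" "\<And>i. i < b (n - 1) \<Longrightarrow> kdif s b a n x i = 0"
  obtains y where "\<And>l. l < b (Suc n) \<Longrightarrow> y l \<in> Q" "\<And>i. i < b n \<Longrightarrow> kdif s b a (Suc n) y i = x i"
  using assms unfolding kexact_def by blast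

lemma kexact_ex:
  assumes "kexact s b a n P Q" "\<And>l. l < b n \<Longrightarrow> x l \<in> P" "\<And>i. i < b (n - 1) \<Longrightarrow> kdif s b a n x i = 0"
  shows "\<exists>y. (\<forall>l<b (Suc n). y l \<in> Q) \<and> (\<forall>i<b n. kdif s b a (Suc n) y i = x i)"
  using assms unfolding kexact_def by blast

lemma kdif_cong: "(\<And>l. l < b n \<Longrightarrow> x l = y l) \<Longrightarrow> kdif s b a n x i = kdif s b a n y i"
  by (simp add: kdif_def)

lemma kdif_hom:
  assumes "additive \<phi>" "\<And>c x. \<phi> (s c x) = t c (\<phi> x)"
  shows "\<phi> (kdif s b a n x i) = kdif t b a n (\<lambda>l. \<phi> (x l)) i"
  unfolding kdif_def by (simp add: additive.sum[OF assms(1)] assms(2))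

lemma kdif_diff:
  assumes "module s"
  shows "kdif s b a n (\<lambda>l. x l - y l) i = kdif s b a n x i - kdif s b a n y i"
  unfolding kdif_def by (simp add: module.scale_right_diff_distrib[OF assms] sum_subtractf)

lemma kdif_sum:
  assumes "module s"
  shows "kdif s b a n (\<lambda>l. \<Sum>j\<in>J. x j l) i = (\<Sum>j\<in>J. kdif s b a n (x j) i)"
  unfolding kdif_def by (simp add: module.scale_sum_right[OF assms] sum.swap[of _ J])

lemma kexact_zero:
  assumes s: "module s" and Q: "0 \<in> Q"
  shows "kexact s b a n {0} Q"
  unfolding kexact_def
proof (intro allI impI)
  fix x assume "(\<forall>l<b n. x l \<in> {0}) \<and> (\<forall>i<b (n - 1). kdif s b a n x i = 0)"
  then show "\<exists>y. (\<forall>l<b (Suc n). y l \<in> Q) \<and> (\<forall>i<b n. kdif s b a (Suc n) y i = x i)"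
    by (intro exI[of _ "\<lambda>_. 0"]) (simp add: Q kdif_def module.scale_zero_right[OF s])
qed

text \<open>A linear free resolution of \<open>k\<close>, or of a nonzero power of \<open>k\<close>, without its augmentation: the last
  assumption says that the image of \<open>K\<^sub>1\<close> in \<open>K\<^sub>0\<close> contains \<open>\<mm>K\<^sub>0\<close>.\<close>

locale linear_resolution = std_graded \<iota> A
  for \<iota> :: "'k::field \<Rightarrow> 'r::comm_ring_1" and A :: "nat \<Rightarrow> 'r set" +
  fixes b :: "nat \<Rightarrow> nat" and a :: "nat \<Rightarrow> nat \<Rightarrow> nat \<Rightarrow> 'r"
  assumes entries_linear: "n \<ge> 1 \<Longrightarrow> l < b n \<Longrightarrow> i < b (n - 1) \<Longrightarrow> a n l i \<in> A 1"
    and entries_0: "a 0 l i = 0"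
    and entries_complex: "n \<ge> 1 \<Longrightarrow> l < b (Suc n) \<Longrightarrow> i < b (n - 1) \<Longrightarrow>
      (\<Sum>j<b n. a (Suc n) l j * a n j i) = 0"
    and ring_exact: "n \<ge> 1 \<Longrightarrow> kexact (*) b a n UNIV UNIV"
    and rank_0: "b 0 > 0"
    and image_0: "c \<in> A 1 \<Longrightarrow> i < b 0 \<Longrightarrow>
      \<exists>u. (\<forall>l<b 1. u l \<in> A 0) \<and> (\<forall>j<b 0. kdif (*) b a 1 u j = (if j = i then c else 0))"
begin

abbreviation "kd s \<equiv> kdif s b a"
abbreviation "kx s \<equiv> kexact s b a"
abbreviation "kxF \<equiv> kx (free_scale :: 'r \<Rightarrow> _)"

lemma kd_0: "module s \<Longrightarrow> kd s 0 x i = 0"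
  by (simp add: kdif_def entries_0 module.scale_zero_left)

lemma kd_kd:
  assumes s: "module s" and i: "i < b (n - 1)"
  shows "kd s n (\<lambda>j. kd s (Suc n) y j) i = 0"
proof (cases "n = 0")
  case False
  interpret module s by fact
  have "kd s n (\<lambda>j. kd s (Suc n) y j) i = (\<Sum>j<b n. \<Sum>l<b (Suc n). s (a (Suc n) l j * a n j i) (y l))"
    by (simp add: kdif_def scale_sum_right mult.commute)
  also have "\<dots> = (\<Sum>l<b (Suc n). s (\<Sum>j<b n. a (Suc n) l j * a n j i) (y l))"
    by (simp add: scale_sum_left sum.swap[of _ "{..<b n}"])
  also have "\<dots> = 0"
    using entries_complex[of n _ i] i False by (simp add: Suc_leI One_nat_def)
  finally show ?thesis .
qed (simp add: kd_0[OF s])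

lemma kd_lmul:
  assumes s: "module s" and x: "\<And>l. l < b n \<Longrightarrow> x l \<in> Q" and i: "i < b (n - 1)"
  shows "kd s n x i \<in> lm s Q"
proof (cases "n = 0")
  case True
  then show ?thesis using kd_0[OF s] lmul.zero by simp
next
  case False
  then show ?thesis
    unfolding kdif_def using entries_linear[of n _ i] x i
    by (intro lmul_sum lmul_base) (auto simp: One_nat_def)
qed

text \<open>The image of \<open>K\<^sub>1\<close> in \<open>K\<^sub>0\<close> is \<open>\<mm>K\<^sub>0\<close>, so that the boundaries in homological degree \<open>0\<close> are the
  tuples with entries in \<open>R\<^sub>1Q\<close>.\<close>

lemma kx_0_lmul:
  assumes s: "module s" and Q: "additive_subgroup Q" "\<And>c x. x \<in> Q \<Longrightarrow> s (\<iota> c) x \<in> Q"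
  shows "kx s 0 (lm s Q) Q"
proof -
  interpret module s by fact
  have single: "\<exists>y. (\<forall>l<b 1. y l \<in> Q) \<and> (\<forall>j<b 0. kd s 1 y j = (if j = i then w else 0))"
    if w: "w \<in> lm s Q" and i: "i < b 0" for w i
    using w
  proof (induct w rule: lmul.induct)
    case zero
    then show ?case
      by (intro exI[of _ "\<lambda>_. 0"]) (simp add: additive_subgroup_0[OF Q(1)] kdif_def)
  next
    case (step c q w)
    then obtain y where y: "\<forall>l<b 1. y l \<in> Q" "\<forall>j<b 0. kd s 1 y j = (if j = i then w else 0)"
      by blast
    obtain u where u: "\<forall>l<b 1. u l \<in> A 0" "\<forall>j<b 0. kd (*) 1 u j = (if j = i then c else 0)"
      using image_0[OF step(1) i] by blast
    have "s (u l) q + y l \<in> Q" if "l < b 1" for l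
      using that u(1) y(1) step(2) Q by (auto simp: A_0 intro!: additive_subgroup_add)
    moreover have "kd s 1 (\<lambda>l. s (u l) q + y l) j = (if j = i then s c q + w else 0)" if j: "j < b 0" for j
    proof -
      have "kd s 1 (\<lambda>l. s (u l) q + y l) j = s (kd (*) 1 u j) q + kd s 1 y j"
        by (simp add: kdif_def scale_right_distrib sum.distrib scale_sum_left)
      then show ?thesis using u(2) y(2) j by auto
    qed
    ultimately show ?case by (intro exI[of _ "\<lambda>l. s (u l) q + y l"]) simp
  qed
  show ?thesis
    unfolding kexact_def
  proof (intro allI impI, elim conjE)
    fix x assume x: "\<forall>l<b 0. x l \<in> lm s Q"
    have "\<exists>y. (\<forall>l<b 1. y l \<in> Q) \<and> (\<forall>j<b 0. kd s 1 y j = (if j = i then x i else 0))" if "i < b 0" for i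
      using single x that by blast
    from choice_less[OF this] obtain y where
      y: "\<forall>i<b 0. (\<forall>l<b 1. y i l \<in> Q) \<and> (\<forall>j<b 0. kd s 1 (y i) j = (if j = i then x i else 0))"
      by (rule exE)
    have "\<forall>l<b 1. (\<Sum>i<b 0. y i l) \<in> Q"
      using y by (auto intro!: additive_subgroup_sum[OF Q(1)])
    moreover have "kd s 1 (\<lambda>l. \<Sum>i<b 0. y i l) j = x j" if j: "j < b 0" for j
    proof -
      have "kd s 1 (\<lambda>l. \<Sum>i<b 0. y i l) j = (\<Sum>i<b 0. if j = i then x i else 0)"
        unfolding kdif_sum[OF s] using y j by (intro sum.cong) auto
      then show ?thesis using j by simp
    qed
    ultimately show "\<exists>y. (\<forall>l<b (Suc 0). y l \<in> Q) \<and> (\<forall>i<b 0. kd s (Suc 0) y i = x i)"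
      unfolding One_nat_def by (intro exI[of _ "\<lambda>l. \<Sum>i<b 0. y i l"]) simp
  qed
qed

lemma kexact_mono:
  assumes k: "kx s n P Q" "P' \<subseteq> P" "Q \<subseteq> Q'"
  shows "kx s n P' Q'"
  unfolding kexact_def
proof (intro allI impI, elim conjE)
  fix x assume x: "\<forall>l<b n. x l \<in> P'" "\<forall>i<b (n - 1). kd s n x i = 0"
  obtain y where "\<And>l. l < b (Suc n) \<Longrightarrow> y l \<in> Q" "\<And>i. i < b n \<Longrightarrow> kd s (Suc n) y i = x i"
    by (rule kexactD[OF k(1), of x]) (use x k(2) in auto)
  then show "\<exists>y. (\<forall>l<b (Suc n). y l \<in> Q') \<and> (\<forall>i<b n. kd s (Suc n) y i = x i)"
    using k(3) by (intro exI[of _ y]) auto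
qed

lemma kx_0_iff:
  assumes s: "module s" and P: "0 \<in> P" and Q: "additive_subgroup Q" "\<And>c x. x \<in> Q \<Longrightarrow> s (\<iota> c) x \<in> Q"
  shows "kx s 0 P Q \<longleftrightarrow> P \<subseteq> lm s Q"
proof
  assume k: "kx s 0 P Q"
  show "P \<subseteq> lm s Q"
  proof
    fix w assume w: "w \<in> P"
    obtain y where y: "\<And>l. l < b (Suc 0) \<Longrightarrow> y l \<in> Q"
      "\<And>i. i < b 0 \<Longrightarrow> kd s (Suc 0) y i = (if i = 0 then w else 0)"
      by (rule kexactD[OF k, of "\<lambda>i. if i = 0 then w else 0"]) (use w P kd_0[OF s] in auto)
    have "kd s (Suc 0) y 0 \<in> lm s Q"
      by (rule kd_lmul[OF s]) (use y rank_0 in auto)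
    then show "w \<in> lm s Q" using y(2)[of 0] rank_0 by simp
  qed
next
  assume "P \<subseteq> lm s Q"
  then show "kx s 0 P Q" using kx_0_lmul[OF s Q] by (rule_tac kexact_mono) auto
qed

lemma dcomp_kd:
  assumes g: "graded_on s X V" and x: "\<And>l. l < b n \<Longrightarrow> x l \<in> X" and i: "i < b (n - 1)"
  shows "dcomp V r (kd s n x i) = kd s n (\<lambda>l. dcomp V (r - 1) (x l)) i"
proof (cases "n = 0")
  case True
  then show ?thesis using kd_0[OF graded_on_module[OF g]] dcomp_0[OF graded_on_ids[OF g]] by simp
next
  case False
  interpret module s by (rule graded_on_module[OF g])
  have "dcomp V r (s (a n l i) (x l)) = s (a n l i) (dcomp V (r - 1) (x l))" if "l < b n" for l
    using that False i x by (intro dcomp_scale1[OF g] entries_linear) (auto simp: One_nat_def)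
  moreover have "dcomp V r (kd s n x i) = (\<Sum>l<b n. dcomp V r (s (a n l i) (x l)))"
    unfolding kdif_def using x graded_on_subspace[OF g]
    by (intro dcomp_of_sum[OF graded_on_ids[OF g]]) (auto intro: subspace_scale)
  ultimately show ?thesis by (simp add: kdif_def)
qed

text \<open>The differential has degree one, so that exactness may be tested on homogeneous cycles.\<close>

lemma kx_hsub:
  assumes g: "graded_on s X V"
    and W: "\<And>r. additive_subgroup (W r)" "\<And>r. W r \<subseteq> V r"
    and W': "\<And>r. additive_subgroup (W' r)" "\<And>r. W' r \<subseteq> V r"
  shows "kx s n (hsub X V W) (hsub X V W') \<longleftrightarrow> (\<forall>r. kx s n (W r) (W' (r - 1)))"
proof
  note D = graded_on_ids[OF g]
  note s = graded_on_module[OF g]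
  have sub: "W r \<subseteq> hsub X V W" "W' r \<subseteq> hsub X V W'" for r
    using hsub_homogeneous[OF D W, of r] hsub_homogeneous[OF D W', of r] by auto
  {
    assume k: "kx s n (hsub X V W) (hsub X V W')"
    show "\<forall>r. kx s n (W r) (W' (r - 1))"
      unfolding kexact_def
    proof (intro allI impI, elim conjE)
      fix r x assume x: "\<forall>l<b n. x l \<in> W r" "\<forall>i<b (n - 1). kd s n x i = 0"
      obtain y where y: "\<And>l. l < b (Suc n) \<Longrightarrow> y l \<in> hsub X V W'" "\<And>i. i < b n \<Longrightarrow> kd s (Suc n) y i = x i"
        by (rule kexactD[OF k, of x]) (use x sub(1)[of r] in blast)+
      have "kd s (Suc n) (\<lambda>l. dcomp V (r - 1) (y l)) i = x i" if i: "i < b n" for i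
      proof -
        have "x i \<in> V r" using x(1) i W(2) by blast
        then have "x i = dcomp V r (x i)" by (simp add: dcomp_homogeneous[OF D])
        also have "\<dots> = dcomp V r (kd s (Suc n) y i)" using y(2) i by simp
        also have "\<dots> = kd s (Suc n) (\<lambda>l. dcomp V (r - 1) (y l)) i"
          by (rule dcomp_kd[OF g]) (use y(1) i in \<open>auto simp: hsub_def\<close>)
        finally show ?thesis by simp
      qed
      moreover have "dcomp V (r - 1) (y l) \<in> W' (r - 1)" if "l < b (Suc n)" for l
        using y(1)[OF that] by (auto simp: hsub_def)
      ultimately show "\<exists>y. (\<forall>l<b (Suc n). y l \<in> W' (r - 1)) \<and> (\<forall>i<b n. kd s (Suc n) y i = x i)"
        by (intro exI[of _ "\<lambda>l. dcomp V (r - 1) (y l)"]) auto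
    qed
  next
    assume k: "\<forall>r. kx s n (W r) (W' (r - 1))"
    show "kx s n (hsub X V W) (hsub X V W')"
      unfolding kexact_def
    proof (intro allI impI, elim conjE)
      fix x assume x: "\<forall>l<b n. x l \<in> hsub X V W" "\<forall>i<b (n - 1). kd s n x i = 0"
      have xX: "x l \<in> X" if "l < b n" for l using x(1) that by (auto simp: hsub_def)
      have "\<exists>y. (\<forall>l<b (Suc n). y l \<in> W' (r - 1)) \<and> (\<forall>i<b n. kd s (Suc n) y i = dcomp V r (x i))" for r
      proof -
        have "kd s n (\<lambda>l. dcomp V r (x l)) i = 0" if i: "i < b (n - 1)" for i
          using dcomp_kd[OF g, of n x i "r + 1", OF xX i] x(2) i dcomp_0[OF D] by simp
        moreover have "dcomp V r (x l) \<in> W r" if "l < b n" for l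
          using x(1) that by (auto simp: hsub_def)
        ultimately show ?thesis
          by (rule kexact_ex[OF k[rule_format, of r], of "\<lambda>l. dcomp V r (x l)", rotated])
      qed
      from choice[OF allI, OF this] obtain y where
        "\<forall>r. (\<forall>l<b (Suc n). y r l \<in> W' (r - 1)) \<and> (\<forall>i<b n. kd s (Suc n) (y r) i = dcomp V r (x i))"
        by (rule exE)
      then have y: "\<And>r l. l < b (Suc n) \<Longrightarrow> y r l \<in> W' (r - 1)"
        "\<And>r i. i < b n \<Longrightarrow> kd s (Suc n) (y r) i = dcomp V r (x i)"
        by simp_all
      define J where "J = (\<Union>l<b n. {r. dcomp V r (x l) \<noteq> 0})"
      have fin: "finite J" using dcomp_finite[OF D xX] by (auto simp: J_def)
      have "(\<Sum>r\<in>J. y r l) \<in> hsub X V W'" if "l < b (Suc n)" for l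
        using y(1)[OF that] sub(2) by (intro additive_subgroup_sum[OF hsub_additive_subgroup[OF D W'(1)]]) blast
      moreover have "kd s (Suc n) (\<lambda>l. \<Sum>r\<in>J. y r l) i = x i" if i: "i < b n" for i
      proof -
        have "kd s (Suc n) (\<lambda>l. \<Sum>r\<in>J. y r l) i = (\<Sum>r\<in>J. dcomp V r (x i))"
          unfolding kdif_sum[OF s] using y(2)[OF i] by simp
        also have "\<dots> = x i"
          by (rule dcomp_sum_superset[OF D xX[OF i] fin]) (use i in \<open>auto simp: J_def\<close>)
        finally show ?thesis .
      qed
      ultimately show "\<exists>y. (\<forall>l<b (Suc n). y l \<in> hsub X V W') \<and> (\<forall>i<b n. kd s (Suc n) y i = x i)"
        by (intro exI[of _ "\<lambda>l. \<Sum>r\<in>J. y r l"]) auto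
    qed
  }
qed

lemma kx_ring_homogeneous:
  assumes "n \<ge> 1"
  shows "kx (*) n (IA r) (IA (r - 1))"
proof -
  have sub: "\<And>r. additive_subgroup (IA r)" using IA_subgroup .
  show ?thesis
    using kx_hsub[OF graded_on_ring sub subset_refl sub subset_refl, of n] ring_exact[OF assms]
    by (simp add: hsub_self[OF ids_IA])
qed

lemma kx_lmul_power_0:
  assumes s: "module s" and Q: "additive_subgroup Q" "\<And>c x. x \<in> Q \<Longrightarrow> s (\<iota> c) x \<in> Q"
  shows "kx s 0 ((lm s ^^ Suc q) Q) ((lm s ^^ q) Q)"
  using kx_0_lmul[OF s lmul_power_additive_subgroup[OF s Q(1)] lmul_power_scale_closed[OF s Q(2)]] by simp

text \<open>The exactness of \<open>K\<close> in each degree, collected over all degrees at least \<open>q + 1\<close>: a cycle of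
  degree \<open>r\<close> bounds a tuple of degree \<open>r - 1\<close>.\<close>

lemma kx_ring_powers: "kx (*) n ((lm (*) ^^ Suc q) UNIV) ((lm (*) ^^ q) UNIV)"
proof (cases "n = 0")
  case True
  then show ?thesis
    using kx_lmul_power_0[OF module_mult, of UNIV q] by (simp add: additive_subgroup_def)
next
  case False
  let ?W = "\<lambda>q r. (lm (*) ^^ q) (IA (r - int q))"
  have sub: "additive_subgroup (?W q r)" "?W q r \<subseteq> IA r" for q r
    using lmul_power_additive_subgroup[OF module_mult IA_subgroup]
      lmul_power_component[OF graded_on_ring] by auto
  have "kx (*) n (?W (Suc q) r) (?W q (r - 1))" for r
  proof -
    have r: "r - int (Suc q) = r - 1 - int q" by simp
    show ?thesis
    proof (cases "r - 1 - int q < 0")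
      case True
      have "?W (Suc q) r = {0}"
        using True lmul_power_ring_component[of "Suc q" r] by simp
      then show ?thesis using kexact_zero[OF module_mult additive_subgroup_0[OF sub(1)]] by simp
    next
      case False
      then have "?W (Suc q) r = IA r" "?W q (r - 1) = IA (r - 1)"
        using lmul_power_ring_component[of "Suc q" r] lmul_power_ring_component[of q "r - 1"] by auto
      then show ?thesis using kx_ring_homogeneous[of n r] \<open>n \<noteq> 0\<close> by (simp add: One_nat_def)
    qed
  qed
  then have "kx (*) n (hsub UNIV IA (?W (Suc q))) (hsub UNIV IA (?W q))"
    using kx_hsub[OF graded_on_ring, of "?W (Suc q)" "?W q" n, OF sub(1) sub(2) sub(1) sub(2)] by blast
  then show ?thesis unfolding lmul_power_graded[OF graded_on_ring] .
qed

text \<open>\<open>K \<otimes> F\<close> is a direct sum of copies of \<open>K\<close>.\<close>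

lemma kx_coordinates:
  assumes "\<And>i. i < m \<Longrightarrow> kx (*) n (P i) (Q i)"
  shows "kxF n {f \<in> fcar m. \<forall>i<m. lookup f i \<in> P i} {f \<in> fcar m. \<forall>i<m. lookup f i \<in> Q i}"
  unfolding kexact_def
proof (intro allI impI, elim conjE)
  fix x :: "nat \<Rightarrow> nat \<Rightarrow>\<^sub>0 'r"
  assume x: "\<forall>l<b n. x l \<in> {f \<in> fcar m. \<forall>i<m. lookup f i \<in> P i}" "\<forall>j<b (n - 1). kd free_scale n x j = 0"
  have lookup_kd: "lookup (kd free_scale n x j) i = kd (*) n (\<lambda>l. lookup (x l) i) j" for n x j i
    by (rule kdif_hom) (auto simp: additive_lookup)
  have "\<exists>y. (\<forall>l<b (Suc n). y l \<in> Q i) \<and> (\<forall>j<b n. kd (*) (Suc n) y j = lookup (x j) i)" if i: "i < m" for i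
  proof -
    have "kd (*) n (\<lambda>l. lookup (x l) i) j = 0" if "j < b (n - 1)" for j
      using x(2) that lookup_kd[of n x j i] by simp
    moreover have "lookup (x l) i \<in> P i" if "l < b n" for l using x(1) that i by blast
    ultimately show ?thesis
      by (rule kexact_ex[OF assms[OF i], of "\<lambda>l. lookup (x l) i", rotated])
  qed
  from choice_less[OF this] obtain y where
    "\<forall>i<m. (\<forall>l<b (Suc n). y i l \<in> Q i) \<and> (\<forall>j<b n. kd (*) (Suc n) (y i) j = lookup (x j) i)"
    by (rule exE)
  then have y: "\<And>i l. i < m \<Longrightarrow> l < b (Suc n) \<Longrightarrow> y i l \<in> Q i"
    "\<And>i j. i < m \<Longrightarrow> j < b n \<Longrightarrow> kd (*) (Suc n) (y i) j = lookup (x j) i"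
    by simp_all
  let ?y = "\<lambda>l. tup m (\<lambda>i. y i l)"
  have "kd free_scale (Suc n) ?y j = x j" if j: "j < b n" for j
  proof (rule fcar_eqI)
    show "kd free_scale (Suc n) ?y j \<in> fcar m"
      by (auto simp: fcar_iff kdif_def lookup_sum)
    show "x j \<in> fcar m" using x(1) j by blast
    show "lookup (kd free_scale (Suc n) ?y j) i = lookup (x j) i" if "i < m" for i
      using y(2)[OF that j] that by (simp add: lookup_kd)
  qed
  moreover have "?y l \<in> {f \<in> fcar m. \<forall>i<m. lookup f i \<in> Q i}" if "l < b (Suc n)" for l
    using y(1) that by auto
  ultimately show "\<exists>y. (\<forall>l<b (Suc n). y l \<in> {f \<in> fcar m. \<forall>i<m. lookup f i \<in> Q i}) \<and>
      (\<forall>i<b n. kd free_scale (Suc n) y i = x i)"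
    by (intro exI[of _ ?y]) auto
qed

lemma kx_free_powers: "kxF n ((lmF ^^ Suc q) (fcar m)) ((lmF ^^ q) (fcar m))"
  unfolding lmul_power_coordinates by (rule kx_coordinates) (rule kx_ring_powers)

lemma kx_free_homogeneous:
  assumes "n \<ge> 1"
  shows "kxF n (fcomp m d r) (fcomp m d (r - 1))"
  unfolding fcomp_def
proof (rule kx_coordinates)
  fix i show "kx (*) n (IA (r - d i)) (IA (r - 1 - d i))"
    using kx_ring_homogeneous[OF assms, of "r - d i"] by (simp add: algebra_simps)
qed

text \<open>For a short exact sequence \<open>0 \<rightarrow> Z \<rightarrow> F \<rightarrow> N \<rightarrow> 0\<close> with \<open>F\<close> free, the connecting map of the long
  exact sequence embeds the homology of \<open>K \<otimes> N\<close> in degree \<open>n + 1\<close> into that of \<open>K \<otimes> Z\<close> in degree \<open>n\<close>; its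
  image consists of the classes that vanish in \<open>K \<otimes> F\<close>, and these are all classes if \<open>n \<ge> 1\<close>. The next
  two lemmas express this with control of the subgroups from which the entries of the cycles and of the
  bounded tuples are taken.\<close>

lemma kx_shift_down:
  assumes hom: "module_hom t s \<pi>" and PF: "additive_subgroup PF"
    and F: "kx t (Suc n) PF QF" and Z: "kx t n PZ QZ"
    and QZ: "QZ \<subseteq> PF" "\<And>z. z \<in> QZ \<Longrightarrow> \<pi> z = 0"
    and PZ: "\<And>x. x \<in> lm t PF \<Longrightarrow> \<pi> x = 0 \<Longrightarrow> x \<in> PZ"
  shows "kx s (Suc n) (\<pi> ` PF) (\<pi> ` QF)"
  unfolding kexact_def
proof (intro allI impI, elim conjE)
  interpret module_hom t s \<pi> by fact
  have t: "module t" and s: "module s" by unfold_locales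
  have \<pi>_kd: "\<pi> (kd t n x i) = kd s n (\<lambda>l. \<pi> (x l)) i" for n x i
    by (rule kdif_hom) (auto simp: additive_def add scale)
  fix x assume x: "\<forall>l<b (Suc n). x l \<in> \<pi> ` PF" "\<forall>i<b (Suc n - 1). kd s (Suc n) x i = 0"
  have "\<exists>x'. x' \<in> PF \<and> \<pi> x' = x l" if "l < b (Suc n)" for l
    using x(1)[rule_format, OF that] by (elim imageE) auto
  from choice_less[OF this]
  obtain x' where "\<forall>l<b (Suc n). x' l \<in> PF \<and> \<pi> (x' l) = x l"
    by (rule exE)
  then have x': "\<And>l. l < b (Suc n) \<Longrightarrow> x' l \<in> PF" "\<And>l. l < b (Suc n) \<Longrightarrow> \<pi> (x' l) = x l"
    by simp_all
  define z where "z i = kd t (Suc n) x' i" for i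
  have "z i \<in> PZ" if i: "i < b n" for i
  proof (rule PZ)
    show "z i \<in> lm t PF" unfolding z_def by (rule kd_lmul[OF t]) (use x' i in auto)
    have "\<pi> (z i) = kd s (Suc n) x i"
      unfolding z_def \<pi>_kd by (rule kdif_cong) (use x' in auto)
    then show "\<pi> (z i) = 0" using x(2) i by simp
  qed
  moreover have "kd t n z i = 0" if "i < b (n - 1)" for i
    unfolding z_def by (rule kd_kd[OF t that])
  ultimately have "\<exists>y. (\<forall>l<b (Suc n). y l \<in> QZ) \<and> (\<forall>i<b n. kd t (Suc n) y i = z i)"
    by (rule kexact_ex[OF Z])
  then obtain y where y: "\<And>l. l < b (Suc n) \<Longrightarrow> y l \<in> QZ" "\<And>i. i < b n \<Longrightarrow> kd t (Suc n) y i = z i"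
    by (elim exE conjE) auto
  have "x' l - y l \<in> PF" if "l < b (Suc n)" for l
    using that x'(1) y(1) QZ(1) by (intro additive_subgroup_diff[OF PF]) auto
  moreover have "kd t (Suc n) (\<lambda>l. x' l - y l) i = 0" if "i < b (Suc n - 1)" for i
    using that y(2)[of i] by (simp add: kdif_diff[OF t] z_def)
  ultimately have "\<exists>v. (\<forall>l<b (Suc (Suc n)). v l \<in> QF) \<and>
      (\<forall>i<b (Suc n). kd t (Suc (Suc n)) v i = x' i - y i)"
    by (rule kexact_ex[OF F])
  then obtain v where v: "\<And>l. l < b (Suc (Suc n)) \<Longrightarrow> v l \<in> QF"
    "\<And>i. i < b (Suc n) \<Longrightarrow> kd t (Suc (Suc n)) v i = x' i - y i"
    by (elim exE conjE) auto
  have "kd s (Suc (Suc n)) (\<lambda>l. \<pi> (v l)) i = x i" if i: "i < b (Suc n)" for i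
    using v(2)[OF i] x'(2)[OF i] QZ(2)[OF y(1)[OF i]] by (simp add: diff flip: \<pi>_kd)
  then show "\<exists>y. (\<forall>l<b (Suc (Suc n)). y l \<in> \<pi> ` QF) \<and> (\<forall>i<b (Suc n). kd s (Suc (Suc n)) y i = x i)"
    using v(1) by (intro exI[of _ "\<lambda>l. \<pi> (v l)"]) auto
qed

lemma kx_shift_up:
  assumes hom: "module_hom t s \<pi>" and PF: "additive_subgroup PF"
    and F: "kx t n P' PF" and N: "kx s (Suc n) (\<pi> ` PF) (\<pi> ` QF)"
    and QF: "lm t QF \<subseteq> PF"
    and PZ: "PZ \<subseteq> P'" "\<And>z. z \<in> PZ \<Longrightarrow> \<pi> z = 0"
    and QZ: "\<And>x. x \<in> PF \<Longrightarrow> \<pi> x = 0 \<Longrightarrow> x \<in> QZ"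
  shows "kx t n PZ QZ"
  unfolding kexact_def
proof (intro allI impI, elim conjE)
  interpret module_hom t s \<pi> by fact
  have t: "module t" and s: "module s" by unfold_locales
  have \<pi>_kd: "\<pi> (kd t n x i) = kd s n (\<lambda>l. \<pi> (x l)) i" for n x i
    by (rule kdif_hom) (auto simp: additive_def add scale)
  fix z assume z: "\<forall>l<b n. z l \<in> PZ" "\<forall>i<b (n - 1). kd t n z i = 0"
  obtain w where w: "\<And>l. l < b (Suc n) \<Longrightarrow> w l \<in> PF" "\<And>i. i < b n \<Longrightarrow> kd t (Suc n) w i = z i"
    by (rule kexactD[OF F, of z]) (use z PZ(1) in auto)
  have "kd s (Suc n) (\<lambda>l. \<pi> (w l)) i = 0" if "i < b (Suc n - 1)" for i
    using that w(2)[of i] z(1) PZ(2) by (simp flip: \<pi>_kd)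
  moreover have "\<pi> (w l) \<in> \<pi> ` PF" if "l < b (Suc n)" for l using w(1)[OF that] by (rule imageI)
  ultimately have "\<exists>v. (\<forall>l<b (Suc (Suc n)). v l \<in> \<pi> ` QF) \<and>
      (\<forall>i<b (Suc n). kd s (Suc (Suc n)) v i = \<pi> (w i))"
    by (rule kexact_ex[OF N, rotated])
  then obtain v where v: "\<And>l. l < b (Suc (Suc n)) \<Longrightarrow> v l \<in> \<pi> ` QF"
    "\<And>i. i < b (Suc n) \<Longrightarrow> kd s (Suc (Suc n)) v i = \<pi> (w i)"
    by (elim exE conjE) auto
  have "\<exists>u. u \<in> QF \<and> \<pi> u = v l" if "l < b (Suc (Suc n))" for l
    using v(1)[OF that] by (elim imageE) auto
  from choice_less[OF this]
  obtain u where "\<forall>l<b (Suc (Suc n)). u l \<in> QF \<and> \<pi> (u l) = v l"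
    by (rule exE)
  then have u: "\<And>l. l < b (Suc (Suc n)) \<Longrightarrow> u l \<in> QF" "\<And>l. l < b (Suc (Suc n)) \<Longrightarrow> \<pi> (u l) = v l"
    by simp_all
  let ?y = "\<lambda>l. w l - kd t (Suc (Suc n)) u l"
  have "?y l \<in> QZ" if l: "l < b (Suc n)" for l
  proof (rule QZ)
    have "kd t (Suc (Suc n)) u l \<in> lm t QF"
      by (rule kd_lmul[OF t]) (use u l in auto)
    then show "?y l \<in> PF" using w(1)[OF l] QF by (intro additive_subgroup_diff[OF PF]) auto
    have "\<pi> (kd t (Suc (Suc n)) u l) = kd s (Suc (Suc n)) v l"
      unfolding \<pi>_kd by (rule kdif_cong) (use u in auto)
    then show "\<pi> (?y l) = 0" using v(2)[OF l] by (simp add: diff)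
  qed
  moreover have "kd t (Suc n) ?y i = z i" if "i < b n" for i
    using w(2)[OF that] kd_kd[OF t, of i "Suc n" u] that by (simp add: kdif_diff[OF t])
  ultimately show "\<exists>y. (\<forall>l<b (Suc n). y l \<in> QZ) \<and> (\<forall>i<b n. kd t (Suc n) y i = z i)"
    by (intro exI[of _ ?y]) auto
qed

text \<open>Both sides are split by degree: the component of \<open>\<mm>\<^sup>q M\<close> of degree \<open>r\<close> is \<open>R\<^sub>q M\<^bsub>r-q\<^esub>\<close>.\<close>

lemma kx_powers_iff:
  assumes g: "graded_on s UNIV G"
  shows "(\<forall>q. kx s n ((lm s ^^ Suc q) UNIV) ((lm s ^^ q) UNIV)) \<longleftrightarrow>
    (\<forall>i q. kx s n ((lm s ^^ Suc q) (G i)) ((lm s ^^ q) (G i)))"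
proof -
  note D = graded_on_ids[OF g]
  have subG: "additive_subgroup (G r)" for r using ids_subgroup[OF D] .
  let ?W = "\<lambda>q r. (lm s ^^ q) (G (r - int q))"
  have sub: "additive_subgroup (?W q r)" "?W q r \<subseteq> G r" for q r
    using lmul_power_additive_subgroup[OF graded_on_module[OF g] subG] lmul_power_component[OF g] by auto
  have "kx s n ((lm s ^^ Suc q) UNIV) ((lm s ^^ q) UNIV) \<longleftrightarrow>
      (\<forall>i. kx s n ((lm s ^^ Suc q) (G i)) ((lm s ^^ q) (G i)))" for q
  proof -
    have "kx s n ((lm s ^^ Suc q) UNIV) ((lm s ^^ q) UNIV) \<longleftrightarrow>
        (\<forall>r. kx s n (?W (Suc q) r) (?W q (r - 1)))"
      unfolding lmul_power_graded[OF g] by (rule kx_hsub[OF g sub sub])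
    also have "\<dots> \<longleftrightarrow> (\<forall>r. kx s n ((lm s ^^ Suc q) (G (r - int (Suc q)))) ((lm s ^^ q) (G (r - int (Suc q)))))"
      by (simp add: algebra_simps)
    also have "\<dots> \<longleftrightarrow> (\<forall>i. kx s n ((lm s ^^ Suc q) (G i)) ((lm s ^^ q) (G i)))"
      by (metis add_diff_cancel_right')
    finally show ?thesis .
  qed
  then show ?thesis by blast
qed

end

section \<open>The linear part of a minimal resolution\<close>

lemma elt_set_plus_eq_iff:
  assumes "additive_subgroup B"
  shows "x +o B = y +o B \<longleftrightarrow> x - y \<in> B"
proof
  assume eq: "x +o B = y +o B"
  have "x + 0 \<in> x +o B" using additive_subgroup_0[OF assms] by (rule set_plus_intro2)
  then have "x \<in> y +o B" using eq by simp
  then show "x - y \<in> B" by (auto simp: elt_set_plus_def)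
next
  assume xy: "x - y \<in> B"
  have *: "u +o B \<subseteq> v +o B" if "u - v \<in> B" for u v
  proof
    fix w assume "w \<in> u +o B"
    then obtain c where c: "c \<in> B" "w = u + c" by (auto simp: elt_set_plus_def)
    then have "w = v + ((u - v) + c)" by simp
    then show "w \<in> v +o B"
      using additive_subgroup_add[OF assms that c(1)] unfolding elt_set_plus_def by blast
  qed
  have "y - x \<in> B" using additive_subgroup_minus[OF assms xy] by simp
  then show "x +o B = y +o B" using * xy by blast
qed

lemma elt_set_plus_0: "(0::'a::ab_group_add) +o B = B"
  by (auto simp: elt_set_plus_def)

lemma image_coset_plus:
  assumes "additive f" "additive_subgroup B'" "0 \<in> B" "f ` B \<subseteq> B'"
  shows "f ` (x +o B) + B' = f x +o B'"
proof (intro equalityI subsetI)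
  fix w assume "w \<in> f ` (x +o B) + B'"
  then obtain c d where cd: "c \<in> B" "d \<in> B'" "w = f (x + c) + d"
    by (auto simp: set_plus_def elt_set_plus_def)
  then have "w = f x + (f c + d)" by (simp add: additive.add[OF assms(1)] add.assoc)
  moreover have "f c + d \<in> B'" using assms cd by (intro additive_subgroup_add) auto
  ultimately show "w \<in> f x +o B'" by (auto simp: elt_set_plus_def)
next
  fix w assume "w \<in> f x +o B'"
  then obtain d where d: "d \<in> B'" "w = f (x + 0) + d" by (auto simp: elt_set_plus_def)
  moreover have "x + 0 \<in> x +o B" using assms(3) by (rule set_plus_intro2)
  ultimately show "w \<in> f ` (x +o B) + B'" by (metis imageI set_plus_intro)
qed

context std_graded
begin

text \<open>The submodule \<open>\<mm>\<^sup>q F\<close> of the free module \<open>F\<close> of rank \<open>m\<close>.\<close>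

abbreviation fpow :: "nat \<Rightarrow> nat \<Rightarrow> (nat \<Rightarrow>\<^sub>0 'r) set" where
  "fpow q m \<equiv> (lmF ^^ q) (fcar m)"

lemma fpow_subspace: "module.subspace free_scale (fpow q m)"
  by (rule lmul_power_subspace[OF module_free_scale subspace_fcar])

lemma fpow_additive: "additive_subgroup (fpow q m)"
  by (rule subspace_imp_additive_subgroup[OF module_free_scale fpow_subspace])

lemma fpow_antimono: "p \<le> q \<Longrightarrow> fpow q m \<subseteq> fpow p m"
  by (rule lmul_power_antimono[OF module_free_scale subspace_fcar, of p q "A 1" m])

lemma fpow_fcar: "fpow q m \<subseteq> fcar m"
  using fpow_antimono[of 0 q m] by simp

lemma fpow_1_iff: "f \<in> lmF (fcar m) \<longleftrightarrow> f \<in> fcar m \<and> (\<forall>i<m. lookup f i \<in> irrelevant_ideal A)"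
  using lmul_power_coordinates[of 1 "A 1" m] by (auto simp: irrelevant_ideal_eq One_nat_def)

lemma hom_lmul_power_image:
  assumes "module_hom s t \<phi>"
  shows "\<phi> ` (lm s ^^ q) Q = (lm t ^^ q) (\<phi> ` Q)"
  by (rule lmul_power_image[where s = s and t = t and \<phi> = \<phi>, OF module_hom_imp_additive[OF assms] module_hom.scale[OF assms]])

lemma hom_lmul_image:
  assumes "module_hom s t \<phi>"
  shows "\<phi> ` lm s Q = lm t (\<phi> ` Q)"
  by (rule lmul_image[where s = s and t = t and \<phi> = \<phi>, OF module_hom_imp_additive[OF assms] module_hom.scale[OF assms]])

lemma fil_eq: "fil A F i n = fpow (i - n) (rk F n)"
  unfolding fil_def free_carrier_eq by (rule ideal_times_ideal_power[OF module_free_scale subspace_fcar])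

lemma
  assumes "graded_free_resolution A s N V F"
  shows resolution_dif_hom: "module_hom free_scale free_scale (dif F n)"
    and resolution_aug_hom: "module_hom free_scale s (aug F)"
    and resolution_dif_0: "dif F 0 x = 0"
    and resolution_dif_comp: "dif F n ` fcomp (rk F n) (shft F n) j \<subseteq> fcomp (rk F (n - 1)) (shft F (n - 1)) j"
    and resolution_aug_comp: "aug F ` fcomp (rk F 0) (shft F 0) j \<subseteq> V j"
    and resolution_aug_surj: "aug F ` fcar (rk F 0) = N"
    and resolution_aug_ker: "{x \<in> fcar (rk F 0). aug F x = 0} = dif F 1 ` fcar (rk F 1)"
    and resolution_ker: "n \<ge> 1 \<Longrightarrow> {x \<in> fcar (rk F n). dif F n x = 0} = dif F (Suc n) ` fcar (rk F (Suc n))"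
  using assms unfolding graded_free_resolution_def free_carrier_eq free_component_eq Suc_eq_plus1 by simp_all

lemma resolution_dif_additive: "graded_free_resolution A s N V F \<Longrightarrow> additive (dif F n)"
  by (rule module_hom_imp_additive[OF resolution_dif_hom])

lemma resolution_dif_fcar:
  assumes "graded_free_resolution A s N V F"
  shows "dif F n ` fcar (rk F n) \<subseteq> fcar (rk F (n - 1))"
proof (cases "n \<le> 1")
  case True
  then consider "n = 0" | "n = 1" by linarith
  then show ?thesis
  proof cases
    case 1
    then show ?thesis using resolution_dif_0[OF assms] by (auto simp: fcar_iff)
  next
    case 2
    then show ?thesis using resolution_aug_ker[OF assms] by (auto simp: One_nat_def)
  qed
next
  case False
  then have "n - 1 \<ge> 1" "Suc (n - 1) = n" by linarith+
  then have "dif F n ` fcar (rk F n) = {x \<in> fcar (rk F (n - 1)). dif F (n - 1) x = 0}"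
    using resolution_ker[OF assms, of "n - 1"] by simp
  then show ?thesis by blast
qed

lemma resolution_dif_dif:
  assumes "graded_free_resolution A s N V F" "x \<in> fcar (rk F (Suc n))"
  shows "dif F n (dif F (Suc n) x) = 0"
proof (cases "n = 0")
  case True
  then show ?thesis using resolution_dif_0[OF assms(1)] by simp
next
  case False
  then show ?thesis using resolution_ker[OF assms(1), of n] assms(2) by auto
qed

lemma resolution_dif_fpow:
  assumes "graded_free_resolution A s N V F"
  shows "dif F n ` fpow q (rk F n) \<subseteq> fpow q (rk F (n - 1))"
  unfolding hom_lmul_power_image[OF resolution_dif_hom[OF assms]]
  by (rule lmul_power_mono[OF resolution_dif_fcar[OF assms]])

lemma minimal_dif_fpow:
  assumes F: "minimal_graded_free_resolution A s N V F" and n: "n \<ge> 1"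
  shows "dif F n ` fpow q (rk F n) \<subseteq> fpow (Suc q) (rk F (n - 1))"
proof -
  have R: "graded_free_resolution A s N V F"
    using F by (simp add: minimal_graded_free_resolution_def)
  have "dif F n ` fcar (rk F n) \<subseteq> lmF (fcar (rk F (n - 1)))"
    using F n unfolding minimal_graded_free_resolution_def free_carrier_eq
      ideal_times_irrelevant[OF module_free_scale subspace_fcar] by blast
  then have "(lmF ^^ q) (dif F n ` fcar (rk F n)) \<subseteq>
      (lmF ^^ q) (lmF (fcar (rk F (n - 1))))"
    by (rule lmul_power_mono)
  then show ?thesis
    unfolding hom_lmul_power_image[OF resolution_dif_hom[OF R]] by (simp add: funpow_swap1)
qed

text \<open>Acyclicity of the linear part, spelled out for representatives of the cosets. By minimality
  the differential raises the \<open>\<mm>\<close>-adic order by one, so that it acts on the cosets.\<close>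

lemma lin_homology_zero_iff:
  assumes F: "minimal_graded_free_resolution A s N V F" and n: "n \<ge> 1"
  shows "\<not> lin_homology_nonzero A F n \<longleftrightarrow>
    (\<forall>i. \<forall>x\<in>fpow (i - n) (rk F n). dif F n x \<in> fpow (Suc i - (n - 1)) (rk F (n - 1)) \<longrightarrow>
      (\<exists>y\<in>fpow (i - Suc n) (rk F (Suc n)). x - dif F (Suc n) y \<in> fpow (Suc i - n) (rk F n)))"
proof -
  have R: "graded_free_resolution A s N V F"
    using F by (simp add: minimal_graded_free_resolution_def)
  have n1: "n + 1 = Suc n" by simp
  have lin_dif: "lin_dif A F i p (x +o fil A F (i + 1) p) = dif F p x +o fil A F (i + 1) (p - 1)"
    if p: "p \<ge> 1" for i p x
    unfolding lin_dif_def
  proof (rule image_coset_plus)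
    show "additive (dif F p)" by (rule resolution_dif_additive[OF R])
    show "additive_subgroup (fil A F (i + 1) (p - 1))" "0 \<in> fil A F (i + 1) p"
      using fpow_additive additive_subgroup_0[OF fpow_additive] by (auto simp: fil_eq)
    have "dif F p ` fil A F (i + 1) p \<subseteq> fpow (Suc (i + 1 - p)) (rk F (p - 1))"
      unfolding fil_eq by (rule minimal_dif_fpow[OF F p])
    also have "\<dots> \<subseteq> fil A F (i + 1) (p - 1)"
      unfolding fil_eq by (rule fpow_antimono) (use p in linarith)
    finally show "dif F p ` fil A F (i + 1) p \<subseteq> fil A F (i + 1) (p - 1)" .
  qed
  have dif_fil: "dif F (Suc n) y \<in> fil A F i n" if "y \<in> fil A F i (Suc n)" for i y
  proof -
    have "dif F (Suc n) y \<in> fpow (Suc (i - Suc n)) (rk F n)"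
      using minimal_dif_fpow[OF F, of "Suc n" "i - Suc n"] that by (auto simp: fil_eq)
    also have "\<dots> \<subseteq> fil A F i n"
      unfolding fil_eq by (rule fpow_antimono) linarith
    finally show ?thesis .
  qed
  have "{C \<in> lin A F i n. lin_dif A F i n C = fil A F (i + 1) (n - 1)} = lin_dif A F i (n + 1) ` lin A F i (n + 1)
    \<longleftrightarrow> (\<forall>x\<in>fil A F i n. dif F n x \<in> fil A F (i + 1) (n - 1) \<longrightarrow>
      (\<exists>y\<in>fil A F i (Suc n). x - dif F (Suc n) y \<in> fil A F (i + 1) n))" (is "?L = ?R \<longleftrightarrow> ?P") for i
  proof -
    have sub: "additive_subgroup (fil A F (i + 1) p)" for p using fpow_additive by (simp add: fil_eq)
    have cyc: "lin_dif A F i n (x +o fil A F (i + 1) n) = fil A F (i + 1) (n - 1) \<longleftrightarrow>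
        dif F n x \<in> fil A F (i + 1) (n - 1)" for x
      using elt_set_plus_eq_iff[OF sub, of "dif F n x" "n - 1" 0] by (simp add: lin_dif[OF n] elt_set_plus_0)
    have L: "?L = {x +o fil A F (i + 1) n | x. x \<in> fil A F i n \<and> dif F n x \<in> fil A F (i + 1) (n - 1)}"
      unfolding lin_def using cyc by auto
    have R': "?R = {dif F (Suc n) y +o fil A F (i + 1) n | y. y \<in> fil A F i (Suc n)}"
      unfolding lin_def n1 image_image using lin_dif[of "Suc n" i] by auto
    have "?R \<subseteq> ?L"
    proof
      fix C assume "C \<in> ?R"
      then obtain y where y: "C = dif F (Suc n) y +o fil A F (i + 1) n" "y \<in> fil A F i (Suc n)"
        unfolding R' by blast
      have "y \<in> fcar (rk F (Suc n))" using y(2) fpow_fcar by (auto simp: fil_eq)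
      then have "dif F n (dif F (Suc n) y) \<in> fil A F (i + 1) (n - 1)"
        using resolution_dif_dif[OF R] additive_subgroup_0[OF sub] by simp
      then show "C \<in> ?L" unfolding L using y dif_fil by blast
    qed
    moreover have "?L \<subseteq> ?R \<longleftrightarrow> ?P"
    proof -
      have "x +o fil A F (i + 1) n \<in> ?R \<longleftrightarrow> (\<exists>y\<in>fil A F i (Suc n). x - dif F (Suc n) y \<in> fil A F (i + 1) n)" for x
        unfolding R' using elt_set_plus_eq_iff[OF sub, of x n] by blast
      then show ?thesis unfolding L by blast
    qed
    ultimately show ?thesis by blast
  qed
  note vanishing = this
  show ?thesis
    unfolding lin_homology_nonzero_def not_ex not_not vanishing
    unfolding fil_eq Suc_eq_plus1 by (rule refl)
qed

text \<open>This is \<open>Z\<^sub>n \<inter> \<mm>\<^bsup>j+1\<^esup> F\<^bsub>n-1\<^esub> \<subseteq> \<mm>\<^sup>j Z\<^sub>n\<close> for the syzygies \<open>Z\<^sub>n = \<partial>F\<^sub>n\<close>; for minimal \<open>F\<close> the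
  reverse inclusion holds as well, so that the two filtrations of \<open>Z\<^sub>n\<close> agree up to a shift.\<close>

definition strict_syzygy :: "('r, 'm) free_res \<Rightarrow> nat \<Rightarrow> bool" where
  "strict_syzygy F n \<longleftrightarrow> (\<forall>j. \<forall>x\<in>fcar (rk F n).
     dif F n x \<in> fpow (Suc j) (rk F (n - 1)) \<longrightarrow> dif F n x \<in> dif F n ` fpow j (rk F n))"

text \<open>Acyclicity improves the order of a preimage of a syzygy step by step: if \<open>\<partial>x\<close> has a larger order
  than that of \<open>x\<close> accounts for, then \<open>x\<close> can be changed by a boundary into an element of larger
  order. Conversely, a cycle of the linear part differs from a boundary \<open>\<partial>y\<close> by an element of larger
  order, by strictness at \<open>n\<close>, and \<open>y\<close> can be chosen in the right step of the filtration by strictness at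
  \<open>n + 1\<close>.\<close>

lemma lin_acyclic_iff_strict:
  assumes F: "minimal_graded_free_resolution A s N V F"
  shows "(\<forall>n\<ge>1. \<not> lin_homology_nonzero A F n) \<longleftrightarrow> (\<forall>n\<ge>1. strict_syzygy F n)"
proof
  have R: "graded_free_resolution A s N V F"
    using F by (simp add: minimal_graded_free_resolution_def)
  have dif_diff: "dif F n (x - y) = dif F n x - dif F n y" for n x y
    by (rule additive.diff[OF resolution_dif_additive[OF R]])
  {
    assume L: "\<forall>n\<ge>1. \<not> lin_homology_nonzero A F n"
    show "\<forall>n\<ge>1. strict_syzygy F n"
    proof (intro allI impI)
      fix n :: nat assume n: "n \<ge> 1"
      have "dif F n x \<in> dif F n ` fpow j (rk F n)"
        if "x \<in> fcar (rk F n)" "dif F n x \<in> fpow (Suc j) (rk F (n - 1))" for j x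
        using that
      proof (induct j arbitrary: x)
        case 0
        then show ?case by simp
      next
        case (Suc j)
        have "dif F n x \<in> fpow (Suc j) (rk F (n - 1))"
          using Suc(3) by (rule subsetD[OF fpow_antimono, rotated]) simp
        then obtain x' where x': "x' \<in> fpow j (rk F n)" "dif F n x = dif F n x'"
          using Suc(1,2) by blast
        have idx: "n + j - n = j" "Suc (n + j) - (n - 1) = Suc (Suc j)" "Suc (n + j) - n = Suc j"
          using n by arith+
        have "x' \<in> fpow (n + j - n) (rk F n)" "dif F n x' \<in> fpow (Suc (n + j) - (n - 1)) (rk F (n - 1))"
          using x' Suc(3) unfolding idx by (simp_all only:)
        then obtain y where y: "y \<in> fpow (n + j - Suc n) (rk F (Suc n))"
          "x' - dif F (Suc n) y \<in> fpow (Suc (n + j) - n) (rk F n)"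
          using L[rule_format, OF n] unfolding lin_homology_zero_iff[OF F n] by blast
        have "x' - dif F (Suc n) y \<in> fpow (Suc j) (rk F n)"
          using y(2) unfolding idx .
        moreover have "dif F n (x' - dif F (Suc n) y) = dif F n x"
          using resolution_dif_dif[OF R, of y n] y(1) fpow_fcar x'(2) by (auto simp: dif_diff)
        ultimately show ?case by (metis imageI)
      qed
      then show "strict_syzygy F n" unfolding strict_syzygy_def by blast
    qed
  next
    assume S: "\<forall>n\<ge>1. strict_syzygy F n"
    show "\<forall>n\<ge>1. \<not> lin_homology_nonzero A F n"
    proof (intro allI impI)
      fix n :: nat assume n: "n \<ge> 1"
      show "\<not> lin_homology_nonzero A F n"
        unfolding lin_homology_zero_iff[OF F n]
      proof (intro allI ballI impI)
        fix i x assume x: "x \<in> fpow (i - n) (rk F n)" "dif F n x \<in> fpow (Suc i - (n - 1)) (rk F (n - 1))"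
        have xF: "x \<in> fcar (rk F n)" using x(1) fpow_fcar by blast
        show "\<exists>y\<in>fpow (i - Suc n) (rk F (Suc n)). x - dif F (Suc n) y \<in> fpow (Suc i - n) (rk F n)"
        proof (cases "i < n")
          case True
          have "dif F (Suc n) 0 = 0"
            by (rule additive.zero[OF resolution_dif_additive[OF R]])
          then show ?thesis
            using True xF by (intro bexI[OF _ additive_subgroup_0[OF fpow_additive]]) auto
        next
          case False
          define j where "j = i - n"
          have i: "i = n + j" using False by (simp add: j_def)
          have idx: "Suc i - (n - 1) = Suc (Suc j)" "Suc i - n = Suc j"
            using n i by arith+
          have "dif F n x \<in> fpow (Suc (Suc j)) (rk F (n - 1))"
            using x(2) unfolding idx .
          then obtain w where w: "w \<in> fpow (Suc j) (rk F n)" "dif F n x = dif F n w"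
            using S n xF unfolding strict_syzygy_def by blast
          have "w \<in> fpow j (rk F n)"
            using w(1) fpow_antimono[of j "Suc j" "rk F n"] by auto
          then have xw: "x - w \<in> fpow j (rk F n)"
            using x(1) by (intro additive_subgroup_diff[OF fpow_additive]) (auto simp: i)
          moreover have "dif F n (x - w) = 0" using w(2) by (simp add: dif_diff)
          ultimately have "x - w \<in> dif F (Suc n) ` fcar (rk F (Suc n))"
            using resolution_ker[OF R n] fpow_fcar by blast
          then obtain y' where y': "y' \<in> fcar (rk F (Suc n))" "x - w = dif F (Suc n) y'" by blast
          have "\<exists>y\<in>fpow (i - Suc n) (rk F (Suc n)). x - w = dif F (Suc n) y"
          proof (cases j)
            case 0
            then show ?thesis using y' by (auto simp: i)
          next
            case (Suc k)
            have "dif F (Suc n) y' \<in> fpow (Suc k) (rk F (Suc n - 1))" using xw y' Suc by simp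
            then have "dif F (Suc n) y' \<in> dif F (Suc n) ` fpow k (rk F (Suc n))"
              using S[rule_format, of "Suc n"] y'(1) unfolding strict_syzygy_def by simp
            then show ?thesis using y'(2) by (auto simp: i Suc)
          qed
          then obtain y where y: "y \<in> fpow (i - Suc n) (rk F (Suc n))" "x - w = dif F (Suc n) y" by blast
          have "x - dif F (Suc n) y = w" using y(2) by (simp add: algebra_simps)
          then show ?thesis using y(1) w(1) unfolding idx by (intro bexI[of _ y]) simp_all
        qed
      qed
    qed
  }
qed

text \<open>The linearity defect is read off one chosen minimal resolution, and the criterion speaks of that
  one.\<close>

lemma koszul_module_iff_strict:
  assumes g: "graded_on s N V" and N: "fin_generated s N"
  obtains F where "minimal_graded_free_resolution A s N V F"
    "koszul_module A s N V \<longleftrightarrow> (\<forall>n\<ge>1. strict_syzygy F n)"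
proof -
  define F where "F = (SOME F. minimal_graded_free_resolution A s N V F)"
  have F: "minimal_graded_free_resolution A s N V F"
    unfolding F_def by (rule someI_ex[OF minimal_resolution_exists[OF g N]])
  have "koszul_module A s N V \<longleftrightarrow> Sup {enat n |n. lin_homology_nonzero A F n} = 0"
    by (simp add: koszul_module_def linearity_defect_def F_def[symmetric])
  also have "\<dots> \<longleftrightarrow> (\<forall>n. lin_homology_nonzero A F n \<longrightarrow> enat n \<le> 0)"
  proof -
    have "Sup S = (0::enat) \<longleftrightarrow> (\<forall>x\<in>S. x \<le> 0)" for S
      by (metis Sup_upper Sup_least le_zero_eq)
    then show ?thesis by auto
  qed
  also have "\<dots> \<longleftrightarrow> (\<forall>n\<ge>1. \<not> lin_homology_nonzero A F n)"
    by (auto simp: enat_0_iff One_nat_def Suc_le_eq)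
  also have "\<dots> \<longleftrightarrow> (\<forall>n\<ge>1. strict_syzygy F n)"
    by (rule lin_acyclic_iff_strict[OF F])
  finally show ?thesis using that F by blast
qed

section \<open>The resolution of the residue field over a Koszul algebra\<close>

lemma residue_map_eq: "residue_map \<iota> A r = c \<longleftrightarrow> dcomp IA 0 r = \<iota> c"
proof -
  have iff: "r - \<iota> c \<in> irrelevant_ideal A \<longleftrightarrow> dcomp IA 0 r = \<iota> c" for c
    using dcomp_homogeneous[OF ids_IA, of "\<iota> c" 0 0]
    by (simp add: irrelevant_ideal_iff dcomp_diff[OF ids_IA] A_0)
  have inj: "c = d" if "\<iota> c = \<iota> d" for c d
    using that iota_eq_0[of "c - d"] additive.diff[OF additive_iota, of c d] by simp
  obtain d where d: "dcomp IA 0 r = \<iota> d"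
    using dcomp_mem[OF ids_IA, of r 0] by (auto simp: A_0)
  have "residue_map \<iota> A r = d"
    unfolding residue_map_def iff using d inj by (intro the_equality) auto
  then show ?thesis using d inj by auto
qed

lemma iota_residue: "\<iota> (residue_map \<iota> A r) = dcomp IA 0 r"
  using residue_map_eq[of r "residue_map \<iota> A r"] by simp

lemma residue_iota: "residue_map \<iota> A (\<iota> c) = c"
  using dcomp_homogeneous[OF ids_IA, of "\<iota> c" 0 0] by (simp add: residue_map_eq A_0)

lemma residue_add: "residue_map \<iota> A (r + t) = residue_map \<iota> A r + residue_map \<iota> A t"
  by (simp add: residue_map_eq dcomp_add[OF ids_IA] iota_add iota_residue)

lemma residue_0_iff: "residue_map \<iota> A r = 0 \<longleftrightarrow> r \<in> irrelevant_ideal A"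
  by (simp add: residue_map_eq irrelevant_ideal_iff iota_0)

lemma residue_0: "residue_map \<iota> A 0 = 0"
  by (simp add: residue_map_eq dcomp_0[OF ids_IA] iota_0)

lemma irrelevant_ideal_mult: "r \<in> irrelevant_ideal A \<Longrightarrow> c * r \<in> irrelevant_ideal A"
  using lmul_subspace[OF module_mult module.subspace_UNIV[OF module_mult], of "A 1"]
  by (simp add: irrelevant_ideal_eq module.subspace_scale[OF module_mult])

lemma residue_mult: "residue_map \<iota> A (r * t) = residue_map \<iota> A r * residue_map \<iota> A t"
proof -
  let ?\<rho> = "residue_map \<iota> A"
  have "r * t - \<iota> (?\<rho> r * ?\<rho> t) = t * (r - \<iota> (?\<rho> r)) + \<iota> (?\<rho> r) * (t - \<iota> (?\<rho> t))"
    by (simp add: iota_mult algebra_simps)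
  moreover have "x - \<iota> (?\<rho> x) \<in> irrelevant_ideal A" for x
    by (simp add: irrelevant_ideal_iff dcomp_diff[OF ids_IA] iota_residue dcomp_dcomp[OF ids_IA])
  then have "t * (r - \<iota> (?\<rho> r)) + \<iota> (?\<rho> r) * (t - \<iota> (?\<rho> t)) \<in> irrelevant_ideal A"
    by (simp add: irrelevant_ideal_eq lmul_add irrelevant_ideal_mult[unfolded irrelevant_ideal_eq])
  ultimately have "?\<rho> (r * t - \<iota> (?\<rho> r * ?\<rho> t)) = 0" by (simp add: residue_0_iff)
  then have "dcomp IA 0 (r * t) = dcomp IA 0 (\<iota> (?\<rho> r * ?\<rho> t))"
    by (simp add: residue_map_eq iota_0 dcomp_diff[OF ids_IA])
  then show ?thesis
    using residue_iota[of "?\<rho> r * ?\<rho> t"] by (simp add: residue_map_eq)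
qed

lemma graded_on_residue_field:
  "graded_on (\<lambda>r c. residue_map \<iota> A r * c) (UNIV :: 'k set) (\<lambda>j. if j = 0 then UNIV else {0})"
proof -
  have mod: "module (\<lambda>r c. residue_map \<iota> A r * c)"
    by standard (auto simp: residue_add residue_mult algebra_simps residue_iota[of 1, unfolded iota_1])
  have "internal_direct_sum (UNIV :: 'k set) (\<lambda>_::unit. UNIV)"
  proof -
    have "x \<in> family_sum UNIV (\<lambda>_::unit. UNIV)" for x :: 'k
      unfolding family_sum_def by (auto intro!: exI[of _ "{()}"] exI[of _ "\<lambda>_. x"])
    moreover have "f i = 0" if "(\<Sum>i\<in>J. f i) = 0" "i \<in> J" for J and f :: "unit \<Rightarrow> 'k" and i
    proof -
      have "J = {i}" using that(2) by auto
      then show ?thesis using that(1) by simp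
    qed
    ultimately show ?thesis
      by (auto simp: internal_direct_sum_def additive_subgroup_def)
  qed
  then have "internal_direct_sum (UNIV :: 'k set) (\<lambda>j::int. if j = 0 then UNIV else {0})"
    by (rule ids_reindex[where \<sigma> = "\<lambda>_. 0"]) (auto simp: inj_on_def)
  moreover have "residue_map \<iota> A a * x \<in> (if int i + j = 0 then UNIV else {0})"
    if a: "a \<in> A i" and x: "x \<in> (if j = 0 then UNIV else {0})" for i j a and x :: 'k
  proof (cases "int i + j = 0")
    case False
    show ?thesis
    proof (cases "j = 0")
      case True
      then have "a \<in> irrelevant_ideal A"
        using dcomp_homogeneous[OF ids_IA, of a "int i" 0] a False by (simp add: irrelevant_ideal_iff)
      then show ?thesis using False by (simp add: residue_0_iff[THEN iffD2])
    qed (use x in simp)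
  qed simp
  ultimately show ?thesis
    unfolding graded_on_def using mod module.subspace_UNIV[OF mod] by blast
qed

lemma basis_not_in_lmul:
  assumes "l < m"
  shows "bvec l \<notin> lmF (fcar m :: (nat \<Rightarrow>\<^sub>0 'r) set)"
proof
  assume "bvec l \<in> lmF (fcar m :: (nat \<Rightarrow>\<^sub>0 'r) set)"
  then have "(1::'r) \<in> irrelevant_ideal A" using assms by (force simp: fpow_1_iff)
  then have "residue_map \<iota> A 1 = 0" by (simp add: residue_0_iff)
  then show False using residue_iota[of 1] by (simp add: iota_1)
qed

lemma basis_homogeneous:
  assumes "l < m"
  shows "bvec l \<in> fcomp m d (d l)"
proof -
  have "(1::'r) \<in> IA 0" by (metis A_0 IA_0 iota_1 rangeI)
  moreover have "0 \<in> IA j" for j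
    using IA_zero .
  ultimately show ?thesis
    using assms by (auto simp: fcomp_def fcar_iff lookup_single when_def simp del: IA_0)
qed

text \<open>The shifts of the minimal resolution \<open>K\<close> of \<open>k\<close> are determined by induction on \<open>n\<close>. By minimality, a
  basis element \<open>e\<close> of \<open>K\<^bsub>n+1\<^esub>\<close> whose degree is not \<open>n + 1\<close> has \<open>\<partial>e \<in> \<mm>\<^sup>2K\<^sub>n\<close>. Strictness then
  provides \<open>w \<in> \<mm>K\<^bsub>n+1\<^esub>\<close> with \<open>\<partial>e = \<partial>w\<close>, and \<open>e - w\<close> lies in \<open>Z\<^bsub>n+2\<^esub> \<subseteq> \<mm>K\<^bsub>n+1\<^esub>\<close>,
  which is absurd. A basis element of \<open>K\<^sub>0\<close> of nonzero degree would vanish in \<open>k\<close> and hence lie in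
  \<open>Z\<^sub>1 \<subseteq> \<mm>K\<^sub>0\<close>.\<close>

theorem koszul_linear_resolution:
  assumes "koszul_algebra \<iota> A"
  obtains b a where "linear_resolution \<iota> A b a"
proof -
  let ?s = "\<lambda>r c. residue_map \<iota> A r * c" and ?V = "\<lambda>j::int. if j = 0 then UNIV else {0::'k}"
  note g = graded_on_residue_field
  interpret k: module ?s by (rule graded_on_module[OF g])
  have "c \<in> k.span {1}" for c
    using k.span_scale[OF k.span_base[of 1 "{1}"], of "\<iota> c"] by (simp add: residue_iota)
  then have "k.span {1} = UNIV" by blast
  then have "fin_generated ?s (UNIV :: 'k set)"
    unfolding fin_generated_def by (intro exI[of _ "{1}"]) simp
  then obtain F where F: "minimal_graded_free_resolution A ?s UNIV ?V F"
    and "koszul_module A ?s UNIV ?V \<longleftrightarrow> (\<forall>n\<ge>1. strict_syzygy F n)"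
    by (rule koszul_module_iff_strict[OF g])
  then have S: "\<And>n. n \<ge> 1 \<Longrightarrow> strict_syzygy F n"
    using assms unfolding koszul_algebra_def by simp
  have R: "graded_free_resolution A ?s UNIV ?V F"
    using F by (simp add: minimal_graded_free_resolution_def)
  have dif_min: "dif F (Suc n) ` fcar (rk F (Suc n)) \<subseteq> lmF (fcar (rk F n))" for n
    using minimal_dif_fpow[OF F, of "Suc n" 0] by simp
  have e_fcar: "bvec l \<in> (fcar (rk F n) :: (nat \<Rightarrow>\<^sub>0 'r) set)" if "l < rk F n" for l n
    using basis_homogeneous[OF that] by (auto simp: fcomp_def)
  have e_comp: "dif F (Suc n) (bvec l) \<in> fcomp (rk F n) (shft F n) (shft F (Suc n) l)" if "l < rk F (Suc n)" for l n
    using resolution_dif_comp[OF R, of "Suc n"] basis_homogeneous[OF that] by auto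
  have dif_diff: "dif F n (x - y) = dif F n x - dif F n y" for n x y
    by (rule additive.diff[OF resolution_dif_additive[OF R]])
  have lm_diff: "x + y \<in> lmF (fcar m)" if "x \<in> lmF (fcar m)" "y \<in> lmF (fcar m)"
    for x y and m
    using that by (rule lmul_add)
  have lin: "\<forall>l<rk F n. shft F n l = int n" for n
  proof (induct n)
    case 0
    show ?case
    proof (intro allI impI, rule ccontr)
      fix l assume l: "l < rk F 0" and ne: "shft F 0 l \<noteq> int 0"
      have "aug F (bvec l) \<in> ?V (shft F 0 l)"
        using resolution_aug_comp[OF R, of "shft F 0 l"] basis_homogeneous[OF l] by blast
      then have "bvec l \<in> dif F 1 ` fcar (rk F 1)"
        using resolution_aug_ker[OF R] e_fcar[OF l] ne by auto
      then show False using dif_min[of 0] basis_not_in_lmul[OF l] by (auto simp: One_nat_def)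
    qed
  next
    case (Suc n)
    show ?case
    proof (intro allI impI, rule ccontr)
      fix l assume l: "l < rk F (Suc n)" and ne: "shft F (Suc n) l \<noteq> int (Suc n)"
      let ?d = "shft F (Suc n) l" and ?x = "dif F (Suc n) (bvec l)"
      have x: "?x \<in> fcar (rk F n)" "\<And>i. i < rk F n \<Longrightarrow> lookup ?x i \<in> IA (?d - int n)"
        using e_comp[OF l] Suc by (auto simp: fcomp_def)
      have xm: "\<And>i. i < rk F n \<Longrightarrow> lookup ?x i \<in> irrelevant_ideal A"
        using dif_min[of n] e_fcar[OF l] by (auto simp: fpow_1_iff)
      have "?x \<in> fpow 2 (rk F n)"
        unfolding lmul_power_coordinates mem_Collect_eq
      proof (intro conjI x(1) allI impI)
        fix i assume i: "i < rk F n"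
        show "lookup ?x i \<in> (lm (*) ^^ 2) UNIV"
          unfolding lmul_power_ring_iff
        proof (intro allI impI)
          fix j :: int assume j: "j < int 2"
          have "dcomp IA j (lookup ?x i) = 0" if "j \<noteq> 0" "j \<noteq> 1"
            using that j dcomp_mem[OF ids_IA, of "lookup ?x i" j] IA_neg[of j] by auto
          moreover have "dcomp IA 0 (lookup ?x i) = 0"
            using xm[OF i] by (simp add: irrelevant_ideal_iff)
          moreover have "dcomp IA 1 (lookup ?x i) = 0"
            using dcomp_homogeneous[OF ids_IA x(2)[OF i], of 1] ne by auto
          ultimately show "dcomp IA j (lookup ?x i) = 0" by (cases "j = 0"; cases "j = 1") auto
        qed
      qed
      then have "?x \<in> fpow (Suc 1) (rk F (Suc n - 1))" by (simp add: numeral_2_eq_2 One_nat_def)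
      moreover have "strict_syzygy F (Suc n)" by (rule S) simp
      ultimately have "?x \<in> dif F (Suc n) ` fpow 1 (rk F (Suc n))"
        using e_fcar[OF l] unfolding strict_syzygy_def by blast
      then obtain w where w: "w \<in> fpow 1 (rk F (Suc n))" "?x = dif F (Suc n) w" by blast
      have wl: "w \<in> lmF (fcar (rk F (Suc n)))" using w(1) by (simp add: One_nat_def)
      have "bvec l - w \<in> fcar (rk F (Suc n))"
        using e_fcar[OF l] fpow_fcar w(1) by (intro additive_subgroup_diff[OF additive_subgroup_fcar]) auto
      moreover have "dif F (Suc n) (bvec l - w) = 0" using w(2) by (simp add: dif_diff)
      ultimately have "bvec l - w \<in> lmF (fcar (rk F (Suc n)))"
        using resolution_ker[OF R, of "Suc n"] dif_min[of "Suc n"] by auto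
      from lm_diff[OF this wl] show False using basis_not_in_lmul[OF l] by simp
    qed
  qed
  define a where "a n l i = lookup (dif F n (bvec l)) i" for n l i
  have dif_lookup: "lookup (dif F n f) i = (\<Sum>l<rk F n. lookup f l * a n l i)" if "f \<in> fcar (rk F n)" for n f i
    using hom_expansion[OF resolution_dif_hom[OF R] that] by (simp add: lookup_sum a_def)
  have kd_lookup: "kdif (*) (rk F) a n x i = lookup (dif F n (tup (rk F n) x)) i" for n x i
    unfolding dif_lookup[OF tup_in_fcar] kdif_def by (simp add: mult.commute)
  have "linear_resolution \<iota> A (rk F) a"
  proof (unfold_locales)
    show "a n l i \<in> A 1" if n: "1 \<le> n" and l: "l < rk F n" and i: "i < rk F (n - 1)" for n l i
    proof -
      obtain m where m: "n = Suc m" using n by (cases n) auto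
      show ?thesis using e_comp[of l m] lin[of m] lin[of n] l i by (simp add: m a_def fcomp_def)
    qed
    show "a 0 l i = 0" for l i by (simp add: a_def resolution_dif_0[OF R])
    show "(\<Sum>j<rk F n. a (Suc n) l j * a n j i) = 0" if "1 \<le> n" "l < rk F (Suc n)" "i < rk F (n - 1)" for n l i
    proof -
      have "dif F (Suc n) (bvec l) \<in> fcar (rk F n)" using e_comp[OF that(2)] by (simp add: fcomp_def)
      from dif_lookup[OF this, of i] show ?thesis
        using resolution_dif_dif[OF R e_fcar[OF that(2)]] by (simp add: a_def)
    qed
    show "kexact (*) (rk F) a n UNIV UNIV" if n: "1 \<le> n" for n
      unfolding kexact_def
    proof (intro allI impI, elim conjE)
      fix x assume x: "\<forall>i<rk F (n - 1). kdif (*) (rk F) a n x i = 0"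
      have "dif F n (tup (rk F n) x) = 0"
      proof (rule fcar_eqI)
        show "dif F n (tup (rk F n) x) \<in> fcar (rk F (n - 1))"
          using resolution_dif_fcar[OF R, of n] tup_in_fcar by blast
      qed (use x in \<open>auto simp: kd_lookup fcar_iff\<close>)
      then obtain y where y: "y \<in> fcar (rk F (Suc n))" "tup (rk F n) x = dif F (Suc n) y"
        using resolution_ker[OF R n] tup_in_fcar by blast
      have "tup (rk F (Suc n)) (lookup y) = y"
        using y(1) by (intro fcar_eqI[of _ "rk F (Suc n)"]) auto
      then have "kdif (*) (rk F) a (Suc n) (lookup y) i = x i" if "i < rk F n" for i
        using that by (simp add: kd_lookup y(2)[symmetric])
      then show "\<exists>y. (\<forall>l<rk F (Suc n). y l \<in> UNIV) \<and> (\<forall>i<rk F n. kdif (*) (rk F) a (Suc n) y i = x i)"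
        by (intro exI[of _ "lookup y"]) simp
    qed
    show "0 < rk F 0"
    proof (rule ccontr)
      assume "\<not> 0 < rk F 0"
      then have "fcar (rk F 0) = {0 :: nat \<Rightarrow>\<^sub>0 'r}" by (auto simp: fcar_iff intro!: poly_mapping_eqI)
      then have "(UNIV :: 'k set) = {0}"
        using resolution_aug_surj[OF R] additive.zero[OF module_hom_imp_additive[OF resolution_aug_hom[OF R]]]
        by auto
      then have "(1::'k) \<in> {0}" using UNIV_I[of "1::'k"] by (simp only:)
      then show False by simp
    qed
    show "\<exists>u. (\<forall>l<rk F 1. u l \<in> A 0) \<and> (\<forall>j<rk F 0. kdif (*) (rk F) a 1 u j = (if j = i then c else 0))"
      if c: "c \<in> A 1" and i: "i < rk F 0" for c i
    proof -
      let ?f = "Poly_Mapping.single i c"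
      note zero = IA_zero
      have f: "?f \<in> fcomp (rk F 0) (shft F 0) 1"
        using c i lin[of 0] zero zero[of 1, unfolded IA_1]
        by (auto simp: fcomp_def fcar_iff lookup_single when_def)
      then have f': "?f \<in> fcar (rk F 0)" by (simp add: fcomp_def)
      have "c \<in> irrelevant_ideal A"
        using dcomp_homogeneous[OF ids_IA, of c 1 0] c by (simp add: irrelevant_ideal_iff)
      moreover have "?f = free_scale c (bvec i)"
        by (rule poly_mapping_eqI) (simp add: lookup_single when_def)
      ultimately have "aug F ?f = 0"
        using module_hom.scale[OF resolution_aug_hom[OF R]] by (simp add: residue_0_iff[THEN iffD2])
      then obtain h where h: "h \<in> fcar (rk F 1)" "?f = dif F 1 h"
        using resolution_aug_ker[OF R] f' by blast
      let ?h = "dcomp (fcomp (rk F 1) (shft F 1)) 1 h"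
      have "dcomp (fcomp (rk F 0) (shft F 0)) (id 1) (dif F 1 h) = dif F 1 ?h"
        by (rule dcomp_additive[OF ids_fcomp ids_fcomp resolution_dif_additive[OF R] _ bij_id h(1)])
          (use resolution_dif_comp[OF R, of 1] in auto)
      then have eq: "dif F 1 ?h = ?f"
        using dcomp_homogeneous[OF ids_fcomp f, of 1] h(2) by simp
      have hc: "?h \<in> fcomp (rk F 1) (shft F 1) 1" by (rule dcomp_mem[OF ids_fcomp h(1)])
      then have "tup (rk F 1) (lookup ?h) = ?h"
        by (intro fcar_eqI[of _ "rk F 1"]) (auto simp: fcomp_def)
      then have "kdif (*) (rk F) a 1 (lookup ?h) j = (if j = i then c else 0)" if "j < rk F 0" for j
        using that by (simp add: kd_lookup eq lookup_single when_def eq_commute)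
      moreover have "lookup ?h l \<in> A 0" if "l < rk F 1" for l
        using hc that lin[of 1] by (auto simp: fcomp_def One_nat_def)
      ultimately show ?thesis by (intro exI[of _ "lookup ?h"]) simp
    qed
  qed
  then show ?thesis by (rule that)
qed

end

context linear_resolution
begin

section \<open>Koszul modules\<close>

text \<open>When the filtrations of \<open>Z\<close> are compatible up to a shift, the modules \<open>\<mm>\<^sup>qN = \<pi>(\<mm>\<^sup>qF)\<close> have the
  syzygies \<open>\<mm>\<^bsup>q-1\<^esup>Z\<close>, and the connecting maps link the conditions for \<open>N\<close> and for \<open>Z\<close>. The condition
  for \<open>N\<close> in homological degree one already forces the compatibility, by induction on the order \<open>j\<close>.\<close>

lemma strict_shift:
  assumes hom: "module_hom free_scale s \<pi>" and Z: "Z = {x \<in> fcar m. \<pi> x = 0}"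
    and min: "Z \<subseteq> lmF (fcar m)" and N: "N = \<pi> ` fcar m"
  shows "(\<And>j. Z \<inter> fpow (Suc j) m \<subseteq> (lmF ^^ j) Z) \<Longrightarrow>
      (\<And>q. kxF n ((lmF ^^ Suc q) Z) ((lmF ^^ q) Z)) \<Longrightarrow>
      kx s (Suc n) ((lm s ^^ Suc q) N) ((lm s ^^ q) N)"
    and "(\<And>j. Z \<inter> fpow (Suc j) m \<subseteq> (lmF ^^ j) Z) \<Longrightarrow>
      (\<And>q. kx s (Suc n) ((lm s ^^ Suc q) N) ((lm s ^^ q) N)) \<Longrightarrow>
      kxF n ((lmF ^^ Suc q) Z) ((lmF ^^ q) Z)"
    and "(\<And>q. kx s (Suc 0) ((lm s ^^ Suc q) N) ((lm s ^^ q) N)) \<Longrightarrow>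
      Z \<inter> fpow (Suc j) m \<subseteq> (lmF ^^ j) Z"
proof -
  interpret module_hom free_scale s \<pi> by fact
  have subZ: "module.subspace free_scale Z"
    using subspace_fcar[of m] unfolding module.subspace_def[OF module_free_scale] Z
    by (auto simp: zero add scale module.scale_zero_right[OF m2.module_axioms])
  have powZ: "(lmF ^^ q) Z \<subseteq> Z" for q
    using lmul_power_antimono[OF module_free_scale subZ le0[of q], of "A 1"] by simp
  have powZF: "(lmF ^^ q) Z \<subseteq> fpow (Suc q) m" for q
    using lmul_power_mono[OF min, of q free_scale "A 1"] by (simp add: funpow_swap1)
  have N_pow: "(lm s ^^ q) N = \<pi> ` fpow q m" for q
    unfolding N by (rule hom_lmul_power_image[OF hom, symmetric])
  show "kx s (Suc n) ((lm s ^^ Suc q) N) ((lm s ^^ q) N)"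
    if C: "\<And>j. Z \<inter> fpow (Suc j) m \<subseteq> (lmF ^^ j) Z"
      and k: "\<And>q. kxF n ((lmF ^^ Suc q) Z) ((lmF ^^ q) Z)"
    unfolding N_pow
  proof (rule kx_shift_down[OF hom fpow_additive kx_free_powers k powZF])
    show "\<pi> z = 0" if "z \<in> (lmF ^^ q) Z" for z using that powZ by (auto simp: Z)
    show "x \<in> (lmF ^^ Suc q) Z" if "x \<in> lmF (fpow (Suc q) m)" "\<pi> x = 0" for x
    proof -
      have "x \<in> fpow (Suc (Suc q)) m" using that(1) by simp
      then show ?thesis using C[of "Suc q"] that(2) fpow_fcar by (auto simp: Z simp del: funpow.simps)
    qed
  qed
  show up: "kxF n ((lmF ^^ Suc q) Z) ((lmF ^^ q) Z)"
    if C: "\<And>j. Z \<inter> fpow (Suc j) m \<subseteq> (lmF ^^ j) Z"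
      and k: "\<And>q. kx s (Suc n) ((lm s ^^ Suc q) N) ((lm s ^^ q) N)"
  proof (rule kx_shift_up[OF hom fpow_additive kx_free_powers k[unfolded N_pow] _ powZF])
    show "\<pi> z = 0" if "z \<in> (lmF ^^ Suc q) Z" for z using that powZ[of "Suc q"] unfolding Z by blast
    show "x \<in> (lmF ^^ q) Z" if "x \<in> fpow (Suc q) m" "\<pi> x = 0" for x
      using C[of q] that fpow_fcar unfolding Z by blast
  qed simp
  show "Z \<inter> fpow (Suc j) m \<subseteq> (lmF ^^ j) Z"
    if k: "\<And>q. kx s (Suc 0) ((lm s ^^ Suc q) N) ((lm s ^^ q) N)"
  proof (induct j)
    case (Suc j)
    have k': "kx s (Suc 0) (\<pi> ` fpow (Suc j) m) (\<pi> ` fpow j m)"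
      using k[of j] unfolding N_pow .
    have "kxF 0 (Z \<inter> fpow (Suc (Suc j)) m) ((lmF ^^ j) Z)"
    proof (rule kx_shift_up[OF hom fpow_additive kx_free_powers k'])
      show "x \<in> (lmF ^^ j) Z" if "x \<in> fpow (Suc j) m" "\<pi> x = 0" for x
        using Suc that fpow_fcar unfolding Z by blast
    qed (auto simp: Z)
    moreover have "0 \<in> Z \<inter> fpow (Suc (Suc j)) m"
      using additive_subgroup_0[OF fpow_additive] module.subspace_0[OF module_free_scale subZ] by blast
    ultimately have "Z \<inter> fpow (Suc (Suc j)) m \<subseteq> lmF ((lmF ^^ j) Z)"
      using lmul_power_subspace[OF module_free_scale subZ, of j "A 1"]
      by (subst (asm) kx_0_iff[OF module_free_scale])
        (auto intro: subspace_imp_additive_subgroup[OF module_free_scale] module.subspace_scale[OF module_free_scale])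
    then show ?case by simp
  qed auto
qed

text \<open>Strictness at all stages lets the condition climb from the trivial case \<open>n = 0\<close>, for all syzygies at
  once, to all \<open>n\<close>. Conversely, the conditions for \<open>M\<close> give strictness at the first stage, therefore the
  conditions for the first syzygies, and so on.\<close>

theorem strict_iff_kx:
  assumes F: "minimal_graded_free_resolution A s N V F"
  shows "(\<forall>n\<ge>1. strict_syzygy F n) \<longleftrightarrow> (\<forall>n q. kx s n ((lm s ^^ Suc q) N) ((lm s ^^ q) N))"
proof -
  have R: "graded_free_resolution A s N V F"
    using F by (simp add: minimal_graded_free_resolution_def)
  let ?Z = "\<lambda>n. dif F n ` fcar (rk F n)"
  let ?P = "\<lambda>n i. \<forall>q. kxF n ((lmF ^^ Suc q) (?Z i)) ((lmF ^^ q) (?Z i))"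
  let ?C = "\<lambda>n. \<forall>j. ?Z n \<inter> fpow (Suc j) (rk F (n - 1)) \<subseteq> (lmF ^^ j) (?Z n)"
  let ?PN = "\<lambda>n. \<forall>q. kx s n ((lm s ^^ Suc q) N) ((lm s ^^ q) N)"
  have C: "strict_syzygy F n \<longleftrightarrow> ?C n" for n
    unfolding strict_syzygy_def hom_lmul_power_image[OF resolution_dif_hom[OF R]] by blast
  have min: "?Z (Suc n) \<subseteq> lmF (fcar (rk F n))" for n
    using minimal_dif_fpow[OF F, of "Suc n" 0] by simp
  have ker0: "?Z (Suc 0) = {x \<in> fcar (rk F 0). aug F x = 0}"
    using resolution_aug_ker[OF R] by (simp add: One_nat_def)
  have ker: "?Z (Suc i) = {x \<in> fcar (rk F i). dif F i x = 0}" if "i \<ge> 1" for i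
    using resolution_ker[OF R that] by simp
  have s: "module s" using resolution_aug_hom[OF R] by (simp add: module_hom_def)
  have subN: "module.subspace s N"
    using resolution_aug_surj[OF R] module_hom.subspace_image[OF resolution_aug_hom[OF R] subspace_fcar] by metis
  have subZ: "module.subspace free_scale (?Z i)" for i
    by (rule module_hom.subspace_image[OF resolution_dif_hom[OF R] subspace_fcar])
  have aug: "N = aug F ` fcar (rk F 0)" using resolution_aug_surj[OF R] by simp
  note shift0 = strict_shift[OF resolution_aug_hom[OF R] ker0 min aug]
  note shift = strict_shift[OF resolution_dif_hom[OF R] ker min refl]
  show ?thesis
  proof
    assume "\<forall>n\<ge>1. strict_syzygy F n"
    then have CC: "?C (Suc n)" for n using C[of "Suc n"] by simp
    have "?P n i" if "i \<ge> 1" for n i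
      using that
    proof (induct n arbitrary: i)
      case 0
      then show ?case
        by (intro allI kx_lmul_power_0[OF module_free_scale subspace_imp_additive_subgroup[OF module_free_scale subZ]]
            module.subspace_scale[OF module_free_scale subZ])
    next
      case (Suc n)
      then show ?case using shift(1)[OF Suc(2)] CC[of i] by simp
    qed
    then have "?PN (Suc n)" for n using shift0(1) CC[of 0] by (simp add: One_nat_def)
    moreover have "?PN 0"
      by (intro allI kx_lmul_power_0[OF s subspace_imp_additive_subgroup[OF s subN]] module.subspace_scale[OF s subN])
    ultimately show "\<forall>n. ?PN n" by (metis not0_implies_Suc)
  next
    assume PN: "\<forall>n. ?PN n"
    have "?C (Suc i) \<and> (\<forall>n. ?P n (Suc i))" for i
    proof (induct i)
      case 0
      have "?C (Suc 0)" using shift0(3) PN by simp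
      moreover have "?P n (Suc 0)" for n using shift0(2) \<open>?C (Suc 0)\<close> PN by simp
      ultimately show ?case by blast
    next
      case (Suc i)
      have i: "Suc i \<ge> 1" by simp
      have "?C (Suc (Suc i))" using shift(3)[OF i] Suc by simp
      moreover have "?P n (Suc (Suc i))" for n using shift(2)[OF i] \<open>?C (Suc (Suc i))\<close> Suc by simp
      ultimately show ?case by blast
    qed
    then show "\<forall>n\<ge>1. strict_syzygy F n"
      unfolding C by (metis One_nat_def Suc_le_D)
  qed
qed

end

section \<open>Graded Betti numbers\<close>

lemma vector_space_free_scale: "vector_space (free_scale :: 'k::field \<Rightarrow> _)"
  using module_free_scale[where 'a = 'k] by (simp add: vector_space_def module_def)

lemma (in vector_space) dim_diff_eq_0_iff:
  assumes sub: "subspace U" "subspace W" and UW: "U \<subseteq> W" and fin: "finite B" "W \<subseteq> span B"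
  shows "dim W - dim U = 0 \<longleftrightarrow> W \<subseteq> U"
proof
  assume d: "dim W - dim U = 0"
  obtain BU where BU: "BU \<subseteq> U" "independent BU" "U \<subseteq> span BU" "card BU = dim U"
    by (rule basis_exists)
  obtain BW where BW: "BU \<subseteq> BW" "BW \<subseteq> W" "independent BW" "W \<subseteq> span BW"
    using maximal_independent_subset_extend[of BU W] BU UW by blast
  have "finite BW" using independent_span_bound[OF fin(1) BW(3)] BW(2) fin(2) by blast
  moreover have "card BW = dim W" by (rule basis_card_eq_dim[OF BW(2,4,3)])
  ultimately have "BU = BW" using card_seteq[of BW BU] BW(1) BU(4) d by simp
  then show "W \<subseteq> U" using BW(4) span_minimal[OF BU(1) sub(1)] by blast
next
  assume "W \<subseteq> U"
  then have "W = U" using UW by simp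
  then show "dim W - dim U = 0" by simp
qed

context std_graded
begin

abbreviation \<rho> :: "(nat \<Rightarrow>\<^sub>0 'r) \<Rightarrow> (nat \<Rightarrow>\<^sub>0 'k)" where
  "\<rho> \<equiv> Poly_Mapping.map (residue_map \<iota> A)"
abbreviation \<kappa> :: "(nat \<Rightarrow>\<^sub>0 'k) \<Rightarrow> (nat \<Rightarrow>\<^sub>0 'r)" where
  "\<kappa> \<equiv> Poly_Mapping.map \<iota>"

lemma lookup_rho [simp]: "lookup (\<rho> f) i = residue_map \<iota> A (lookup f i)"
  by (auto simp: Poly_Mapping.map.rep_eq when_def residue_0)

lemma lookup_kappa [simp]: "lookup (\<kappa> v) i = \<iota> (lookup v i)"
  by (auto simp: Poly_Mapping.map.rep_eq when_def iota_0)

lemma rho_add: "\<rho> (f + g) = \<rho> f + \<rho> g"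
  by (rule poly_mapping_eqI) (simp add: lookup_add residue_add)

lemma additive_rho: "additive \<rho>"
  by standard (rule rho_add)

lemma rho_scale: "\<rho> (free_scale c f) = free_scale (residue_map \<iota> A c) (\<rho> f)"
  by (rule poly_mapping_eqI) (simp add: residue_mult)

lemma kappa_add: "\<kappa> (v + w) = \<kappa> v + \<kappa> w"
  by (rule poly_mapping_eqI) (simp add: lookup_add iota_add)

lemma kappa_scale: "\<kappa> (free_scale c v) = free_scale (\<iota> c) (\<kappa> v)"
  by (rule poly_mapping_eqI) (simp add: iota_mult)

lemma rho_kappa: "\<rho> (\<kappa> v) = v"
  by (rule poly_mapping_eqI) (simp add: residue_iota)

lemma rho_eq_0_iff:
  assumes "f \<in> fcar m"
  shows "\<rho> f = 0 \<longleftrightarrow> f \<in> lmF (fcar m)"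
proof
  assume "\<rho> f = 0"
  then have "residue_map \<iota> A (lookup f i) = 0" for i
    using lookup_rho[of f i] by simp
  then show "f \<in> lmF (fcar m)" using assms by (simp add: fpow_1_iff residue_0_iff)
next
  assume f: "f \<in> lmF (fcar m)"
  show "\<rho> f = 0"
  proof (rule poly_mapping_eqI)
    fix i show "lookup (\<rho> f) i = lookup 0 i"
      using f by (cases "i < m") (auto simp: fpow_1_iff residue_0_iff[symmetric] fcar_iff residue_0 not_less)
  qed
qed

lemma k_tensor_component_iff:
  "v \<in> k_tensor_component F n j \<longleftrightarrow> (\<forall>i. lookup v i \<noteq> 0 \<longrightarrow> i < rk F n \<and> shft F n i = j)"
  by (auto simp: k_tensor_component_def in_keys_iff subset_iff)

lemma kappa_component:
  assumes "v \<in> k_tensor_component F n j"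
  shows "\<kappa> v \<in> fcomp (rk F n) (shft F n) j"
proof -
  note zero = IA_zero
  have "\<iota> (lookup v i) \<in> IA (j - shft F n i)" for i
    using assms zero by (cases "lookup v i = 0") (auto simp: k_tensor_component_iff iota_0 A_0)
  moreover have "\<iota> (lookup v i) = 0" if "rk F n \<le> i" for i
    using assms that by (cases "lookup v i = 0") (auto simp: k_tensor_component_iff iota_0)
  ultimately show ?thesis by (simp add: fcomp_def fcar_iff)
qed

lemma rho_component:
  assumes "f \<in> fcomp (rk F n) (shft F n) j"
  shows "\<rho> f \<in> k_tensor_component F n j"
  unfolding k_tensor_component_iff
proof (intro allI impI)
  fix i assume ne: "lookup (\<rho> f) i \<noteq> 0"
  have "i < rk F n"
    using ne assms by (cases "i < rk F n") (auto simp: fcomp_def fcar_iff residue_0)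
  moreover have "shft F n i = j"
  proof (rule ccontr)
    assume "shft F n i \<noteq> j"
    then have "dcomp IA 0 (lookup f i) = 0"
      using dcomp_homogeneous[OF ids_IA, of "lookup f i" "j - shft F n i" 0] assms \<open>i < rk F n\<close>
      by (auto simp: fcomp_def)
    then show False using ne residue_map_eq[of "lookup f i" 0] by (simp add: iota_0)
  qed
  ultimately show "i < rk F n \<and> shft F n i = j" ..
qed

text \<open>The vanishing of the homology of \<open>k \<otimes> F\<close>, lifted to \<open>F\<close>: the reduction \<open>\<rho>\<close> has the kernel \<open>\<mm>F\<close> and
  the homogeneous section \<open>\<kappa>\<close>. As \<open>dif F 0 = 0\<close>, all \<open>x\<close> count as cycles for \<open>n = 0\<close>.\<close>

lemma tor_dim_eq_0_iff:
  fixes s :: "'r \<Rightarrow> 'm::ab_group_add \<Rightarrow> 'm"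
  assumes R: "graded_free_resolution A s N V F"
  shows "tor_dim \<iota> A F n j = 0 \<longleftrightarrow>
    (\<forall>x\<in>fcomp (rk F n) (shft F n) j. dif F n x \<in> lmF (fcar (rk F (n - 1))) \<longrightarrow>
      (\<exists>y\<in>fcomp (rk F (Suc n)) (shft F (Suc n)) j. x - dif F (Suc n) y \<in> lmF (fcar (rk F n))))"
proof -
  interpret k: vector_space "free_scale :: 'k \<Rightarrow> _" by (rule vector_space_free_scale)
  let ?T = "k_tensor_dif \<iota> A F" and ?C = "k_tensor_component F"
  let ?FC = "\<lambda>n. fcomp (rk F n) (shft F n) j"
  let ?m = "\<lambda>n. lmF (fcar (rk F n))"
  let ?W = "{v \<in> ?C n j. ?T n v = 0}" and ?U = "?T (Suc n) ` ?C (Suc n) j"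
  have hom: "module_hom free_scale free_scale (dif F n)" for n by (rule resolution_dif_hom[OF R])
  have dif_add: "dif F n (x + y) = dif F n x + dif F n y" for n x y
    by (rule additive.add[OF resolution_dif_additive[OF R]])
  have dif_diff: "dif F n (x - y) = dif F n x - dif F n y" for n x y
    by (rule additive.diff[OF resolution_dif_additive[OF R]])
  have rho_diff: "\<rho> (f - g) = \<rho> f - \<rho> g" for f g by (rule additive.diff[OF additive_rho])
  have T: "?T n v = \<rho> (dif F n (\<kappa> v))" for n v by (simp add: k_tensor_dif_def)
  have T_add: "?T n (v + w) = ?T n v + ?T n w" for n v w
    by (simp add: T kappa_add dif_add rho_add)
  have T_scale: "?T n (free_scale c v) = free_scale c (?T n v)" for n c v
    by (simp add: T kappa_scale module_hom.scale[OF hom] rho_scale residue_iota)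
  have T_0: "?T n 0 = 0" for n
    using T_scale[of n 0 0] k.scale_zero_left by simp
  have FC: "x \<in> fcar (rk F n)" if "x \<in> ?FC n" for x n using that by (simp add: fcomp_def)
  have dif_FC: "dif F n x \<in> ?FC (n - 1)" if "x \<in> ?FC n" for n x
    using resolution_dif_comp[OF R, of n j] that by blast
  have dif_m: "dif F n x \<in> ?m (n - 1)" if "x \<in> ?m n" for n x
    using resolution_dif_fpow[OF R, of n 1] that by (auto simp: One_nat_def)
  have rep: "x - \<kappa> (\<rho> x) \<in> ?m n" if "x \<in> ?FC n" for x n
  proof -
    have "\<kappa> (\<rho> x) \<in> ?FC n" by (rule kappa_component[OF rho_component[OF that]])
    then have "x - \<kappa> (\<rho> x) \<in> fcar (rk F n)"
      using that by (intro additive_subgroup_diff[OF additive_subgroup_fcar] FC)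
    then show ?thesis by (simp add: rho_eq_0_iff[symmetric] rho_diff rho_kappa)
  qed
  have T_rho: "?T n (\<rho> x) = \<rho> (dif F n x)" if x: "x \<in> ?FC n" for n x
  proof -
    have "dif F n x - dif F n (\<kappa> (\<rho> x)) \<in> ?m (n - 1)"
      using dif_m[OF rep[OF x]] by (simp add: dif_diff)
    then have "\<rho> (dif F n x - dif F n (\<kappa> (\<rho> x))) = 0"
      using lmul_subset_subspace[OF module_free_scale subspace_fcar] by (subst rho_eq_0_iff) auto
    then show ?thesis by (simp add: rho_diff T)
  qed
  have subC: "k.subspace (?C n j)" for n
    by (rule k.subspaceI; simp add: k_tensor_component_iff lookup_add) (metis add_0)
  have "k.subspace ?W"
    using subC[of n] unfolding k.subspace_def by (simp add: T_add T_scale T_0)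
  moreover have "k.subspace ?U"
    unfolding k.subspace_def
  proof (intro conjI ballI allI)
    show "0 \<in> ?U" using T_0[of "Suc n"] k.subspace_0[OF subC, of "Suc n"] by (metis imageI)
    show "x + y \<in> ?U" if xy: "x \<in> ?U" "y \<in> ?U" for x y
    proof -
      obtain v w where "v \<in> ?C (Suc n) j" "w \<in> ?C (Suc n) j" "x = ?T (Suc n) v" "y = ?T (Suc n) w"
        using xy by blast
      then show ?thesis using k.subspace_add[OF subC] by (intro image_eqI[of _ _ "v + w"]) (simp_all add: T_add)
    qed
    show "free_scale c x \<in> ?U" if x: "x \<in> ?U" for c x
    proof -
      obtain v where "v \<in> ?C (Suc n) j" "x = ?T (Suc n) v" using x by blast
      then show ?thesis using k.subspace_scale[OF subC] by (intro image_eqI[of _ _ "free_scale c v"]) (simp_all add: T_scale)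
    qed
  qed
  moreover have "?U \<subseteq> ?W"
  proof
    fix v assume "v \<in> ?U"
    then obtain w where w: "w \<in> ?C (Suc n) j" "v = \<rho> (dif F (Suc n) (\<kappa> w))" by (auto simp: T)
    have x: "dif F (Suc n) (\<kappa> w) \<in> ?FC n"
      using dif_FC[OF kappa_component[OF w(1)]] by simp
    have "?T n v = 0"
      using T_rho[OF x] resolution_dif_dif[OF R FC[OF kappa_component[OF w(1)]]]
      by (simp add: w(2) additive.zero[OF additive_rho])
    then show "v \<in> ?W" using rho_component[OF x] w(2) by simp
  qed
  moreover have "?W \<subseteq> k.span (bvec ` {..<rk F n})"
  proof
    fix v assume "v \<in> ?W"
    then have "v \<in> fcar (rk F n)" by (auto simp: k_tensor_component_iff fcar_iff)
    from free_expansion[OF this]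
    show "v \<in> k.span (bvec ` {..<rk F n})"
      by (elim ssubst) (auto intro!: k.span_sum k.span_scale intro: k.span_base)
  qed
  ultimately have dim: "tor_dim \<iota> A F n j = 0 \<longleftrightarrow> ?W \<subseteq> ?U"
    unfolding tor_dim_def Suc_eq_plus1[symmetric] by (intro k.dim_diff_eq_0_iff) auto
  show ?thesis
    unfolding dim
  proof
    assume WU: "?W \<subseteq> ?U"
    show "\<forall>x\<in>?FC n. dif F n x \<in> ?m (n - 1) \<longrightarrow> (\<exists>y\<in>?FC (Suc n). x - dif F (Suc n) y \<in> ?m n)"
    proof (intro ballI impI)
      fix x assume x: "x \<in> ?FC n" "dif F n x \<in> ?m (n - 1)"
      have "\<rho> (dif F n x) = 0" using x(2) rho_eq_0_iff[OF FC[OF dif_FC[OF x(1)]]] by simp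
      then have "\<rho> x \<in> ?W" using rho_component[OF x(1)] T_rho[OF x(1)] by simp
      then obtain w where w: "w \<in> ?C (Suc n) j" "\<rho> x = \<rho> (dif F (Suc n) (\<kappa> w))"
        using WU by (auto simp: T)
      have y: "\<kappa> w \<in> ?FC (Suc n)" by (rule kappa_component[OF w(1)])
      have "x - dif F (Suc n) (\<kappa> w) \<in> fcar (rk F n)"
        using x(1) dif_FC[OF y] by (intro additive_subgroup_diff[OF additive_subgroup_fcar] FC) auto
      then have "x - dif F (Suc n) (\<kappa> w) \<in> ?m n"
        using w(2) by (simp add: rho_eq_0_iff[symmetric] rho_diff)
      then show "\<exists>y\<in>?FC (Suc n). x - dif F (Suc n) y \<in> ?m n" using y by blast
    qed
  next
    assume L: "\<forall>x\<in>?FC n. dif F n x \<in> ?m (n - 1) \<longrightarrow> (\<exists>y\<in>?FC (Suc n). x - dif F (Suc n) y \<in> ?m n)"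
    show "?W \<subseteq> ?U"
    proof
      fix v assume v: "v \<in> ?W"
      then have x: "\<kappa> v \<in> ?FC n" by (intro kappa_component) simp
      have "dif F n (\<kappa> v) \<in> ?m (n - 1)"
        using v rho_eq_0_iff[OF FC[OF dif_FC[OF x]]] by (simp add: T)
      then obtain y where y: "y \<in> ?FC (Suc n)" "\<kappa> v - dif F (Suc n) y \<in> ?m n" using L x by blast
      have "\<kappa> v - dif F (Suc n) y \<in> fcar (rk F n)"
        using x dif_FC[OF y(1)] by (intro additive_subgroup_diff[OF additive_subgroup_fcar] FC) auto
      then have "\<rho> (\<kappa> v - dif F (Suc n) y) = 0" using y(2) by (simp add: rho_eq_0_iff)
      then have "v = ?T (Suc n) (\<rho> y)" using T_rho[OF y(1)] by (simp add: rho_diff rho_kappa)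
      then show "v \<in> ?U" using rho_component[OF y(1)] by blast
    qed
  qed
qed

lemma lmul_fcomp: "lmF (fcomp m d (r - 1)) = lmF (fcar m) \<inter> fcomp m d r"
proof -
  note sub = fcomp_subgroup
  have sub': "additive_subgroup (lmF (fcomp m d (r - 1)))" for r
    by (rule lmul_additive_subgroup[OF module_free_scale sub])
  have "lmF (fcar m) = hsub (fcar m) (fcomp m d) (\<lambda>r. lmF (fcomp m d (r - 1)))"
    using lmul_hsub[OF graded_on_fcar sub subset_refl] by (simp add: hsub_self[OF ids_fcomp])
  then show ?thesis
    using hsub_homogeneous[OF ids_fcomp sub' lmul_component[OF graded_on_fcar subset_refl]] by blast
qed

lemma homogeneous_kernel:
  assumes R: "graded_free_resolution A s N V F"
  shows "{x \<in> fcomp (rk F 0) (shft F 0) r. aug F x = 0} = dif F (Suc 0) ` fcomp (rk F (Suc 0)) (shft F (Suc 0)) r" (is ?A)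
    and "n \<ge> 1 \<Longrightarrow> {x \<in> fcomp (rk F n) (shft F n) r. dif F n x = 0} =
      dif F (Suc n) ` fcomp (rk F (Suc n)) (shft F (Suc n)) r" (is "_ \<Longrightarrow> ?B")
proof -
  let ?FC = "\<lambda>n. fcomp (rk F n) (shft F n)"
  have *: "x \<in> dif F (Suc n) ` ?FC (Suc n) r"
    if x: "x \<in> ?FC n r" "x \<in> dif F (Suc n) ` fcar (rk F (Suc n))" for x n
  proof -
    obtain y where y: "y \<in> fcar (rk F (Suc n))" "x = dif F (Suc n) y" using x(2) by blast
    have "dcomp (?FC n) (id r) (dif F (Suc n) y) = dif F (Suc n) (dcomp (?FC (Suc n)) r y)"
      by (rule dcomp_additive[OF ids_fcomp ids_fcomp resolution_dif_additive[OF R] _ bij_id y(1)])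
        (use resolution_dif_comp[OF R, of "Suc n"] in auto)
    moreover have "dcomp (?FC n) r x = x" using dcomp_homogeneous[OF ids_fcomp x(1), of r] by simp
    ultimately show ?thesis using y(2) dcomp_mem[OF ids_fcomp y(1)] by (metis id_apply imageI)
  qed
  have comp: "dif F (Suc n) ` ?FC (Suc n) r \<subseteq> ?FC n r" for n
    using resolution_dif_comp[OF R, of "Suc n" r] by simp
  have car: "?FC n r \<subseteq> fcar (rk F n)" for n by (auto simp: fcomp_def)
  have restrict: "{x \<in> ?FC n r. p x} = dif F (Suc n) ` ?FC (Suc n) r"
    if ker: "{x \<in> fcar (rk F n). p x} = dif F (Suc n) ` fcar (rk F (Suc n))" for n p
  proof (intro equalityI subsetI)
    fix x assume x: "x \<in> {x \<in> ?FC n r. p x}"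
    then have "x \<in> {x \<in> fcar (rk F n). p x}" using car[of n] by auto
    then show "x \<in> dif F (Suc n) ` ?FC (Suc n) r" using *[of x n] x unfolding ker by simp
  next
    fix x assume x: "x \<in> dif F (Suc n) ` ?FC (Suc n) r"
    then have "x \<in> {x \<in> fcar (rk F n). p x}" unfolding ker using car[of "Suc n"] by (rule_tac image_mono[THEN subsetD])
    then show "x \<in> {x \<in> ?FC n r. p x}" using comp[of n] x by auto
  qed
  show ?A
    by (rule restrict) (use resolution_aug_ker[OF R] in \<open>simp add: One_nat_def\<close>)
  show ?B if "n \<ge> 1"
    by (rule restrict[OF resolution_ker[OF R that]])
qed

lemma resolution_aug_component:
  assumes R: "graded_free_resolution A s N V F" and D: "internal_direct_sum N V"
  shows "aug F ` fcomp (rk F 0) (shft F 0) r = V r"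
proof
  show "aug F ` fcomp (rk F 0) (shft F 0) r \<subseteq> V r" by (rule resolution_aug_comp[OF R])
  show "V r \<subseteq> aug F ` fcomp (rk F 0) (shft F 0) r"
  proof
    fix x assume x: "x \<in> V r"
    have "x \<in> N" using x by (rule ids_component_subset[OF D])
    then obtain y where y: "y \<in> fcar (rk F 0)" "x = aug F y" using resolution_aug_surj[OF R] by blast
    have "dcomp V (id r) (aug F y) = aug F (dcomp (fcomp (rk F 0) (shft F 0)) r y)"
      by (rule dcomp_additive[OF ids_fcomp D module_hom_imp_additive[OF resolution_aug_hom[OF R]] _ bij_id y(1)])
        (use resolution_aug_comp[OF R] in auto)
    moreover have "dcomp V r x = x" using dcomp_homogeneous[OF D x, of r] by simp
    ultimately show "x \<in> aug F ` fcomp (rk F 0) (shft F 0) r"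
      using y(2) dcomp_mem[OF ids_fcomp y(1)] by (metis id_apply imageI)
  qed
qed

text \<open>Here \<open>\<pi>\<close> is either the augmentation or a differential. These have different target types, and a lemma
  about one homogeneous map serves both. An element differs from a boundary by an element of \<open>\<mm>F\<close> iff
  it has the same image under \<open>\<pi>\<close> as an element of \<open>\<mm>F\<close>.\<close>

lemma boundary_criterion:
  assumes hom: "module_hom free_scale s \<pi>"
    and ker: "{x \<in> fcomp m d r. \<pi> x = 0} = \<delta> ` Y"
  shows "(\<forall>x\<in>fcomp m d r. D x \<longrightarrow> (\<exists>y\<in>Y. x - \<delta> y \<in> lmF (fcar m))) \<longleftrightarrow>
    (\<forall>x\<in>fcomp m d r. D x \<longrightarrow> \<pi> x \<in> lm s (\<pi> ` fcomp m d (r - 1)))"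
proof -
  interpret module_hom free_scale s \<pi> by fact
  note sub = fcomp_subgroup
  have "(\<exists>y\<in>Y. x - \<delta> y \<in> lmF (fcar m)) \<longleftrightarrow> \<pi> x \<in> lm s (\<pi> ` fcomp m d (r - 1))"
    if x: "x \<in> fcomp m d r" for x
  proof -
    have "(\<exists>y\<in>Y. x - \<delta> y \<in> lmF (fcar m)) \<longleftrightarrow>
        (\<exists>z\<in>\<delta> ` Y. x - z \<in> lmF (fcar m))" by blast
    also have "\<dots> \<longleftrightarrow> (\<exists>z\<in>fcomp m d r. \<pi> z = 0 \<and> x - z \<in> lmF (fcar m))"
      unfolding ker[symmetric] by blast
    also have "\<dots> \<longleftrightarrow> (\<exists>z\<in>fcomp m d r. \<pi> z = 0 \<and> x - z \<in> lmF (fcomp m d (r - 1)))"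
      using additive_subgroup_diff[OF sub x] unfolding lmul_fcomp by blast
    also have "\<dots> \<longleftrightarrow> \<pi> x \<in> \<pi> ` lmF (fcomp m d (r - 1))"
    proof
      assume "\<exists>z\<in>fcomp m d r. \<pi> z = 0 \<and> x - z \<in> lmF (fcomp m d (r - 1))"
      then obtain z where z: "\<pi> z = 0" "x - z \<in> lmF (fcomp m d (r - 1))" by blast
      have "\<pi> x = \<pi> (x - z)" using z(1) by (simp add: diff)
      then show "\<pi> x \<in> \<pi> ` lmF (fcomp m d (r - 1))" using z(2) by blast
    next
      assume "\<pi> x \<in> \<pi> ` lmF (fcomp m d (r - 1))"
      then obtain w where w: "w \<in> lmF (fcomp m d (r - 1))" "\<pi> x = \<pi> w" by blast
      have "x - w \<in> fcomp m d r"
        using w(1) by (intro additive_subgroup_diff[OF sub x]) (simp add: lmul_fcomp)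
      moreover have "\<pi> (x - w) = 0" "x - (x - w) = w" using w(2) by (simp_all add: diff)
      ultimately show "\<exists>z\<in>fcomp m d r. \<pi> z = 0 \<and> x - z \<in> lmF (fcomp m d (r - 1))"
        using w(1) by metis
    qed
    also have "\<dots> \<longleftrightarrow> \<pi> x \<in> lm s (\<pi> ` fcomp m d (r - 1))"
      unfolding hom_lmul_image[OF hom] ..
    finally show ?thesis .
  qed
  then show ?thesis by blast
qed

end

context linear_resolution
begin

text \<open>Dimension shifting in a fixed degree. The case \<open>n = 0\<close> is different because \<open>K \<otimes> F\<close> has homology
  \<open>F / \<mm>F\<close> there, which restricts the shift to elements of \<open>\<mm>F\<close>.\<close>

lemma
  fixes m :: nat and d :: "nat \<Rightarrow> int" and r :: int
  assumes hom: "module_hom free_scale s \<pi>"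
  defines "Z \<equiv> \<lambda>r. {x \<in> fcomp m d r. \<pi> x = 0}" and "W \<equiv> \<lambda>r. \<pi> ` fcomp m d r"
  shows graded_shift_Suc: "n \<ge> 1 \<Longrightarrow> kx s (Suc n) (W r) (W (r - 1)) \<longleftrightarrow> kxF n (Z (r + 1)) (Z r)"
    and graded_shift_0: "kx s (Suc 0) (W r) (W (r - 1)) \<longleftrightarrow>
      Z (r + 1) \<inter> lmF (fcar m) \<subseteq> lmF (Z r)"
proof -
  interpret module_hom free_scale s \<pi> by fact
  note sub = fcomp_subgroup
  have scale_comp: "free_scale (\<iota> c) x \<in> fcomp m d r" if "x \<in> fcomp m d r" for c x r
    by (rule subspace_homogeneous_component[OF graded_on_fcar that])
  have ZF: "Z r \<subseteq> fcomp m d r" for r by (auto simp: Z_def)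
  have Z0: "\<pi> z = 0" if "z \<in> Z r" for z r using that by (simp add: Z_def)
  have lm1: "lmF (fcomp m d (r - 1)) \<subseteq> fcomp m d r" for r by (simp add: lmul_fcomp)
  have F: "kxF (Suc n) (fcomp m d r) (fcomp m d (r - 1))" for n r
    by (rule kx_free_homogeneous) (simp add: One_nat_def)
  have subZ: "additive_subgroup (Z r)"
    using additive_subgroup_Int[OF sub[of m d r] additive_subgroup_vimage[of \<pi> "{0}"]]
    by (simp add: Z_def additive_def add additive_subgroup_def Int_def)
  have scaleZ: "free_scale (\<iota> c) x \<in> Z r" if "x \<in> Z r" for c x
    using that scale_comp scale[of "\<iota> c" x] by (simp add: Z_def m2.scale_zero_right)
  have down: "kx s (Suc n) (W r) (W (r - 1))"
    if "kxF n PZ (Z r)" "Z (r + 1) \<inter> lmF (fcar m) \<subseteq> PZ" for n PZ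
    unfolding W_def
  proof (rule kx_shift_down[OF hom sub F that(1) ZF Z0])
    show "x \<in> PZ" if x: "x \<in> lmF (fcomp m d r)" "\<pi> x = 0" for x
    proof -
      have "x \<in> lmF (fcar m) \<inter> fcomp m d (r + 1)"
        using x(1) lmul_fcomp[of m d "r + 1"] by simp
      then show ?thesis using x(2) \<open>Z (r + 1) \<inter> lmF (fcar m) \<subseteq> PZ\<close> unfolding Z_def by blast
    qed
  qed
  show "kx s (Suc n) (W r) (W (r - 1)) \<longleftrightarrow> kxF n (Z (r + 1)) (Z r)" if n: "n \<ge> 1"
  proof
    assume k: "kx s (Suc n) (W r) (W (r - 1))"
    have F': "kxF n (fcomp m d (r + 1)) (fcomp m d r)"
      using kx_free_homogeneous[OF n, of m d "r + 1"] by simp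
    show "kxF n (Z (r + 1)) (Z r)"
      by (rule kx_shift_up[OF hom sub F' k[unfolded W_def] lm1 ZF]) (simp_all add: Z_def)
  qed (rule down, auto)
  have "kx s (Suc 0) (W r) (W (r - 1)) \<longleftrightarrow> kxF 0 (Z (r + 1) \<inter> lmF (fcar m)) (Z r)"
  proof
    assume k: "kx s (Suc 0) (W r) (W (r - 1))"
    show "kxF 0 (Z (r + 1) \<inter> lmF (fcar m)) (Z r)"
    proof (rule kx_shift_up[OF hom sub kx_0_lmul[OF module_free_scale sub scale_comp] k[unfolded W_def] lm1])
      show "Z (r + 1) \<inter> lmF (fcar m) \<subseteq> lmF (fcomp m d r)"
        using lmul_fcomp[of m d "r + 1"] ZF[of "r + 1"] by auto
    qed (auto simp: Z_def)
  qed (rule down, auto)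
  also have "\<dots> \<longleftrightarrow> Z (r + 1) \<inter> lmF (fcar m) \<subseteq> lmF (Z r)"
  proof (rule kx_0_iff[OF module_free_scale _ subZ scaleZ])
    show "0 \<in> Z (r + 1) \<inter> lmF (fcar m)"
      using additive_subgroup_0[OF sub] by (simp add: Z_def zero lmul.zero)
  qed
  finally show "kx s (Suc 0) (W r) (W (r - 1)) \<longleftrightarrow>
      Z (r + 1) \<inter> lmF (fcar m) \<subseteq> lmF (Z r)" .
qed

text \<open>Tor may be computed from a resolution of either argument. Dimension shifting reduces the homology of
  \<open>K \<otimes> N\<close> in degree \<open>n\<close> to the \<open>n\<close>-th syzygies \<open>Z\<^sub>n\<close>, where it says in degree \<open>j\<close> that
  \<open>Z\<^sub>n \<inter> \<mm>F\<^bsub>n-1\<^esub> \<subseteq> \<mm>Z\<^sub>n\<close>; and this is also what the vanishing of the homology of \<open>k \<otimes> F\<close> means. For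
  \<open>n = 0\<close> both vanish iff \<open>N = \<mm>N\<close> in degree \<open>j\<close>.\<close>

theorem tor_dim_eq_0_iff_kx:
  assumes R: "graded_free_resolution A s N V F" and g: "graded_on s N V"
  shows "tor_dim \<iota> A F n (int n + r) = 0 \<longleftrightarrow> kx s n (V r) (V (r - 1))"
proof -
  let ?FC = "\<lambda>n. fcomp (rk F n) (shft F n)"
  let ?S = "\<lambda>n r. dif F n ` ?FC n r"
  let ?E = "\<lambda>n r. ?S n r \<inter> lmF (fcar (rk F (n - 1))) \<subseteq> lmF (?S n (r - 1))"
  note D = graded_on_ids[OF g]
  note aug = resolution_aug_component[OF R D]
  note s = graded_on_module[OF g]
  show ?thesis
  proof (cases n)
    case 0
    have "tor_dim \<iota> A F 0 r = 0 \<longleftrightarrow>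
      (\<forall>x\<in>?FC 0 r. True \<longrightarrow> (\<exists>y\<in>?FC (Suc 0) r. x - dif F (Suc 0) y \<in> lmF (fcar (rk F 0))))"
      unfolding tor_dim_eq_0_iff[OF R] by (simp add: resolution_dif_0[OF R] lmul.zero)
    also have "\<dots> \<longleftrightarrow> (\<forall>x\<in>?FC 0 r. True \<longrightarrow> aug F x \<in> lm s (aug F ` ?FC 0 (r - 1)))"
      by (rule boundary_criterion[OF resolution_aug_hom[OF R] homogeneous_kernel(1)[OF R]])
    also have "\<dots> \<longleftrightarrow> V r \<subseteq> lm s (V (r - 1))"
      unfolding aug[symmetric] by blast
    also have "\<dots> \<longleftrightarrow> kx s 0 (V r) (V (r - 1))"
      by (rule kx_0_iff[OF s additive_subgroup_0[OF ids_subgroup[OF D]]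
            ids_subgroup[OF D] subspace_homogeneous_component[OF g], symmetric])
    finally show ?thesis using 0 by simp
  next
    case (Suc p)
    have tor: "tor_dim \<iota> A F (Suc p) j = 0 \<longleftrightarrow> ?E (Suc p) j" for p j
    proof -
      have p: "Suc p \<ge> 1" by (simp add: One_nat_def)
      have "tor_dim \<iota> A F (Suc p) j = 0 \<longleftrightarrow> (\<forall>x\<in>?FC (Suc p) j.
          dif F (Suc p) x \<in> lmF (fcar (rk F (Suc p - 1))) \<longrightarrow>
          dif F (Suc p) x \<in> lmF (dif F (Suc p) ` ?FC (Suc p) (j - 1)))"
        unfolding tor_dim_eq_0_iff[OF R]
        by (rule boundary_criterion[OF resolution_dif_hom[OF R] homogeneous_kernel(2)[OF R p]])
      then show ?thesis by blast
    qed
    have step: "kxF (Suc n) (?S i r) (?S i (r - 1)) \<longleftrightarrow> ?E (Suc (i + n)) (r + 1 + int n)"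
      if "i \<ge> 1" for n i r
      using that
    proof (induct n arbitrary: i r)
      case 0
      show ?case
        using graded_shift_0[OF resolution_dif_hom[OF R, of i], where m = "rk F i" and d = "shft F i" and r = r]
        by (simp add: homogeneous_kernel(2)[OF R 0])
    next
      case (Suc n)
      have "kxF (Suc (Suc n)) (?S i r) (?S i (r - 1)) \<longleftrightarrow>
          kxF (Suc n) (?S (Suc i) (r + 1)) (?S (Suc i) r)"
        using graded_shift_Suc[OF resolution_dif_hom[OF R, of i], where n = "Suc n" and m = "rk F i" and d = "shft F i" and r = r]
        by (simp add: homogeneous_kernel(2)[OF R Suc(2)])
      also have "\<dots> \<longleftrightarrow> ?E (Suc (Suc i + n)) (r + 1 + 1 + int n)"
        using Suc(1)[of "Suc i" "r + 1"] by (simp add: One_nat_def)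
      finally show ?case by (simp add: algebra_simps)
    qed
    have "kx s (Suc p) (V r) (V (r - 1)) \<longleftrightarrow> ?E (Suc p) (r + 1 + int p)"
    proof (cases p)
      case 0
      show ?thesis
        using graded_shift_0[OF resolution_aug_hom[OF R], where m = "rk F 0" and d = "shft F 0" and r = r]
        by (simp add: homogeneous_kernel(1)[OF R] aug 0)
    next
      case (Suc q)
      have "kx s (Suc (Suc q)) (V r) (V (r - 1)) \<longleftrightarrow>
          kxF (Suc q) (?S (Suc 0) (r + 1)) (?S (Suc 0) r)"
        using graded_shift_Suc[OF resolution_aug_hom[OF R], where n = "Suc q" and m = "rk F 0" and d = "shft F 0" and r = r]
        by (simp add: homogeneous_kernel(1)[OF R] aug)
      also have "\<dots> \<longleftrightarrow> ?E (Suc (Suc 0 + q)) (r + 1 + 1 + int q)"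
        using step[of "Suc 0" q "r + 1"] by (simp add: One_nat_def)
      finally show ?thesis by (simp add: Suc algebra_simps)
    qed
    then show ?thesis using tor[of p "int (Suc p) + r"] Suc by (simp add: algebra_simps)
  qed
qed

lemma has_linear_resolution_iff_kx:
  assumes g: "graded_on s N V" and N: "fin_generated s N"
  shows "has_linear_resolution \<iota> A s N V i \<longleftrightarrow> (\<forall>n r. r \<noteq> i \<longrightarrow> kx s n (V r) (V (r - 1)))"
proof -
  define F where "F = (SOME F. graded_free_resolution A s N V F)"
  have "\<exists>F. graded_free_resolution A s N V F"
    using minimal_resolution_exists[OF g N] by (auto simp: minimal_graded_free_resolution_def)
  then have "graded_free_resolution A s N V F" unfolding F_def by (rule someI_ex)
  from tor_dim_eq_0_iff_kx[OF this g] show ?thesis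
    by (simp add: has_linear_resolution_def betti_def F_def[symmetric])
qed

text \<open>The component of \<open>M\<^bsub>\<langle>i\<rangle>\<^esub>\<close> of degree \<open>r\<close> is \<open>R\<^bsub>r-i\<^esub> M\<^sub>i\<close> for \<open>r \<ge> i\<close> and zero for \<open>r < i\<close>, so that only
  the degrees \<open>r > i\<close> impose a condition.\<close>

theorem componentwise_linear_iff_kx:
  assumes g: "graded_on s UNIV G" and M: "fin_generated s (UNIV :: 'm::ab_group_add set)"
  shows "componentwise_linear \<iota> A s G \<longleftrightarrow> (\<forall>n i q. kx s n ((lm s ^^ Suc q) (G i)) ((lm s ^^ q) (G i)))"
proof -
  note s = graded_on_module[OF g]
  let ?N = "\<lambda>i. module.span s (G i)"
  let ?V = "\<lambda>i r. if r < i then {0} else (lm s ^^ nat (r - i)) (G i)"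
  have V: "?N i \<inter> G r = ?V i r" for i r by (rule span_component_homogeneous[OF g])
  have fg: "fin_generated s (?N i)" for i
    by (rule fin_generated_subspace[OF s M module.subspace_span[OF s] subset_UNIV])
  have "componentwise_linear \<iota> A s G \<longleftrightarrow> (\<forall>i n r. r \<noteq> i \<longrightarrow> kx s n (?V i r) (?V i (r - 1)))"
    unfolding componentwise_linear_def
    using has_linear_resolution_iff_kx[OF graded_on_span_component[OF g] fg] by (simp only: V)
  also have "\<dots> \<longleftrightarrow> (\<forall>n i q. kx s n ((lm s ^^ Suc q) (G i)) ((lm s ^^ q) (G i)))"
  proof (intro iffI allI impI)
    fix n i q assume L: "\<forall>i n r. r \<noteq> i \<longrightarrow> kx s n (?V i r) (?V i (r - 1))"
    have "nat (i + int (Suc q) - i) = Suc q" "nat (i + int (Suc q) - 1 - i) = q" by simp_all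
    then show "kx s n ((lm s ^^ Suc q) (G i)) ((lm s ^^ q) (G i))"
      using L[rule_format, of "i + int (Suc q)" i n] by (simp del: funpow.simps)
  next
    fix i n and r :: int
    assume K: "\<forall>n i q. kx s n ((lm s ^^ Suc q) (G i)) ((lm s ^^ q) (G i))" and r: "r \<noteq> i"
    show "kx s n (?V i r) (?V i (r - 1))"
    proof (cases "r < i")
      case True
      then show ?thesis using kexact_zero[OF s, of "{0}"] by simp
    next
      case False
      then have "nat (r - i) = Suc (nat (r - 1 - i))" "\<not> r - 1 < i" using r by simp_all
      then show ?thesis using K False by (simp del: funpow.simps)
    qed
  qed
  finally show ?thesis .
qed

theorem koszul_iff_componentwise_linear:
  assumes g: "graded_on s UNIV G" and M: "fin_generated s (UNIV :: 'm::ab_group_add set)"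
  shows "koszul_module A s UNIV G \<longleftrightarrow> componentwise_linear \<iota> A s G"
proof -
  obtain F where F: "minimal_graded_free_resolution A s UNIV G F"
    "koszul_module A s UNIV G \<longleftrightarrow> (\<forall>n\<ge>1. strict_syzygy F n)"
    by (rule koszul_module_iff_strict[OF g M])
  show ?thesis
    unfolding F(2) strict_iff_kx[OF F(1)] componentwise_linear_iff_kx[OF g M]
    using kx_powers_iff[OF g] by blast
qed

end

theorem theorem5p6:
  fixes \<iota> :: "'k::field \<Rightarrow> 'r::comm_ring_1"
    and A :: "nat \<Rightarrow> 'r set"
    and s :: "'r \<Rightarrow> 'm::ab_group_add \<Rightarrow> 'm"
    and G :: "int \<Rightarrow> 'm set"
  assumes "standard_graded_algebra \<iota> A"
    and "koszul_algebra \<iota> A"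
    and "graded_module A s G"
    and "fin_generated s (UNIV :: 'm set)"
  shows "koszul_module A s UNIV G \<longleftrightarrow> componentwise_linear \<iota> A s G"
proof -
  interpret std_graded \<iota> A using assms(1) by unfold_locales
  obtain b a where "linear_resolution \<iota> A b a"
    by (rule koszul_linear_resolution[OF assms(2)])
  then interpret linear_resolution \<iota> A b a .
  show ?thesis
    by (rule koszul_iff_componentwise_linear[OF _ assms(4)]) (simp add: graded_on_UNIV assms(3))
qed

end
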